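(* Let $\lambda=\frac{1}{w(N-1)}$ and $D=\frac{1}{\beta w^2(N-1)}$. Suppose $\lambda\lesssim O(1)$ (that is, $\lambda$ is at most of order one). Suppose that $V:\mathbb{R}^d\to\mathbb{R}$ and $U_1:\mathbb{R}^d\to\mathbb{R}$ are smooth, and that their derivatives up to third order are bounded. Let $Q(x,\cdot)$ be the transition probability, over the time interval $[0,T]$, of the SDE $$dY=-\Big(\lambda\nabla V(Y)+\frac{1}{N-1}\sum_{j\ne i}\nabla U_1(Y-x_j)\Big)\,dt+\sqrt{2D}\,dW,\qquad Y(0)=x,$$ and let $\widetilde Q(x,\cdot)$ be the transition probability computed by its discretization with random batch and constant step size $\tau>0$, i.e. the law of $Y^m$ with $m\tau=T$, where $Y^0=x$ and, for $k=0,\dots,m-1$, $$Y^{k+1}=Y^k-\tau\Big[\lambda\nabla V(Y^k)+\frac{1}{p-1}\sum_{j\in\xi_k}\nabla U_1(Y^k-x_j)\Big]+\sqrt{2D\tau}\,z_k .$$ Then, for a constant $C$, $$\sup_{x}W_2\big(Q(x,\cdot),\widetilde Q(x,\cdot)\big)\le C\sqrt{(e^{CT}-1)\Big(\frac{1}{p-1}\|\nabla U_1\|_\infty\,\tau+(1+D^2)\tau^2\Big)}.$$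
   Context: $N$ is the number of particles in $\mathbb{R}^d$, $w>0$ is the common particle weight and $\beta>0$ is a constant (inverse temperature). The index $i\in\{1,\dots,N\}$ is the chosen particle being moved, and the positions $x_j\in\mathbb{R}^d$, $j\ne i$, of the other particles are held fixed. $V$ is the external potential, and $U_1$ is the smooth part in a splitting of the pair interaction potential. $W$ is a standard $d$-dimensional Brownian motion. The integer $p>1$ is the batch size; for each $k$, $\xi_k$ is a random subset of $\{1,\dots,N\}\setminus\{i\}$ of size $p-1$ (chosen uniformly, without replacement, freshly at each step), and $z_k\sim\mathcal{N}(0,I_d)$ are independent standard Gaussian vectors, independent of the batches. For probability measures $\mu,\nu$ on $\mathbb{R}^d$, the Wasserstein-2 distance is $$W_2(\mu,\nu)=\Big(\inf_{\gamma\in\Pi(\mu,\nu)}\int_{\mathbb{R}^d\times\mathbb{R}^d}|x-y|^2\,d\gamma\Big)^{1/2},$$ where $\Pi(\mu,\nu)$ is the set of joint distributions with marginals $\mu$ and $\nu$. $\|\nabla U_1\|_\infty$ is the supremum norm of $\nabla U_1$. The source does not specify on which quantities the constant $C$ depends. *)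

theory Defs
  imports "HOL-Probability.Probability"
begin

section \<open>Smooth functions on Euclidean space\<close>

definition partial :: "'d::finite \<Rightarrow> (real ^ 'd \<Rightarrow> real) \<Rightarrow> real ^ 'd \<Rightarrow> real" where
  "partial j f x = frechet_derivative f (at x) (axis j 1)"

primrec partials :: "'d::finite list \<Rightarrow> (real ^ 'd \<Rightarrow> real) \<Rightarrow> real ^ 'd \<Rightarrow> real" where
  "partials [] f = f"
| "partials (j # js) f = partial j (partials js f)"

text \<open>Differentiability of every iterated partial derivative forces each of them to be continuous,
  so this is the class of infinitely often continuously differentiable functions.\<close>

definition smooth :: "(real ^ 'd::finite \<Rightarrow> real) \<Rightarrow> bool" where
  "smooth f \<longleftrightarrow> (\<forall>js x. partials js f differentiable (at x))"

text \<open>Only the derivatives of order 1, 2 and 3 are bounded, not the function itself.\<close>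

definition derivs_bounded :: "real \<Rightarrow> (real ^ 'd::finite \<Rightarrow> real) \<Rightarrow> bool" where
  "derivs_bounded K f \<longleftrightarrow>
     (\<forall>js x. 1 \<le> length js \<and> length js \<le> 3 \<longrightarrow> \<bar>partials js f x\<bar> \<le> K)"

definition grad :: "(real ^ 'd::finite \<Rightarrow> real) \<Rightarrow> real ^ 'd \<Rightarrow> real ^ 'd" where
  "grad f x = (THE g. GDERIV f x :> g)"


section \<open>Wasserstein-2 distance\<close>

definition couplings ::
    "'a::second_countable_topology measure \<Rightarrow> 'a measure \<Rightarrow> ('a \<times> 'a) measure set" where
  "couplings \<mu> \<nu> = {\<gamma>. sets \<gamma> = sets (borel \<Otimes>\<^sub>M borel) \<and> distr \<gamma> borel fst = \<mu> \<and> distr \<gamma> borel snd = \<nu>}"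

definition ennreal_sqrt :: "ennreal \<Rightarrow> ennreal" where
  "ennreal_sqrt a = (if a = \<top> then \<top> else ennreal (sqrt (enn2real a)))"

definition W2 :: "'a::euclidean_space measure \<Rightarrow> 'a measure \<Rightarrow> ennreal" where
  "W2 \<mu> \<nu> = ennreal_sqrt (INF \<gamma>\<in>couplings \<mu> \<nu>. \<integral>\<^sup>+ q. ennreal ((norm (fst q - snd q))\<^sup>2) \<partial>\<gamma>)"


section \<open>Brownian motion and stochastic differential equations with additive noise\<close>

text \<open>The law of \<open>s\<close> times a standard Gaussian vector, for \<open>s > 0\<close>.\<close>

definition gaussian :: "real \<Rightarrow> (real ^ 'd::finite) measure" where
  "gaussian s = density lborel (\<lambda>x. ennreal (\<Prod>j\<in>UNIV. normal_density 0 s (x $ j)))"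

text \<open>The events of \<open>M\<close> determined by \<open>X\<close>. The library's \<open>indep_var\<close> requires both random variables
  to have the same value type, so independence is stated through these events instead.\<close>

definition preimages :: "'w measure \<Rightarrow> 'b measure \<Rightarrow> ('w \<Rightarrow> 'b) \<Rightarrow> 'w set set" where
  "preimages M N X = {X -` A \<inter> space M | A. A \<in> sets N}"

definition brownian_motion ::
    "'w measure \<Rightarrow> (real \<Rightarrow> 'w measure) \<Rightarrow> (real \<Rightarrow> 'w \<Rightarrow> real ^ 'd::finite) \<Rightarrow> bool" where
  "brownian_motion M F W \<longleftrightarrow>
     prob_space M \<and> filtration (space M) F \<and> (\<forall>t. subalgebra M (F t)) \<and>
     (\<forall>t\<ge>0. W t \<in> borel_measurable (F t)) \<and>
     (AE \<omega> in M. W 0 \<omega> = 0 \<and> continuous_on {0..} (\<lambda>t. W t \<omega>)) \<and>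
     (\<forall>s t. 0 \<le> s \<and> s < t \<longrightarrow>
        distr M borel (\<lambda>\<omega>. W t \<omega> - W s \<omega>) = gaussian (sqrt (t - s)) \<and>
        prob_space.indep_set M (sets (F s)) (preimages M borel (\<lambda>\<omega>. W t \<omega> - W s \<omega>)))"

text \<open>\<open>Y\<close> solves \<open>dY = b(Y) dt + s dW\<close>, \<open>Y(0) = x\<close>, on \<open>[0,T]\<close>. The diffusion coefficient is
  constant and \<open>W 0 = 0\<close> almost surely, so the stochastic integral of \<open>s\<close> over \<open>[0,t]\<close> is \<open>s W(t)\<close>.\<close>

definition sde_solution ::
    "'w measure \<Rightarrow> (real \<Rightarrow> 'w measure) \<Rightarrow> (real \<Rightarrow> 'w \<Rightarrow> real ^ 'd::finite) \<Rightarrow>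
     (real ^ 'd \<Rightarrow> real ^ 'd) \<Rightarrow> real \<Rightarrow> real ^ 'd \<Rightarrow> real \<Rightarrow> (real \<Rightarrow> 'w \<Rightarrow> real ^ 'd) \<Rightarrow> bool" where
  "sde_solution M F W b s x T Y \<longleftrightarrow>
     (\<forall>t\<in>{0..T}. Y t \<in> borel_measurable (F t)) \<and>
     (AE \<omega> in M. continuous_on {0..T} (\<lambda>t. Y t \<omega>) \<and>
        (\<forall>t\<in>{0..T}. Y t \<omega> = x + integral {0..t} (\<lambda>u. b (Y u \<omega>)) + s *\<^sub>R W t \<omega>))"


section \<open>Interacting particles and the random batch scheme\<close>

definition full_drift ::
    "real \<Rightarrow> (real ^ 'd::finite \<Rightarrow> real) \<Rightarrow> (real ^ 'd \<Rightarrow> real) \<Rightarrow> nat \<Rightarrow> nat \<Rightarrow> (nat \<Rightarrow> real ^ 'd) \<Rightarrow>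
     real ^ 'd \<Rightarrow> real ^ 'd" where
  "full_drift lam V U1 N i xs y =
     - (lam *\<^sub>R grad V y + (1 / (real N - 1)) *\<^sub>R (\<Sum>j\<in>{1..N} - {i}. grad U1 (y - xs j)))"

definition batch_drift ::
    "real \<Rightarrow> (real ^ 'd::finite \<Rightarrow> real) \<Rightarrow> (real ^ 'd \<Rightarrow> real) \<Rightarrow> nat \<Rightarrow> nat set \<Rightarrow> (nat \<Rightarrow> real ^ 'd) \<Rightarrow>
     real ^ 'd \<Rightarrow> real ^ 'd" where
  "batch_drift lam V U1 p S xs y =
     - (lam *\<^sub>R grad V y + (1 / (real p - 1)) *\<^sub>R (\<Sum>j\<in>S. grad U1 (y - xs j)))"

definition batches :: "nat \<Rightarrow> nat \<Rightarrow> nat \<Rightarrow> nat set set" where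
  "batches N i p = {S. S \<subseteq> {1..N} - {i} \<and> card S = p - 1}"

definition batch_noise ::
    "'v measure \<Rightarrow> nat \<Rightarrow> nat \<Rightarrow> nat \<Rightarrow> (nat \<Rightarrow> 'v \<Rightarrow> nat set) \<Rightarrow> (nat \<Rightarrow> 'v \<Rightarrow> real ^ 'd::finite) \<Rightarrow> bool" where
  "batch_noise M N i p \<xi> z \<longleftrightarrow>
     prob_space M \<and>
     prob_space.indep_vars M (\<lambda>_. count_space (batches N i p)) \<xi> UNIV \<and>
     prob_space.indep_vars M (\<lambda>_. borel) z UNIV \<and>
     prob_space.indep_set M
       (preimages M (\<Pi>\<^sub>M k\<in>UNIV. count_space (batches N i p)) (\<lambda>\<omega> k. \<xi> k \<omega>))
       (preimages M (\<Pi>\<^sub>M k\<in>UNIV. borel) (\<lambda>\<omega> k. z k \<omega>)) \<and>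
     (\<forall>k. distr M (count_space (batches N i p)) (\<xi> k) = uniform_count_measure (batches N i p)) \<and>
     (\<forall>k. distr M borel (z k) = gaussian 1)"

primrec rb_chain ::
    "(nat set \<Rightarrow> real ^ 'd::finite \<Rightarrow> real ^ 'd) \<Rightarrow> real \<Rightarrow> real \<Rightarrow> (nat \<Rightarrow> nat set) \<Rightarrow> (nat \<Rightarrow> real ^ 'd) \<Rightarrow>
     real ^ 'd \<Rightarrow> nat \<Rightarrow> real ^ 'd" where
  "rb_chain b D \<tau> \<xi> z x 0 = x"
| "rb_chain b D \<tau> \<xi> z x (Suc k) =
     rb_chain b D \<tau> \<xi> z x k + \<tau> *\<^sub>R b (\<xi> k) (rb_chain b D \<tau> \<xi> z x k) + sqrt (2 * D * \<tau>) *\<^sub>R z k"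

end

theory Submission
  imports Defs
begin

text \<open>Couple the diffusion and the random batch scheme synchronously: on the product of the two
  probability spaces, run the scheme with the batches of one factor and the Brownian increments of
  the other. Write \<open>e\<close> for the difference of the two processes at a grid point. One step gives
  \<open>e' = A + R + G + \<tau> \<chi>\<close>, where \<open>A\<close> is the error propagated by the full drift,
  \<open>G = sqrt (2 D) Db(Y) (\<integral> W(s) - W(t) ds)\<close> is the linear part of the response of the drift to the
  noise, \<open>R\<close> is a Taylor remainder of second moment \<open>O((1 + D\<^sup>2) \<tau>\<^sup>4)\<close>, and \<open>\<chi>\<close> is the
  fluctuation of the batch drift. Both \<open>G\<close> and \<open>\<chi>\<close> are centered given the past, so their cross
  terms with \<open>A\<close> vanish and only their variances \<open>O(D \<tau>\<^sup>3)\<close> and \<open>O(1 / (p - 1))\<close> enter. Summing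
  the resulting recursion for the second moment of \<open>e\<close> gives the bound. Since the noise is additive,
  a Taylor expansion of the drift replaces Ito's formula.\<close>

section \<open>Bounds from bounded partial derivatives\<close>

text \<open>The obstacle is the power of \<tau>. There are \<open>T / \<tau>\<close> steps, so a
  squared error of order \<open>\<tau>^2\<close> allows only \<open>\<tau>^3\<close> per step.
  Young's inequality for the cross term of \<open>A\<close> with \<open>G\<close> would leave
  \<open>D \<tau>^3 / \<tau>\<close> per step, and for the cross term with
  \<open>\<tau> \<chi>\<close> it would leave a total that does not vanish with \<tau>. Hence the
  linear response to the noise is split off from the drift increment: the rest, \<open>R\<close>, is
  small enough to pay the factor \<open>1 / \<tau>\<close>. Third derivatives serve to make the
  Taylor remainder of the gradients quadratic. The two centerings use different randomness: \<chi>
  is averaged over the current batch with the Brownian path frozen, \<open>G\<close> over the path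
  with the batches frozen. The product space turns both into applications of Fubini's theorem,
  without conditional expectations. The constant depends on the dimension, \<open>K\<close> and
  \<open>Lam\<close> only.\<close>

lemma has_derivative_partials:
  fixes f :: "real ^ 'd::finite \<Rightarrow> real"
  assumes "f differentiable (at x)"
  shows "(f has_derivative (\<lambda>h. \<Sum>j\<in>UNIV. h $ j * partial j f x)) (at x)"
proof -
  have d: "(f has_derivative frechet_derivative f (at x)) (at x)"
    using assms frechet_derivative_works by blast
  then have l: "linear (frechet_derivative f (at x))"
    by (rule has_derivative_linear)
  have "frechet_derivative f (at x) = (\<lambda>h. \<Sum>j\<in>UNIV. h $ j * partial j f x)"
  proof
    fix h :: "real ^ 'd"
    have "h = (\<Sum>j\<in>UNIV. h $ j *\<^sub>R axis j 1)"
      by (simp add: basis_expansion scalar_mult_eq_scaleR [symmetric])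
    then have "frechet_derivative f (at x) h = (\<Sum>j\<in>UNIV. frechet_derivative f (at x) (h $ j *\<^sub>R axis j 1))"
      by (metis (no_types, lifting) l linear_sum sum.cong)
    also have "\<dots> = (\<Sum>j\<in>UNIV. h $ j * partial j f x)"
      by (simp add: linear_scale[OF l] partial_def)
    finally show "frechet_derivative f (at x) h = \<dots>" .
  qed
  with d show ?thesis by simp
qed

lemma smooth_differentiable: "smooth f \<Longrightarrow> partials js f differentiable (at x)"
  by (auto simp: smooth_def)

lemma continuous_on_partials: "smooth f \<Longrightarrow> continuous_on UNIV (partials js f)"
  by (simp add: smooth_differentiable continuous_at_imp_continuous_on differentiable_imp_continuous_within)

lemma abs_sum_component_mult_le:
  fixes h :: "real ^ 'd::finite"
  assumes "\<And>j. \<bar>c j\<bar> \<le> B"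
  shows "\<bar>\<Sum>j\<in>UNIV. h $ j * c j\<bar> \<le> real CARD('d) * B * norm h"
proof -
  have "\<bar>\<Sum>j\<in>UNIV. h $ j * c j\<bar> \<le> (\<Sum>j\<in>(UNIV::'d set). norm h * B)"
  proof (rule order_trans[OF sum_abs sum_mono])
    show "\<bar>h $ j * c j\<bar> \<le> norm h * B" for j
      using assms[of j] component_le_norm_cart[of h j] by (simp add: abs_mult mult_mono)
  qed
  then show ?thesis by (simp add: mult_ac)
qed

lemma partial_bounded_lipschitz:
  fixes f :: "real ^ 'd::finite \<Rightarrow> real"
  assumes "\<And>x. f differentiable (at x)" "\<And>j x. \<bar>partial j f x\<bar> \<le> B"
  shows "\<bar>f y - f x\<bar> \<le> real CARD('d) * B * norm (y - x)"
proof -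
  have B: "0 \<le> B" using assms(2)[of undefined undefined] by linarith
  have "norm (f y - f x) \<le> real CARD('d) * B * norm (y - x)"
  proof (rule differentiable_bound[OF convex_UNIV])
    show "(f has_derivative (\<lambda>h. \<Sum>j\<in>UNIV. h $ j * partial j f z)) (at z within UNIV)" for z
      using has_derivative_partials[OF assms(1)] .
    show "onorm (\<lambda>h. \<Sum>j\<in>UNIV. h $ j * partial j f z) \<le> real CARD('d) * B" for z
      using abs_sum_component_mult_le[of "\<lambda>j. partial j f z" B] assms(2) B
      by (intro onorm_bound) auto
  qed auto
  then show ?thesis by simp
qed

text \<open>The mean value inequality on the segment from \<open>x\<close> to \<open>x + h\<close>,
  applied to \<open>f\<close> minus its linearization at \<open>x\<close>: the derivative moves
  there by at most a multiple of \<open>norm h\<close>. The sharp factor 1/2 is lost because the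
  derivative is bounded by its worst value on the segment.\<close>

lemma partial_lipschitz_taylor:
  fixes f :: "real ^ 'd::finite \<Rightarrow> real"
  assumes "\<And>x. f differentiable (at x)"
    and lip: "\<And>j x y. \<bar>partial j f y - partial j f x\<bar> \<le> B * norm (y - x)" and B: "0 \<le> B"
  shows "\<bar>f (x + h) - f x - (\<Sum>j\<in>UNIV. h $ j * partial j f x)\<bar> \<le> real CARD('d) * B * (norm h)\<^sup>2"
proof -
  let ?S = "closed_segment x (x + h)"
  let ?D = "\<lambda>z h. \<Sum>j\<in>UNIV. h $ j * partial j f z"
  have "norm (f (x + h) - f x - ?D x (x + h - x)) \<le> norm (x + h - x) * (real CARD('d) * (B * norm h))"
  proof (rule differentiable_bound_linearization[where S = ?S])
    show "(f has_derivative ?D z) (at z within ?S)" for z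
      using has_derivative_partials[OF assms(1)] has_derivative_at_withinI by blast
    show "t \<in> {0..1} \<Longrightarrow> x + t *\<^sub>R (x + h - x) \<in> ?S" for t
      by (auto simp: closed_segment_def algebra_simps intro!: exI[of _ t])
    show "onorm (?D z - ?D x) \<le> real CARD('d) * (B * norm h)" if "z \<in> ?S" for z
    proof -
      have "norm (z - x) \<le> norm h"
        using segment_bound1[OF that] by simp
      then have *: "\<bar>partial j f z - partial j f x\<bar> \<le> B * norm h" for j
        using lip[of j z x] mult_left_mono[OF _ B] order_trans by blast
      have "(?D z - ?D x) = (\<lambda>h. \<Sum>j\<in>UNIV. h $ j * (partial j f z - partial j f x))"
        by (simp add: fun_eq_iff sum_subtractf right_diff_distrib)
      then show ?thesis
        using abs_sum_component_mult_le[OF *] B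
        by (auto intro!: onorm_bound)
    qed
  qed auto
  then show ?thesis by (simp add: power2_eq_square mult_ac)
qed

text \<open>\<open>grad\<close> is a definite description, so uniqueness is needed too: the
  derivative is unique as a linear map, and its inner products with all \<open>h\<close> determine
  the representing vector.\<close>

lemma grad_eq:
  fixes f :: "real ^ 'd::finite \<Rightarrow> real"
  assumes "f differentiable (at x)"
  shows "grad f x = (\<chi> j. partial j f x)"
proof -
  have "(\<lambda>h. \<Sum>j\<in>UNIV. h $ j * partial j f x) = (\<lambda>h. h \<bullet> (\<chi> j. partial j f x))"
    by (simp add: fun_eq_iff inner_vec_def)
  then have g: "GDERIV f x :> (\<chi> j. partial j f x)"
    using has_derivative_partials[OF assms] by (simp add: gderiv_def)
  show ?thesis unfolding grad_def
  proof (rule the_equality, rule g)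
    fix g' assume "GDERIV f x :> g'"
    then have "(\<lambda>h. h \<bullet> g') = (\<lambda>h. h \<bullet> (\<chi> j. partial j f x))"
      using g has_derivative_unique unfolding gderiv_def by blast
    then show "g' = (\<chi> j. partial j f x)"
      by (metis inner_commute vector_eq_ldot)
  qed
qed

text \<open>A linear map in the direction \<open>h\<close> rather than a matrix: it has to be pulled
  out of the time integral of the noise and expanded along the axes.\<close>

definition hess :: "(real ^ 'd::finite \<Rightarrow> real) \<Rightarrow> real ^ 'd \<Rightarrow> real ^ 'd \<Rightarrow> real ^ 'd" where
  "hess f x h = (\<chi> j. \<Sum>l\<in>UNIV. h $ l * partial l (partial j f) x)"

lemma linear_hess: "linear (hess f x)"
  by (rule linearI)
    (auto simp: hess_def vec_eq_iff sum.distrib sum_distrib_left algebra_simps)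

lemma norm_le_card_component:
  fixes v :: "real ^ 'd::finite"
  assumes "\<And>j. \<bar>v $ j\<bar> \<le> B"
  shows "norm v \<le> real CARD('d) * B"
proof -
  have "norm v \<le> (\<Sum>j\<in>UNIV. \<bar>v $ j\<bar>)" by (rule norm_le_l1_cart)
  also have "\<dots> \<le> (\<Sum>j\<in>(UNIV::'d set). B)" using assms by (intro sum_mono)
  finally show ?thesis by simp
qed

lemma one_le_card_finite: "1 \<le> real CARD('d::finite)"
  using zero_less_card_finite[where 'a='d] by linarith

context
  fixes f :: "real ^ 'd::finite \<Rightarrow> real" and K :: real
  assumes sm: "smooth f" and db: "derivs_bounded K f"
begin

lemma derivs_bound_nonneg: "0 \<le> K"
  using db unfolding derivs_bounded_def
  by (metis abs_ge_zero length_Cons list.size(3) One_nat_def le_refl one_le_numeral order_trans)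

lemma partials_bound: "1 \<le> length js \<Longrightarrow> length js \<le> 3 \<Longrightarrow> \<bar>partials js f x\<bar> \<le> K"
  using db unfolding derivs_bounded_def by blast

lemma grad_component: "grad f x $ j = partials [j] f x"
  using smooth_differentiable[OF sm, of "[]"] by (simp add: grad_eq)

lemma hess_component: "hess f x h $ j = (\<Sum>l\<in>UNIV. h $ l * partials [l, j] f x)"
  by (simp add: hess_def)

lemma norm_grad_le: "norm (grad f x) \<le> real CARD('d) * K"
  by (rule norm_le_card_component) (simp only: grad_component, simp add: partials_bound del: partials.simps)

lemma grad_lipschitz: "norm (grad f y - grad f x) \<le> real CARD('d) * (real CARD('d) * K * norm (y - x))"
proof (rule norm_le_card_component)
  fix j
  have "\<bar>partials [j] f y - partials [j] f x\<bar> \<le> real CARD('d) * K * norm (y - x)"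
  proof (rule partial_bounded_lipschitz)
    show "partials [j] f differentiable at x" for x by (rule smooth_differentiable[OF sm])
    show "\<bar>partial l (partials [j] f) x\<bar> \<le> K" for l x
      using partials_bound[of "[l, j]"] by simp
  qed
  then show "\<bar>(grad f y - grad f x) $ j\<bar> \<le> real CARD('d) * K * norm (y - x)"
    by (simp add: grad_component del: partials.simps)
qed

lemma norm_hess_le: "norm (hess f x h) \<le> real CARD('d) * (real CARD('d) * K * norm h)"
proof (rule norm_le_card_component)
  show "\<bar>hess f x h $ j\<bar> \<le> real CARD('d) * K * norm h" for j
    unfolding hess_component by (rule abs_sum_component_mult_le) (rule partials_bound, auto)
qed

text \<open>Bounded third derivatives make the second ones Lipschitz, and this makes the Taylor
  remainder of each first derivative quadratic. One factor \<open>CARD('d)\<close> is paid for the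
  Lipschitz bound, one for the expansion along the axes, one for passing from components to the
  norm.\<close>

lemma grad_taylor:
  "norm (grad f (x + h) - grad f x - hess f x h)
     \<le> real CARD('d) * (real CARD('d) * (real CARD('d) * K) * (norm h)\<^sup>2)"
proof (rule norm_le_card_component)
  fix j
  have "\<bar>partials [j] f (x + h) - partials [j] f x - (\<Sum>l\<in>UNIV. h $ l * partial l (partials [j] f) x)\<bar>
      \<le> real CARD('d) * (real CARD('d) * K) * (norm h)\<^sup>2"
  proof (rule partial_lipschitz_taylor)
    show "partials [j] f differentiable at x" for x by (rule smooth_differentiable[OF sm])
    show "\<bar>partial l (partials [j] f) y - partial l (partials [j] f) x\<bar> \<le> real CARD('d) * K * norm (y - x)" for l x y
    proof (rule partial_bounded_lipschitz)
      show "partial l (partials [j] f) differentiable at x" for x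
        using smooth_differentiable[OF sm, of "[l, j]"] by simp
      show "\<bar>partial k (partial l (partials [j] f)) x\<bar> \<le> K" for k x
        using partials_bound[of "[k, l, j]"] by simp
    qed
    show "0 \<le> real CARD('d) * K" using derivs_bound_nonneg by simp
  qed
  then show "\<bar>(grad f (x + h) - grad f x - hess f x h) $ j\<bar> \<le> real CARD('d) * (real CARD('d) * K) * (norm h)\<^sup>2"
    by (simp add: grad_component hess_component)
qed

lemma continuous_on_grad: "continuous_on UNIV (grad f)"
  using continuous_on_partials[OF sm]
  by (subst continuous_on_componentwise)
    (simp add: Basis_vec_def inner_axis grad_component del: partials.simps)

lemma continuous_on_hess: "continuous_on UNIV (\<lambda>x. hess f x h)"
  unfolding hess_def
  using continuous_on_partials[OF sm, of "[_, _]"]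
  by (intro continuous_intros) simp

end

section \<open>Sampling without replacement\<close>

text \<open>Deleting \<open>J\<close> is a bijection onto the subsets of \<open>A - J\<close> of
  size \<open>k - card J\<close>. The case distinction matters: for \<open>card J > k\<close>
  truncated subtraction would make the binomial coefficient 1.\<close>

lemma card_subsets_superset:
  assumes "finite A" "J \<subseteq> A"
  shows "card {S. S \<subseteq> A \<and> card S = k \<and> J \<subseteq> S} =
    (if card J \<le> k then (card A - card J) choose (k - card J) else 0)"
proof (cases "card J \<le> k")
  case True
  have fJ: "finite J" using assms finite_subset by blast
  have "bij_betw (\<lambda>S. S - J) {S. S \<subseteq> A \<and> card S = k \<and> J \<subseteq> S} {S. S \<subseteq> A - J \<and> card S = k - card J}"
  proof (rule bij_betw_byWitness[where f' = "\<lambda>S. S \<union> J"])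
    show "(\<lambda>S. S - J) ` {S. S \<subseteq> A \<and> card S = k \<and> J \<subseteq> S} \<subseteq> {S. S \<subseteq> A - J \<and> card S = k - card J}"
      using fJ by (auto simp: card_Diff_subset)
    show "(\<lambda>S. S \<union> J) ` {S. S \<subseteq> A - J \<and> card S = k - card J} \<subseteq> {S. S \<subseteq> A \<and> card S = k \<and> J \<subseteq> S}"
    proof clarsimp
      fix S assume S: "S \<subseteq> A - J" "card S = k - card J"
      then have "finite S" "S \<inter> J = {}" using assms finite_subset by blast+
      then show "S \<subseteq> A \<and> J \<subseteq> A \<and> card (S \<union> J) = k"
        using S fJ True assms by (auto simp: card_Un_disjoint)
    qed
  qed auto
  then have "card {S. S \<subseteq> A \<and> card S = k \<and> J \<subseteq> S} = card {S. S \<subseteq> A - J \<and> card S = k - card J}"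
    by (rule bij_betw_same_card)
  also have "\<dots> = (card A - card J) choose (k - card J)"
    using assms fJ by (simp add: n_subsets card_Diff_subset)
  finally show ?thesis using True by simp
next
  case False
  then have "{S. S \<subseteq> A \<and> card S = k \<and> J \<subseteq> S} = {}"
    using assms by (auto dest: card_mono[rotated] finite_subset)
  then show ?thesis unfolding \<open>_ = {}\<close> using False by simp
qed

text \<open>Double counting: every element of \<open>A\<close> lies in equally many subsets of size
  \<open>k\<close>.\<close>

lemma sum_subsets_sum:
  fixes g :: "'b \<Rightarrow> 'a::real_vector"
  assumes "finite A" "1 \<le> k"
  shows "(\<Sum>S | S \<subseteq> A \<and> card S = k. \<Sum>j\<in>S. g j) = real ((card A - 1) choose (k - 1)) *\<^sub>R (\<Sum>j\<in>A. g j)"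
proof -
  let ?Sk = "{S. S \<subseteq> A \<and> card S = k}"
  have fin: "finite ?Sk" using assms by simp
  have "(\<Sum>S\<in>?Sk. \<Sum>j\<in>S. g j) = (\<Sum>S\<in>?Sk. \<Sum>j\<in>A. if j \<in> S then g j else 0)"
  proof (rule sum.cong[OF refl])
    fix S assume "S \<in> ?Sk"
    then show "(\<Sum>j\<in>S. g j) = (\<Sum>j\<in>A. if j \<in> S then g j else 0)"
      using assms by (simp add: Int_absorb1 flip: sum.inter_restrict)
  qed
  also have "\<dots> = (\<Sum>j\<in>A. \<Sum>S\<in>?Sk. if j \<in> S then g j else 0)" by (rule sum.swap)
  also have "\<dots> = (\<Sum>j\<in>A. real ((card A - 1) choose (k - 1)) *\<^sub>R g j)"
  proof (rule sum.cong[OF refl])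
    fix j assume "j \<in> A"
    have "?Sk \<inter> {S. j \<in> S} = {S. S \<subseteq> A \<and> card S = k \<and> {j} \<subseteq> S}" by auto
    then have "card (?Sk \<inter> {S. j \<in> S}) = (card A - 1) choose (k - 1)"
      using card_subsets_superset[of A "{j}" k] assms \<open>j \<in> A\<close> by simp
    then show "(\<Sum>S\<in>?Sk. if j \<in> S then g j else 0) = real ((card A - 1) choose (k - 1)) *\<^sub>R g j"
      using fin by (simp add: sum.If_cases scaleR_conv_of_real sum_constant_scaleR)
  qed
  finally show ?thesis by (simp add: scaleR_sum_right)
qed

text \<open>Expanding the square leaves a count of the subsets that contain a given pair:
  \<open>c1\<close> on the diagonal, \<open>c2\<close> off it. The part with the common weight
  \<open>c2\<close> is \<open>c2\<close> times the square of a vanishing sum, so only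
  \<open>c1 - c2\<close> survives, on the diagonal. Dropping \<open>c2\<close> gives the same bound
  as sampling with replacement.\<close>

lemma sum_subsets_norm_sum_le:
  fixes h :: "'b \<Rightarrow> 'a::real_inner"
  assumes "finite A" "1 \<le> k" and h: "(\<Sum>j\<in>A. h j) = 0"
  shows "(\<Sum>S | S \<subseteq> A \<and> card S = k. (norm (\<Sum>j\<in>S. h j))\<^sup>2)
    \<le> real ((card A - 1) choose (k - 1)) * (\<Sum>j\<in>A. (norm (h j))\<^sup>2)"
proof -
  let ?Sk = "{S. S \<subseteq> A \<and> card S = k}"
  have fin: "finite ?Sk" using assms by simp
  define c1 where "c1 = real ((card A - 1) choose (k - 1))"
  \<comment> \<open>No pair fits into a singleton: for \<open>k = 1\<close> the truncated
    \<open>k - 2\<close> would wrongly count one subset.\<close>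
  define c2 where "c2 = real (if 2 \<le> k then (card A - 2) choose (k - 2) else 0)"
  have count: "(\<Sum>S\<in>?Sk. if j \<in> S \<and> l \<in> S then h j \<bullet> h l else 0)
      = c2 * (h j \<bullet> h l) + (if j = l then (c1 - c2) * (h j \<bullet> h l) else 0)" if "j \<in> A" "l \<in> A" for j l
  proof -
    have "?Sk \<inter> {S. j \<in> S \<and> l \<in> S} = {S. S \<subseteq> A \<and> card S = k \<and> {j, l} \<subseteq> S}" by auto
    then have "real (card (?Sk \<inter> {S. j \<in> S \<and> l \<in> S})) = (if j = l then c1 else c2)"
      using card_subsets_superset[of A "{j, l}" k] assms that
      by (auto simp: c1_def c2_def card_insert_if numeral_2_eq_2)
    then show ?thesis
      using fin by (simp add: sum.If_cases algebra_simps)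
  qed
  have "(\<Sum>S\<in>?Sk. (norm (\<Sum>j\<in>S. h j))\<^sup>2) = (\<Sum>S\<in>?Sk. \<Sum>j\<in>A. \<Sum>l\<in>A. if j \<in> S \<and> l \<in> S then h j \<bullet> h l else 0)"
  proof (rule sum.cong[OF refl])
    fix S assume S: "S \<in> ?Sk"
    have "(\<Sum>j\<in>S. h j) = (\<Sum>j\<in>A. if j \<in> S then h j else 0)"
      using assms S by (simp add: Int_absorb1 flip: sum.inter_restrict)
    then have "(norm (\<Sum>j\<in>S. h j))\<^sup>2 = (\<Sum>j\<in>A. \<Sum>l\<in>A. (if j \<in> S then h j else 0) \<bullet> (if l \<in> S then h l else 0))"
      by (simp only: power2_norm_eq_inner inner_sum_left inner_sum_right) (rule sum.swap)
    also have "\<dots> = (\<Sum>j\<in>A. \<Sum>l\<in>A. if j \<in> S \<and> l \<in> S then h j \<bullet> h l else 0)"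
      by (intro sum.cong refl) auto
    finally show "(norm (\<Sum>j\<in>S. h j))\<^sup>2 = \<dots>" .
  qed
  also have "\<dots> = (\<Sum>j\<in>A. \<Sum>l\<in>A. \<Sum>S\<in>?Sk. if j \<in> S \<and> l \<in> S then h j \<bullet> h l else 0)"
    by (subst sum.swap) (intro sum.cong refl sum.swap)
  also have "\<dots> = (\<Sum>j\<in>A. \<Sum>l\<in>A. c2 * (h j \<bullet> h l) + (if j = l then (c1 - c2) * (h j \<bullet> h l) else 0))"
    by (intro sum.cong refl count)
  also have "\<dots> = c2 * ((\<Sum>j\<in>A. h j) \<bullet> (\<Sum>j\<in>A. h j)) + (c1 - c2) * (\<Sum>j\<in>A. (norm (h j))\<^sup>2)"
  proof -
    have "(\<Sum>j\<in>A. \<Sum>l\<in>A. h j \<bullet> h l) = (\<Sum>j\<in>A. h j) \<bullet> (\<Sum>j\<in>A. h j)"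
      by (simp only: inner_sum_left inner_sum_right) (rule sum.swap)
    then show ?thesis
      using assms(1) by (simp add: sum.distrib sum_distrib_left[symmetric] power2_norm_eq_inner)
  qed
  also have "\<dots> = (c1 - c2) * (\<Sum>j\<in>A. (norm (h j))\<^sup>2)" using h by simp
  also have "\<dots> \<le> c1 * (\<Sum>j\<in>A. (norm (h j))\<^sup>2)"
    by (intro mult_right_mono) (auto simp: c2_def intro!: sum_nonneg)
  finally show ?thesis by (simp add: c1_def)
qed

text \<open>Second moments are smallest around the mean: the cross term is twice
  \<open>card A * (norm m)\<^sup>2\<close>, which outweighs the added squares.\<close>

lemma sum_norm_centered_le:
  fixes g :: "'b \<Rightarrow> 'a::real_inner"
  assumes "finite A"
  shows "(\<Sum>j\<in>A. (norm (g j - (1 / real (card A)) *\<^sub>R (\<Sum>l\<in>A. g l)))\<^sup>2) \<le> (\<Sum>j\<in>A. (norm (g j))\<^sup>2)"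
proof (cases "A = {}")
  case False
  define m where "m = (1 / real (card A)) *\<^sub>R (\<Sum>l\<in>A. g l)"
  have c: "real (card A) > 0" using False assms by (simp add: card_gt_0_iff)
  have s: "(\<Sum>l\<in>A. g l) = real (card A) *\<^sub>R m" using c by (simp add: m_def)
  have "(\<Sum>j\<in>A. (norm (g j - m))\<^sup>2) = (\<Sum>j\<in>A. (norm (g j))\<^sup>2 - 2 * (g j \<bullet> m) + (norm m)\<^sup>2)"
    by (intro sum.cong refl) (simp add: power2_norm_eq_inner inner_diff_left inner_diff_right inner_commute)
  also have "\<dots> = (\<Sum>j\<in>A. (norm (g j))\<^sup>2) - 2 * ((\<Sum>l\<in>A. g l) \<bullet> m) + real (card A) * (norm m)\<^sup>2"
    by (simp add: sum.distrib sum_subtractf inner_sum_left sum_distrib_left)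
  also have "\<dots> = (\<Sum>j\<in>A. (norm (g j))\<^sup>2) - real (card A) * (norm m)\<^sup>2"
    by (simp add: s power2_norm_eq_inner)
  also have "\<dots> \<le> (\<Sum>j\<in>A. (norm (g j))\<^sup>2)" by simp
  finally show ?thesis by (simp add: m_def)
qed simp

section \<open>Mean and variance of a random batch average\<close>

lemma finite_batches: "finite (batches N i p)"
  unfolding batches_def by (rule finite_subset[of _ "Pow {1..N}"]) auto

context
  fixes N i p :: nat
  assumes i: "i \<in> {1..N}" and p: "1 < p" "p \<le> N"
begin

lemma card_others: "card ({1..N} - {i}) = N - 1"
  using i by simp

lemma card_batches: "card (batches N i p) = (N - 1) choose (p - 1)"
  unfolding batches_def by (subst n_subsets) (use i in auto)

lemma batches_nonempty: "batches N i p \<noteq> {}"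
  using card_batches p by (auto simp: card_eq_0_iff binomial_eq_0_iff)

text \<open>Both sides count pairs of a batch and a particle in it. The mean and the variance both
  need this to trade the number of batches through a fixed particle for the number of all
  batches.\<close>

lemma binomial_batches:
  "(real p - 1) * real ((N - 1) choose (p - 1)) = (real N - 1) * real ((N - 2) choose (p - 2))"
proof -
  have "(p - 1) * ((N - 1) choose (p - 1)) = (N - 1) * ((N - 2) choose (p - 2))"
    using binomial_absorption[of "p - 2" "N - 1"] p
    by (simp add: Suc_diff_Suc numeral_2_eq_2)
  then have "real (p - 1) * real ((N - 1) choose (p - 1)) = real (N - 1) * real ((N - 2) choose (p - 2))"
    by (metis of_nat_mult)
  moreover have "real (p - 1) = real p - 1" "real (N - 1) = real N - 1" using p by auto
  ultimately show ?thesis by metis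
qed

text \<open>Unbiasedness of the batch force, in the form of a finite sum because it is applied under
  the integral sign at a frozen position.\<close>

lemma batch_mean:
  fixes g :: "nat \<Rightarrow> 'a::real_vector"
  shows "(\<Sum>S\<in>batches N i p. (1 / (real p - 1)) *\<^sub>R (\<Sum>j\<in>S. g j))
    = real (card (batches N i p)) *\<^sub>R ((1 / (real N - 1)) *\<^sub>R (\<Sum>j\<in>{1..N} - {i}. g j))"
proof -
  have pos: "real p - 1 > 0" "real N - 1 > 0" using p by auto
  have "(\<Sum>S\<in>batches N i p. (1 / (real p - 1)) *\<^sub>R (\<Sum>j\<in>S. g j))
      = (1 / (real p - 1)) *\<^sub>R (real ((N - 2) choose (p - 2)) *\<^sub>R (\<Sum>j\<in>{1..N} - {i}. g j))"
    using sum_subsets_sum[of "{1..N} - {i}" "p - 1" g] p i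
    by (simp add: batches_def scaleR_sum_right[symmetric] numeral_2_eq_2)
  moreover have "real ((N - 2) choose (p - 2)) / (real p - 1) = real (card (batches N i p)) / (real N - 1)"
    using binomial_batches pos by (simp add: card_batches field_simps)
  ultimately show ?thesis by simp
qed

text \<open>A batch has exactly \<open>p - 1\<close> elements, so the mean can be subtracted inside
  the batch sum. The centered summands add up to zero over all particles, as
  \<open>sum_subsets_norm_sum_le\<close> requires. Of the factor
  \<open>1 / (real p - 1)\<^sup>2\<close> one power is cancelled when
  \<open>binomial_batches\<close> brings in the number of all batches.\<close>

lemma batch_variance:
  fixes g :: "nat \<Rightarrow> 'a::real_inner"
  assumes g: "\<And>j. norm (g j) \<le> G"
  shows "(\<Sum>S\<in>batches N i p. (norm ((1 / (real p - 1)) *\<^sub>R (\<Sum>j\<in>S. g j)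
      - (1 / (real N - 1)) *\<^sub>R (\<Sum>j\<in>{1..N} - {i}. g j)))\<^sup>2)
    \<le> real (card (batches N i p)) * (G\<^sup>2 / (real p - 1))"
proof -
  let ?A = "{1..N} - {i}"
  have pos: "real p - 1 > 0" "real N - 1 > 0" using p by auto
  define m where "m = (1 / (real N - 1)) *\<^sub>R (\<Sum>j\<in>?A. g j)"
  have cA: "real (card ?A) = real N - 1" using card_others p by simp
  have m: "m = (1 / real (card ?A)) *\<^sub>R (\<Sum>j\<in>?A. g j)" unfolding m_def cA ..
  have eq: "(norm ((1 / (real p - 1)) *\<^sub>R (\<Sum>j\<in>S. g j) - m))\<^sup>2
      = (1 / (real p - 1)\<^sup>2) * (norm (\<Sum>j\<in>S. g j - m))\<^sup>2" if "S \<in> batches N i p" for S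
  proof -
    have "card S = p - 1" using that by (simp add: batches_def)
    then have "(\<Sum>j\<in>S. g j - m) = (\<Sum>j\<in>S. g j) - (real p - 1) *\<^sub>R m"
      using p by (simp add: sum_subtractf sum_constant_scaleR)
    then have "(1 / (real p - 1)) *\<^sub>R (\<Sum>j\<in>S. g j) - m = (1 / (real p - 1)) *\<^sub>R (\<Sum>j\<in>S. g j - m)"
      using pos by (simp add: scaleR_right_diff_distrib)
    then show ?thesis by (simp add: power_divide)
  qed
  have "(\<Sum>S\<in>batches N i p. (norm ((1 / (real p - 1)) *\<^sub>R (\<Sum>j\<in>S. g j) - m))\<^sup>2)
      = (1 / (real p - 1)\<^sup>2) * (\<Sum>S\<in>batches N i p. (norm (\<Sum>j\<in>S. g j - m))\<^sup>2)"
    by (simp add: eq sum_distrib_left)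
  also have "\<dots> \<le> (1 / (real p - 1)\<^sup>2) * (real ((N - 2) choose (p - 2)) * (\<Sum>j\<in>?A. (norm (g j - m))\<^sup>2))"
  proof -
    have "(\<Sum>j\<in>?A. g j - m) = 0"
      using pos by (simp only: sum_subtractf sum_constant_scaleR cA m_def) simp
    from sum_subsets_norm_sum_le[OF _ _ this, of "p - 1"] show ?thesis
      using p i by (intro mult_left_mono) (simp_all add: batches_def numeral_2_eq_2)
  qed
  also have "\<dots> \<le> (1 / (real p - 1)\<^sup>2) * (real ((N - 2) choose (p - 2)) * ((real N - 1) * G\<^sup>2))"
  proof -
    have "(\<Sum>j\<in>?A. (norm (g j - m))\<^sup>2) \<le> (\<Sum>j\<in>?A. (norm (g j))\<^sup>2)"
      unfolding m by (rule sum_norm_centered_le) simp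
    also have "\<dots> \<le> (\<Sum>j\<in>?A. G\<^sup>2)" using g by (intro sum_mono power_mono) auto
    also have "\<dots> = (real N - 1) * G\<^sup>2" using cA by simp
    finally show ?thesis by (intro mult_left_mono) auto
  qed
  also have "\<dots> = real (card (batches N i p)) * (G\<^sup>2 / (real p - 1))"
  proof -
    have *: "real ((N - 2) choose (p - 2)) * ((real N - 1) * G\<^sup>2) = (real p - 1) * (real ((N - 1) choose (p - 1)) * G\<^sup>2)"
      using binomial_batches by (metis mult.assoc mult.commute)
    show ?thesis unfolding * card_batches using pos by (simp add: power2_eq_square[of "real p - 1"])
  qed
  finally show ?thesis by (simp add: m_def)
qed

end

section \<open>Gaussian vectors\<close>

lemma sets_gaussian [simp, measurable_cong]: "sets (gaussian s) = sets borel"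
  by (simp add: gaussian_def)

lemma space_gaussian [simp]: "space (gaussian s) = UNIV"
  by (simp add: gaussian_def)

lemma gaussian_density_measurable [measurable]:
  "(\<lambda>x::real ^ 'd::finite. ennreal (\<Prod>j\<in>UNIV. normal_density 0 s (x $ j))) \<in> borel_measurable borel"
  by measurable

text \<open>The density is a product, so the integral factors over the coordinates, and all factors
  but the \<open>k\<close>-th are 1. Working with nonnegative integrals yields moments without prior
  integrability.\<close>

lemma nn_integral_gaussian_component:
  fixes k :: "'d::finite"
  assumes s: "0 < s" and [measurable]: "f \<in> borel_measurable borel" and f: "\<And>x. 0 \<le> f x"
  shows "(\<integral>\<^sup>+ x. ennreal (f (x $ k)) \<partial>gaussian s) = (\<integral>\<^sup>+ x. ennreal (normal_density 0 s x * f x) \<partial>lborel)"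
proof -
  \<comment> \<open>\<open>nn_integral_lborel_prod\<close> is indexed by \<open>Basis\<close>, the
    density by coordinates; \<open>axis\<close> matches the two.\<close>
  have prodBasis: "(\<Prod>b\<in>(Basis::(real ^ 'd) set). g b) = (\<Prod>j\<in>UNIV. g (axis j 1))" for g :: "real ^ 'd \<Rightarrow> ennreal"
  proof -
    have B: "(Basis::(real ^ 'd) set) = (\<lambda>j. axis j 1) ` UNIV"
      by (auto simp: Basis_vec_def)
    show ?thesis unfolding B by (subst prod.reindex) (auto simp: inj_on_def axis_eq_axis)
  qed
  have nd: "0 \<le> normal_density 0 s x" for x using s by simp
  have "(\<integral>\<^sup>+ x. ennreal (f (x $ k)) \<partial>gaussian s)
      = (\<integral>\<^sup>+ x. (\<Prod>j\<in>UNIV. ennreal (normal_density 0 s (x $ j) * (if j = k then f (x $ j) else 1))) \<partial>lborel)"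
    unfolding gaussian_def
  proof (subst nn_integral_density, simp, simp, rule nn_integral_cong)
    fix x :: "real ^ 'd"
    have "(\<Prod>j\<in>UNIV. normal_density 0 s (x $ j) * (if j = k then f (x $ j) else 1))
        = (\<Prod>j\<in>UNIV. normal_density 0 s (x $ j)) * f (x $ k)"
      by (simp add: prod.distrib)
    moreover have "(\<Prod>j\<in>UNIV. ennreal (normal_density 0 s (x $ j) * (if j = k then f (x $ j) else 1)))
        = ennreal (\<Prod>j\<in>UNIV. normal_density 0 s (x $ j) * (if j = k then f (x $ j) else 1))"
      by (rule prod_ennreal) (use nd f in auto)
    ultimately show "ennreal (\<Prod>j\<in>UNIV. normal_density 0 s (x $ j)) * ennreal (f (x $ k))
        = (\<Prod>j\<in>UNIV. ennreal (normal_density 0 s (x $ j) * (if j = k then f (x $ j) else 1)))"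
      using f by (simp add: ennreal_mult'')
  qed
  also have "\<dots> = (\<integral>\<^sup>+ x. (\<Prod>b\<in>Basis. ennreal (normal_density 0 s (x \<bullet> b) * (if b = axis k 1 then f (x \<bullet> b) else 1))) \<partial>(lborel :: (real ^ 'd) measure))"
    unfolding prodBasis by (intro nn_integral_cong prod.cong refl) (simp add: inner_axis axis_eq_axis)
  also have "\<dots> = (\<Prod>b\<in>(Basis::(real ^ 'd) set). \<integral>\<^sup>+ x. ennreal (normal_density 0 s x * (if b = axis k 1 then f x else 1)) \<partial>lborel)"
    by (rule nn_integral_lborel_prod) auto
  also have "\<dots> = (\<Prod>j\<in>UNIV. if j = k then (\<integral>\<^sup>+ x. ennreal (normal_density 0 s x * f x) \<partial>lborel) else 1)"
  proof -
    have "(\<integral>\<^sup>+ x. ennreal (normal_density 0 s x) \<partial>lborel) = 1"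
      using prob_space.emeasure_space_1[OF prob_space_normal_density[OF s, of 0]]
      by (simp add: emeasure_density)
    then show ?thesis
      unfolding prodBasis by (intro prod.cong refl) (auto simp: axis_eq_axis)
  qed
  finally show ?thesis by simp
qed

lemma prob_space_gaussian:
  assumes "0 < s" shows "prob_space (gaussian s :: (real ^ 'd::finite) measure)"
proof
  have "(\<integral>\<^sup>+ x. ennreal 1 \<partial>(gaussian s :: (real ^ 'd) measure)) = (\<integral>\<^sup>+ x. ennreal (normal_density 0 s x * 1) \<partial>lborel)"
    using nn_integral_gaussian_component[OF assms, of "\<lambda>_. 1" undefined] by simp
  also have "\<dots> = 1"
    using prob_space.emeasure_space_1[OF prob_space_normal_density[OF assms, of 0]]
    by (simp add: emeasure_density)
  finally show "emeasure (gaussian s :: (real ^ 'd) measure) (space (gaussian s)) = 1"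
    by simp
qed

lemma nn_integral_gaussian_even_moment:
  fixes j :: "'d::finite"
  assumes s: "0 < s"
  shows "(\<integral>\<^sup>+ x. ennreal ((x $ j) ^ (2 * k)) \<partial>gaussian s) = ennreal (fact (2 * k) / ((2 / s\<^sup>2) ^ k * fact k))"
proof -
  have *: "has_bochner_integral lborel (\<lambda>x. normal_density 0 s x * x ^ (2 * k)) (fact (2 * k) / ((2 / s\<^sup>2) ^ k * fact k))"
    using normal_moment_even[OF s, of 0 k] by simp
  have "(\<integral>\<^sup>+ x. ennreal ((x $ j) ^ (2 * k)) \<partial>gaussian s) = (\<integral>\<^sup>+ x. ennreal (normal_density 0 s x * x ^ (2 * k)) \<partial>lborel)"
    using nn_integral_gaussian_component[OF s, of "\<lambda>x. x ^ (2 * k)" j]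
    by (simp add: power_mult)
  also have "\<dots> = ennreal (fact (2 * k) / ((2 / s\<^sup>2) ^ k * fact k))"
    using * s by (intro nn_integral_eq_integral[THEN trans])
      (auto simp: has_bochner_integral_iff power_mult)
  finally show ?thesis .
qed

lemma nn_integral_gaussian_second_moment:
  fixes j :: "'d::finite"
  assumes s: "0 < s"
  shows "(\<integral>\<^sup>+ x. ennreal ((x $ j)\<^sup>2) \<partial>gaussian s) = ennreal (s\<^sup>2)"
  using nn_integral_gaussian_even_moment[OF s, of j 1] by simp

lemma nn_integral_gaussian_fourth_moment:
  fixes j :: "'d::finite"
  assumes s: "0 < s"
  shows "(\<integral>\<^sup>+ x. ennreal ((x $ j) ^ 4) \<partial>gaussian s) = ennreal (3 * s ^ 4)"
proof -
  have "fact (2 * 2) / ((2 / s\<^sup>2)\<^sup>2 * fact 2) = 3 * s ^ 4"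
    by (simp add: fact_numeral power_divide flip: power_mult)
  then show ?thesis
    using nn_integral_gaussian_even_moment[OF s, of j 2] by simp
qed

lemma nn_integral_gaussian_norm_power2:
  assumes s: "0 < s"
  shows "(\<integral>\<^sup>+ x. ennreal ((norm x)\<^sup>2) \<partial>(gaussian s :: (real ^ 'd::finite) measure)) = ennreal (real CARD('d) * s\<^sup>2)"
proof -
  have "(\<integral>\<^sup>+ x. ennreal ((norm x)\<^sup>2) \<partial>(gaussian s :: (real ^ 'd) measure))
      = (\<integral>\<^sup>+ x. (\<Sum>j\<in>UNIV. ennreal ((x $ j)\<^sup>2)) \<partial>(gaussian s :: (real ^ 'd) measure))"
    by (intro nn_integral_cong)
      (simp add: norm_vec_def L2_set_def real_sqrt_pow2 sum_nonneg sum_ennreal)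
  also have "\<dots> = (\<Sum>j\<in>(UNIV::'d set). ennreal (s\<^sup>2))"
    by (subst nn_integral_sum) (auto simp: nn_integral_gaussian_second_moment[OF s])
  finally show ?thesis by (simp add: sum_ennreal ennreal_of_nat_eq_real_of_nat ennreal_mult)
qed

text \<open>Cauchy-Schwarz reduces the fourth power of the norm to fourth moments of single
  coordinates, at the price of \<open>3 d^2\<close> in place of the exact
  \<open>d (d + 2)\<close>.\<close>

lemma nn_integral_gaussian_norm_power4:
  assumes s: "0 < s"
  shows "(\<integral>\<^sup>+ x. ennreal ((norm x) ^ 4) \<partial>(gaussian s :: (real ^ 'd::finite) measure)) \<le> ennreal (3 * (real CARD('d))\<^sup>2 * s ^ 4)"
proof -
  have "(norm x) ^ 4 \<le> real CARD('d) * (\<Sum>j\<in>UNIV. (x $ j) ^ 4)" for x :: "real ^ 'd"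
  proof -
    have n: "(norm x)\<^sup>2 = (\<Sum>j\<in>UNIV. (x $ j)\<^sup>2)"
      by (simp add: norm_vec_def L2_set_def real_sqrt_pow2 sum_nonneg)
    have "(norm x) ^ 4 = (\<Sum>j\<in>UNIV. 1 * (x $ j)\<^sup>2)\<^sup>2"
      unfolding n[symmetric] by (simp add: n[symmetric] flip: power_mult)
    also have "\<dots> \<le> (\<Sum>j\<in>(UNIV::'d set). 1\<^sup>2) * (\<Sum>j\<in>UNIV. ((x $ j)\<^sup>2)\<^sup>2)"
      by (rule Cauchy_Schwarz_ineq_sum)
    finally show ?thesis by (simp flip: power_mult)
  qed
  then have "(\<integral>\<^sup>+ x. ennreal ((norm x) ^ 4) \<partial>(gaussian s :: (real ^ 'd) measure))
      \<le> (\<integral>\<^sup>+ x. ennreal (real CARD('d)) * (\<Sum>j\<in>UNIV. ennreal ((x $ j) ^ 4)) \<partial>(gaussian s :: (real ^ 'd) measure))"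
    by (intro nn_integral_mono) (simp add: sum_ennreal ennreal_mult'[symmetric] ennreal_leI sum_nonneg)
  also have "\<dots> = ennreal (real CARD('d)) * (\<Sum>j\<in>(UNIV::'d set). ennreal (3 * s ^ 4))"
    by (subst nn_integral_cmult, simp, subst nn_integral_sum)
      (auto simp: nn_integral_gaussian_fourth_moment[OF s])
  also have "\<dots> = ennreal (3 * (real CARD('d))\<^sup>2 * s ^ 4)"
    using s by (simp add: ennreal_of_nat_eq_real_of_nat ennreal_mult'[symmetric] power2_eq_square mult_ac)
  finally show ?thesis .
qed

lemma integrable_gaussian_component:
  fixes j :: "'d::finite"
  assumes s: "0 < s"
  shows "integrable (gaussian s) (\<lambda>x. x $ j)"
proof -
  interpret prob_space "gaussian s :: (real ^ 'd) measure" by (rule prob_space_gaussian[OF s])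
  have "integrable (gaussian s) (\<lambda>x. (x $ j)\<^sup>2)"
    by (rule integrableI_nonneg) (auto simp: nn_integral_gaussian_second_moment[OF s])
  then show ?thesis by (rule square_integrable_imp_integrable[rotated]) simp
qed

text \<open>Change of variables for a dilation: the Jacobian \<open>c ^ CARD('d)\<close> is spread
  over the coordinates, one factor \<open>c\<close> for each one-dimensional density. This
  identifies the law of rescaled Brownian increments with that of \<open>z\<close>.\<close>

lemma distr_gaussian_scaleR:
  assumes c: "0 < c" and s: "0 < s"
  shows "distr (gaussian s) borel (\<lambda>x. c *\<^sub>R x) = (gaussian (c * s) :: (real ^ 'd::finite) measure)"
proof -
  have d: "(\<Prod>j\<in>UNIV. normal_density 0 (c * s) (c * (x $ j))) * c ^ CARD('d) = (\<Prod>j\<in>UNIV. normal_density 0 s (x $ j))" for x :: "real ^ 'd"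
  proof -
    have "normal_density 0 (c * s) (c * y) * c = normal_density 0 s y" for y
    proof -
      have "(c * y)\<^sup>2 / (2 * (c * s)\<^sup>2) = y\<^sup>2 / (2 * s\<^sup>2)"
        using c by (simp add: power_mult_distrib)
      moreover have "sqrt (2 * pi * (c * s)\<^sup>2) = c * sqrt (2 * pi * s\<^sup>2)"
        using c by (simp add: power_mult_distrib real_sqrt_mult)
      ultimately show ?thesis using c by (simp add: normal_density_def)
    qed
    then have "(\<Prod>j\<in>UNIV. normal_density 0 (c * s) (c * (x $ j)) * c) = (\<Prod>j\<in>UNIV. normal_density 0 s (x $ j))"
      by (intro prod.cong refl)
    then show ?thesis unfolding prod.distrib by (simp only: prod_constant)
  qed
  have "(gaussian (c * s) :: (real ^ 'd) measure)
    = density (density (distr lborel borel (\<lambda>x. 0 + c *\<^sub>R x)) (\<lambda>_. ennreal (\<bar>c\<bar> ^ DIM(real ^ 'd))))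
        (\<lambda>x. ennreal (\<Prod>j\<in>UNIV. normal_density 0 (c * s) (x $ j)))"
    unfolding gaussian_def using c by (subst lborel_affine[of c 0]) auto
  also have "\<dots> = density (distr lborel borel (\<lambda>x. c *\<^sub>R x))
      (\<lambda>x::real ^ 'd. ennreal (c ^ CARD('d)) * ennreal (\<Prod>j\<in>UNIV. normal_density 0 (c * s) (x $ j)))"
    using c by (subst density_density_eq) auto
  also have "\<dots> = distr (density lborel (\<lambda>x. ennreal (c ^ CARD('d)) * ennreal (\<Prod>j\<in>UNIV. normal_density 0 (c * s) ((c *\<^sub>R x) $ j)))) borel (\<lambda>x::real ^ 'd. c *\<^sub>R x)"
    by (subst density_distr) auto
  also have "(\<lambda>x::real ^ 'd. ennreal (c ^ CARD('d)) * ennreal (\<Prod>j\<in>UNIV. normal_density 0 (c * s) ((c *\<^sub>R x) $ j)))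
      = (\<lambda>x. ennreal (\<Prod>j\<in>UNIV. normal_density 0 s (x $ j)))"
  proof
    fix x :: "real ^ 'd"
    have "ennreal (c ^ CARD('d)) * ennreal (\<Prod>j\<in>UNIV. normal_density 0 (c * s) (c * (x $ j)))
        = ennreal ((\<Prod>j\<in>UNIV. normal_density 0 (c * s) (c * (x $ j))) * c ^ CARD('d))"
      using c by (subst mult.commute, intro ennreal_mult''[symmetric]) simp
    then show "ennreal (c ^ CARD('d)) * ennreal (\<Prod>j\<in>UNIV. normal_density 0 (c * s) ((c *\<^sub>R x) $ j))
        = ennreal (\<Prod>j\<in>UNIV. normal_density 0 s (x $ j))"
      by (simp only: d vector_scaleR_component real_scaleR_def)
  qed
  finally show ?thesis by (simp add: gaussian_def)
qed

text \<open>The Gaussian law is invariant under reflection, so the mean is its own negative.\<close>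

lemma integral_gaussian_component:
  fixes j :: "'d::finite"
  assumes s: "0 < s"
  shows "(\<integral>x. x $ j \<partial>gaussian s) = 0"
proof -
  have u: "distr (gaussian s) borel uminus = (gaussian s :: (real ^ 'd) measure)"
  proof -
    have "(gaussian s :: (real ^ 'd) measure)
      = density (density (distr lborel borel (\<lambda>x. 0 + (-1) *\<^sub>R x)) (\<lambda>_. ennreal (\<bar>-1\<bar> ^ DIM(real ^ 'd))))
          (\<lambda>x. ennreal (\<Prod>j\<in>UNIV. normal_density 0 s (x $ j)))"
      unfolding gaussian_def by (subst lborel_affine[of "-1" 0]) auto
    also have "\<dots> = density (distr lborel borel uminus) (\<lambda>x::real ^ 'd. ennreal (\<Prod>j\<in>UNIV. normal_density 0 s (x $ j)))"
      by (simp add: density_1 flip: one_ennreal_def)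
    also have "\<dots> = distr (density lborel (\<lambda>x. ennreal (\<Prod>j\<in>UNIV. normal_density 0 s ((- x) $ j)))) borel (uminus :: real ^ 'd \<Rightarrow> _)"
      by (subst density_distr) auto
    also have "(\<lambda>x::real ^ 'd. ennreal (\<Prod>j\<in>UNIV. normal_density 0 s ((- x) $ j))) = (\<lambda>x. ennreal (\<Prod>j\<in>UNIV. normal_density 0 s (x $ j)))"
      by (simp add: normal_density_def)
    finally show ?thesis by (simp add: gaussian_def)
  qed
  have "(\<integral>x. x $ j \<partial>gaussian s) = (\<integral>x. x $ j \<partial>distr (gaussian s) borel (uminus :: real ^ 'd \<Rightarrow> _))"
    by (simp add: u)
  also have "\<dots> = - (\<integral>x. x $ j \<partial>gaussian s)"
    by (subst integral_distr) auto
  finally show ?thesis by simp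
qed

section \<open>Brownian motion over one time step\<close>

lemma borel_measurable_vec_nth [measurable]:
  fixes f :: "'a \<Rightarrow> real ^ 'd::finite"
  assumes "f \<in> borel_measurable M"
  shows "(\<lambda>x. f x $ j) \<in> borel_measurable M"
  by (rule measurable_compose[OF assms]) simp

text \<open>Time is rounded down to the grid of mesh \<open>1 / Suc n\<close>. At each of the
  countably many grid points measurability is known, and continuity of the paths recovers
  \<open>X\<close> in the limit.\<close>

lemma borel_measurable_continuous_paths:
  fixes X :: "real \<Rightarrow> 'w \<Rightarrow> 'b::euclidean_space"
  assumes X [measurable]: "\<And>s. X s \<in> borel_measurable M"
    and cont: "\<And>\<omega>. \<omega> \<in> space M \<Longrightarrow> continuous_on UNIV (\<lambda>s. X s \<omega>)"
  shows "(\<lambda>(\<omega>, s). X s \<omega>) \<in> borel_measurable (M \<Otimes>\<^sub>M lborel)"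
proof (rule borel_measurable_LIMSEQ_metric)
  fix n :: nat
  show "(\<lambda>(\<omega>, s). X (real_of_int \<lfloor>real (Suc n) * s\<rfloor> / real (Suc n)) \<omega>) \<in> borel_measurable (M \<Otimes>\<^sub>M lborel)"
  proof -
    have "(\<lambda>q. (\<lambda>k::int. \<lambda>q. X (real_of_int k / real (Suc n)) (fst q)) \<lfloor>real (Suc n) * snd q\<rfloor> q) \<in> borel_measurable (M \<Otimes>\<^sub>M lborel)"
      by (rule measurable_compose_countable) measurable
    then show ?thesis by (simp add: case_prod_beta)
  qed
next
  fix q :: "'w \<times> real" assume "q \<in> space (M \<Otimes>\<^sub>M lborel)"
  then have "fst q \<in> space M" by (auto simp: space_pair_measure)
  then have c: "isCont (\<lambda>s. X s (fst q)) (snd q)"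
    using cont continuous_on_eq_continuous_at by blast
  have "(\<lambda>n. real_of_int \<lfloor>real (Suc n) * snd q\<rfloor> / real (Suc n)) \<longlonglongrightarrow> snd q"
  proof (rule tendsto_sandwich)
    show "\<forall>\<^sub>F n in sequentially. snd q - 1 / real (Suc n) \<le> real_of_int \<lfloor>real (Suc n) * snd q\<rfloor> / real (Suc n)"
    proof (intro always_eventually allI)
      fix n
      have "real (Suc n) * snd q - 1 \<le> real_of_int \<lfloor>real (Suc n) * snd q\<rfloor>" by linarith
      then have "(real (Suc n) * snd q - 1) / real (Suc n) \<le> real_of_int \<lfloor>real (Suc n) * snd q\<rfloor> / real (Suc n)"
        by (rule divide_right_mono) simp
      then show "snd q - 1 / real (Suc n) \<le> real_of_int \<lfloor>real (Suc n) * snd q\<rfloor> / real (Suc n)"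
        by (simp add: diff_divide_distrib)
    qed
    show "\<forall>\<^sub>F n in sequentially. real_of_int \<lfloor>real (Suc n) * snd q\<rfloor> / real (Suc n) \<le> snd q"
      by (intro always_eventually allI) (simp add: divide_le_eq mult.commute del: of_nat_Suc)
    have "(\<lambda>n. snd q - 1 / real (Suc n)) \<longlonglongrightarrow> snd q - 0"
      by (intro tendsto_diff tendsto_const LIMSEQ_Suc[OF lim_1_over_n])
    then show "(\<lambda>n. snd q - 1 / real (Suc n)) \<longlonglongrightarrow> snd q" by simp
  qed simp
  from isCont_tendsto_compose[OF c this]
  show "(\<lambda>n. (\<lambda>(\<omega>, s). X (real_of_int \<lfloor>real (Suc n) * s\<rfloor> / real (Suc n)) \<omega>) q) \<longlonglongrightarrow> (\<lambda>(\<omega>, s). X s \<omega>) q"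
    by (simp add: case_prod_beta)
qed

text \<open>Cauchy-Schwarz against the constant 1, obtained from the nonnegative integral of
  \<open>(f s - m)\<^sup>2\<close> with \<open>m\<close> the mean of \<open>f\<close>.\<close>

lemma power2_integral_le:
  fixes f :: "real \<Rightarrow> real"
  assumes "a < b" and f: "continuous_on {a..b} f"
  shows "(integral {a..b} f)\<^sup>2 \<le> (b - a) * integral {a..b} (\<lambda>s. (f s)\<^sup>2)"
proof -
  define I where "I = integral {a..b} f"
  define m where "m = I / (b - a)"
  have int: "f integrable_on {a..b}" "(\<lambda>s. (f s)\<^sup>2) integrable_on {a..b}"
    using f by (auto intro!: integrable_continuous_interval continuous_intros)
  have "0 \<le> integral {a..b} (\<lambda>s. (f s - m)\<^sup>2)"
    by (rule integral_nonneg) (use f in \<open>auto intro!: integrable_continuous_interval continuous_intros\<close>)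
  also have "integral {a..b} (\<lambda>s. (f s - m)\<^sup>2) = integral {a..b} (\<lambda>s. (f s)\<^sup>2) - 2 * m * I + (b - a) * m\<^sup>2"
  proof (rule integral_unique)
    have "((\<lambda>s. (f s)\<^sup>2 - 2 * m * f s + m\<^sup>2) has_integral
        (integral {a..b} (\<lambda>s. (f s)\<^sup>2) - 2 * m * I + (b - a) * m\<^sup>2)) {a..b}"
      using has_integral_const_real[of "m\<^sup>2" a b] int assms(1)
      by (intro has_integral_add has_integral_diff has_integral_mult_right)
        (auto simp: I_def content_real intro: integrable_integral)
    then show "((\<lambda>s. (f s - m)\<^sup>2) has_integral
        (integral {a..b} (\<lambda>s. (f s)\<^sup>2) - 2 * m * I + (b - a) * m\<^sup>2)) {a..b}"
      by (simp add: power2_diff algebra_simps)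
  qed
  also have "\<dots> = integral {a..b} (\<lambda>s. (f s)\<^sup>2) - I\<^sup>2 / (b - a)"
  proof -
    have "(b - a) * m = I" using assms by (simp add: m_def)
    then have "(b - a) * m\<^sup>2 = m * I" "I\<^sup>2 / (b - a) = m * I"
      using assms by (auto simp: power2_eq_square m_def)
    then show ?thesis by simp
  qed
  finally show ?thesis using assms by (simp add: I_def field_simps)
qed

text \<open>Links the gauge integral, in which the stochastic equation is written, to the Lebesgue
  integral on which Tonelli's theorem operates.\<close>

lemma nn_integral_indicator_continuous:
  fixes f :: "real \<Rightarrow> real"
  assumes f: "continuous_on {a..b} f" and nn: "\<And>s. s \<in> {a..b} \<Longrightarrow> 0 \<le> f s"
  shows "(\<integral>\<^sup>+ s. indicator {a..b} s * ennreal (f s) \<partial>lborel) = ennreal (integral {a..b} f)"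
proof -
  have si: "set_integrable lborel {a..b} f"
    using f by (rule borel_integrable_atLeastAtMost')
  have "(\<integral>\<^sup>+ s. indicator {a..b} s * ennreal (f s) \<partial>lborel) = (\<integral>\<^sup>+ s. ennreal (indicator {a..b} s *\<^sub>R f s) \<partial>lborel)"
    by (intro nn_integral_cong) (auto split: split_indicator)
  also have "\<dots> = ennreal (LINT s:{a..b}|lborel. f s)"
    using si nn unfolding set_lebesgue_integral_def set_integrable_def
    by (intro nn_integral_eq_integral) (auto split: split_indicator)
  finally show ?thesis using set_borel_integral_eq_integral(2)[OF si] by simp
qed

section \<open>Moments and orthogonality of Brownian increments and of their time integrals\<close>

lemma brownian_adapted:
  assumes BM: "brownian_motion M F W" and "0 \<le> u" "u \<le> v"
  shows "W u \<in> borel_measurable (F v)"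
proof (rule measurable_from_subalg)
  have filt: "filtration (space M) F" using BM by (simp add: brownian_motion_def)
  show "subalgebra (F v) (F u)"
    using filtration.sets_F_mono[OF filt assms(3)] filtration.space_F[OF filt] by (simp add: subalgebra_def)
  show "W u \<in> borel_measurable (F u)" using BM assms(2) by (simp add: brownian_motion_def)
qed

text \<open>The moments are transported from the Gaussian law. The centering claim is the martingale
  property tested against a bounded \<open>F s\<close>-measurable \<open>g\<close>: independence
  factors the expectation, and the increment has mean zero.\<close>

lemma brownian_increment:
  fixes W :: "real \<Rightarrow> 'w \<Rightarrow> real ^ 'd::finite"
  assumes BM: "brownian_motion M F W" and st: "0 \<le> s" "s < t"
  shows brownian_increment_measurable: "(\<lambda>\<omega>. W t \<omega> - W s \<omega>) \<in> borel_measurable M"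
    and brownian_increment_power2: "(\<integral>\<^sup>+ \<omega>. ennreal ((norm (W t \<omega> - W s \<omega>))\<^sup>2) \<partial>M) = ennreal (real CARD('d) * (t - s))"
    and brownian_increment_power4: "(\<integral>\<^sup>+ \<omega>. ennreal ((norm (W t \<omega> - W s \<omega>)) ^ 4) \<partial>M) \<le> ennreal (3 * (real CARD('d))\<^sup>2 * (t - s)\<^sup>2)"
    and brownian_increment_centered: "g \<in> borel_measurable (F s) \<Longrightarrow> (AE \<omega> in M. \<bar>g \<omega>\<bar> \<le> c) \<Longrightarrow>
      (\<integral>\<omega>. g \<omega> * (W t \<omega> - W s \<omega>) $ j \<partial>M) = 0"
proof -
  interpret prob_space M using BM by (simp add: brownian_motion_def)
  have sub: "subalgebra M (F u)" for u using BM by (simp add: brownian_motion_def)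
  have W: "W u \<in> borel_measurable M" if "0 \<le> u" for u
    by (rule measurable_from_subalg[OF sub brownian_adapted[OF BM that order_refl]])
  show m [measurable]: "(\<lambda>\<omega>. W t \<omega> - W s \<omega>) \<in> borel_measurable M"
    using W st by (intro borel_measurable_diff) auto
  have pos: "0 < sqrt (t - s)" using st by simp
  have law: "distr M borel (\<lambda>\<omega>. W t \<omega> - W s \<omega>) = gaussian (sqrt (t - s))"
    using BM st by (simp add: brownian_motion_def)
  have nn: "(\<integral>\<^sup>+ \<omega>. ennreal (f (W t \<omega> - W s \<omega>)) \<partial>M) = (\<integral>\<^sup>+ x. ennreal (f x) \<partial>gaussian (sqrt (t - s)))"
    if "f \<in> borel_measurable borel" for f
    using that by (subst law[symmetric], subst nn_integral_distr) auto
  show "(\<integral>\<^sup>+ \<omega>. ennreal ((norm (W t \<omega> - W s \<omega>))\<^sup>2) \<partial>M) = ennreal (real CARD('d) * (t - s))"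
    using nn[of "\<lambda>x. (norm x)\<^sup>2"] nn_integral_gaussian_norm_power2[OF pos] st by simp
  have "sqrt (t - s) ^ 4 = (t - s)\<^sup>2"
    using st by (metis abs_of_pos diff_gt_0_iff_gt numeral_Bit0 power2_eq_square power_add real_sqrt_abs2 real_sqrt_power)
  then show "(\<integral>\<^sup>+ \<omega>. ennreal ((norm (W t \<omega> - W s \<omega>)) ^ 4) \<partial>M) \<le> ennreal (3 * (real CARD('d))\<^sup>2 * (t - s)\<^sup>2)"
    using nn[of "\<lambda>x. (norm x) ^ 4"] nn_integral_gaussian_norm_power4[OF pos, where 'd='d] by simp
  assume g: "g \<in> borel_measurable (F s)" and gc: "AE \<omega> in M. \<bar>g \<omega>\<bar> \<le> c"
  have gM [measurable]: "g \<in> borel_measurable M" using measurable_from_subalg[OF sub g] .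
  have mj: "(\<lambda>\<omega>. (W t \<omega> - W s \<omega>) $ j) \<in> borel_measurable M"
    by measurable
  have spF: "space (F s) = space M" using sub by (simp add: subalgebra_def)
  have ind: "indep_set (sets (F s)) (preimages M borel (\<lambda>\<omega>. W t \<omega> - W s \<omega>))"
    using BM st by (simp add: brownian_motion_def)
  \<comment> \<open>The definition of Brownian motion gives independence on events. The preimages
    under \<open>g\<close> lie in \<open>F s\<close>, those under one coordinate are preimages under
    the whole increment, and both families are closed under intersection, so independence passes to
    the generated sigma-algebras.\<close>
  have "indep_var borel g borel (\<lambda>\<omega>. (W t \<omega> - W s \<omega>) $ j)"
    unfolding indep_var_eq
  proof (intro conjI)
    show "indep_set (sigma_sets (space M) {g -` A \<inter> space M |A. A \<in> sets borel})
       (sigma_sets (space M) {(\<lambda>\<omega>. (W t \<omega> - W s \<omega>) $ j) -` A \<inter> space M |A. A \<in> sets borel})"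
    proof (rule indep_set_sigma_sets)
      show "indep_set {g -` A \<inter> space M |A. A \<in> sets borel}
         {(\<lambda>\<omega>. (W t \<omega> - W s \<omega>) $ j) -` A \<inter> space M |A. A \<in> sets borel}"
      proof (rule indep_setI)
        fix a b assume a: "a \<in> {g -` A \<inter> space M |A. A \<in> sets borel}"
          and b: "b \<in> {(\<lambda>\<omega>. (W t \<omega> - W s \<omega>) $ j) -` A \<inter> space M |A. A \<in> sets borel}"
        from a obtain A where A: "A \<in> sets borel" "a = g -` A \<inter> space M" by auto
        from b obtain B where B: "B \<in> sets borel" "b = (\<lambda>\<omega>. (W t \<omega> - W s \<omega>) $ j) -` B \<inter> space M" by auto
        have "a \<in> sets (F s)" using measurable_sets[OF g A(1)] A(2) spF by simp
        moreover have "b \<in> preimages M borel (\<lambda>\<omega>. W t \<omega> - W s \<omega>)"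
        proof -
          have "(\<lambda>x::real ^ 'd. x $ j) -` B \<inter> space borel \<in> sets borel"
            by (rule measurable_sets[OF _ B(1)]) simp
          then show ?thesis unfolding preimages_def B(2)
            by (intro CollectI exI[of _ "(\<lambda>x::real ^ 'd. x $ j) -` B"]) auto
        qed
        ultimately show "prob (a \<inter> b) = prob a * prob b"
          by (rule indep_setD[OF ind])
      qed (use measurable_sets[OF gM] measurable_sets[OF mj] in auto)
    qed (auto simp: Int_stable_def; metis (no_types, lifting) Int_assoc Int_left_commute inf.idem sets.Int vimage_Int)+
  qed (use mj in auto)
  moreover have "integrable M g"
    using gc by (intro integrable_const_bound[of _ c]) auto
  moreover have "integrable M (\<lambda>\<omega>. (W t \<omega> - W s \<omega>) $ j)"
    using integrable_gaussian_component[OF pos, of j] unfolding law[symmetric]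
    by (subst (asm) integrable_distr_eq) auto
  ultimately have "(\<integral>\<omega>. g \<omega> * (W t \<omega> - W s \<omega>) $ j \<partial>M) = (\<integral>\<omega>. g \<omega> \<partial>M) * (\<integral>\<omega>. (W t \<omega> - W s \<omega>) $ j \<partial>M)"
    by (rule indep_var_lebesgue_integral)
  also have "(\<integral>\<omega>. (W t \<omega> - W s \<omega>) $ j \<partial>M) = (\<integral>x. x $ j \<partial>gaussian (sqrt (t - s)))"
    unfolding law[symmetric] by (subst integral_distr) auto
  finally show "(\<integral>\<omega>. g \<omega> * (W t \<omega> - W s \<omega>) $ j \<partial>M) = 0"
    by (simp add: integral_gaussian_component[OF pos])
qed

text \<open>\<open>H\<close> is the noise that enters linearly through \<open>G\<close>,
  \<open>Q\<close> the noise that enters quadratically through \<open>R\<close>. Cauchy-Schwarz in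
  time bounds \<open>(norm H)^2\<close> by \<open>\<tau> * Q\<close>, and \<open>Q^2\<close> by
  \<tau> times the integral of the fourth power; Tonelli's theorem and the Gaussian moments do the
  rest. As an integral of increments after \<open>t\<close>, \<open>H\<close> inherits their
  orthogonality to \<open>F t\<close>.\<close>

lemma brownian_window:
  fixes W :: "real \<Rightarrow> 'w \<Rightarrow> real ^ 'd::finite"
  assumes BM: "brownian_motion M F W" and t: "0 \<le> t" and \<tau>: "0 < \<tau>"
  obtains H Q where
    "H \<in> borel_measurable M" "Q \<in> borel_measurable M"
    "AE \<omega> in M. continuous_on {0..} (\<lambda>s. W s \<omega>) \<and>
       H \<omega> = integral {t..t + \<tau>} (\<lambda>s. W s \<omega> - W t \<omega>) \<and>
       Q \<omega> = integral {t..t + \<tau>} (\<lambda>s. (norm (W s \<omega> - W t \<omega>))\<^sup>2)"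
    "(\<integral>\<^sup>+ \<omega>. ennreal ((norm (H \<omega>))\<^sup>2) \<partial>M) \<le> ennreal (real CARD('d) * \<tau> ^ 3)"
    "(\<integral>\<^sup>+ \<omega>. ennreal ((Q \<omega>)\<^sup>2) \<partial>M) \<le> ennreal (3 * (real CARD('d))\<^sup>2 * \<tau> ^ 4)"
    "\<And>g j c. g \<in> borel_measurable (F t) \<Longrightarrow> (AE \<omega> in M. \<bar>g \<omega>\<bar> \<le> c) \<Longrightarrow> (\<integral>\<omega>. g \<omega> * H \<omega> $ j \<partial>M) = 0"
proof -
  interpret prob_space M using BM by (simp add: brownian_motion_def)
  interpret P: pair_sigma_finite M lborel ..
  have sub: "subalgebra M (F u)" for u using BM by (simp add: brownian_motion_def)
  have W: "W u \<in> borel_measurable M" if "0 \<le> u" for u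
    by (rule measurable_from_subalg[OF sub brownian_adapted[OF BM that order_refl]])
  have "AE \<omega> in M. continuous_on {0..} (\<lambda>s. W s \<omega>)"
    using BM by (auto simp: brownian_motion_def elim: AE_mp)
  then obtain N where N: "{\<omega> \<in> space M. \<not> continuous_on {0..} (\<lambda>s. W s \<omega>)} \<subseteq> N" "N \<in> null_sets M"
    by (auto elim!: AE_E3)
  then have NM [measurable]: "N \<in> sets M" by auto
  have AEN: "AE \<omega> in M. \<omega> \<notin> N" using N(2) by (rule AE_not_in)
  \<comment> \<open>Paths are continuous only almost surely and only on nonnegative times: \<open>I\<close> is a version of the
    increment that is continuous in time everywhere, hence jointly measurable.\<close>
  define cl where "cl s = max t (min (t + \<tau>) s)" for s
  have cl: "t \<le> cl s" "cl s \<le> t + \<tau>" "0 \<le> cl s" for s using t \<tau> by (auto simp: cl_def)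
  have cl_id: "cl s = s" if "s \<in> {t..t + \<tau>}" for s using that by (auto simp: cl_def)
  define I where "I s \<omega> = (if \<omega> \<in> N then 0 else W (cl s) \<omega> - W t \<omega>)" for s \<omega>
  have I_meas: "I s \<in> borel_measurable M" for s
    unfolding I_def using W[OF cl(3)[of s]] W[OF t] by measurable
  have I_cont: "continuous_on UNIV (\<lambda>s. I s \<omega>)" if "\<omega> \<in> space M" for \<omega>
  proof (cases "\<omega> \<in> N")
    case False
    then have c: "continuous_on {0..} (\<lambda>s. W s \<omega>)" using N that by blast
    have "continuous_on UNIV (\<lambda>s. W (cl s) \<omega>)"
      by (rule continuous_on_compose2[OF c]) (auto simp: cl(3), auto simp: cl_def intro!: continuous_intros)
    then show ?thesis using False by (simp add: I_def continuous_intros)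
  qed (simp add: I_def)
  have Ip [measurable]: "(\<lambda>(\<omega>, s). I s \<omega>) \<in> borel_measurable (M \<Otimes>\<^sub>M lborel)"
    by (rule borel_measurable_continuous_paths[OF I_meas I_cont])
  have I_t: "AE \<omega> in M. I s \<omega> = W (cl s) \<omega> - W t \<omega>" for s
    using AEN by eventually_elim (simp add: I_def)
  have I_eq_0: "I s \<omega> = 0" if "cl s = t" for s \<omega>
    using that by (auto simp: I_def)
  \<comment> \<open>At \<open>cl s = t\<close> the increment has length zero and no Gaussian law to
    quote; \<open>I\<close> vanishes there.\<close>
  have I2: "(\<integral>\<^sup>+ \<omega>. ennreal ((norm (I s \<omega>))\<^sup>2) \<partial>M) \<le> ennreal (real CARD('d) * \<tau>)" for s
  proof (cases "cl s = t")
    case False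
    have "(\<integral>\<^sup>+ \<omega>. ennreal ((norm (I s \<omega>))\<^sup>2) \<partial>M) = (\<integral>\<^sup>+ \<omega>. ennreal ((norm (W (cl s) \<omega> - W t \<omega>))\<^sup>2) \<partial>M)"
      using I_t[of s] by (intro nn_integral_cong_AE) (auto elim!: eventually_mono)
    also have "\<dots> = ennreal (real CARD('d) * (cl s - t))"
      using False cl(1)[of s] by (intro brownian_increment_power2[OF BM t]) auto
    also have "\<dots> \<le> ennreal (real CARD('d) * \<tau>)"
      using cl(2)[of s] by (intro ennreal_leI mult_left_mono) auto
    finally show ?thesis .
  qed (simp add: I_eq_0)
  have I4: "(\<integral>\<^sup>+ \<omega>. ennreal ((norm (I s \<omega>)) ^ 4) \<partial>M) \<le> ennreal (3 * (real CARD('d))\<^sup>2 * \<tau>\<^sup>2)" for s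
  proof (cases "cl s = t")
    case False
    have "(\<integral>\<^sup>+ \<omega>. ennreal ((norm (I s \<omega>)) ^ 4) \<partial>M) = (\<integral>\<^sup>+ \<omega>. ennreal ((norm (W (cl s) \<omega> - W t \<omega>)) ^ 4) \<partial>M)"
      using I_t[of s] by (intro nn_integral_cong_AE) (auto elim!: eventually_mono)
    also have "\<dots> \<le> ennreal (3 * (real CARD('d))\<^sup>2 * (cl s - t)\<^sup>2)"
      using False cl(1)[of s] by (intro brownian_increment_power4[OF BM t]) auto
    also have "\<dots> \<le> ennreal (3 * (real CARD('d))\<^sup>2 * \<tau>\<^sup>2)"
      using cl[of s] by (intro ennreal_leI mult_left_mono power_mono) auto
    finally show ?thesis .
  qed (simp add: I_eq_0)

  let ?S = "{t..t + \<tau>}"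
  define H where "H \<omega> = (\<integral>s. indicator ?S s *\<^sub>R I s \<omega> \<partial>lborel)" for \<omega>
  define Q where "Q \<omega> = (\<integral>s. indicator ?S s *\<^sub>R (norm (I s \<omega>))\<^sup>2 \<partial>lborel)" for \<omega>
  have si: "set_integrable lborel ?S (\<lambda>s. I s \<omega>)" "set_integrable lborel ?S (\<lambda>s. (norm (I s \<omega>))\<^sup>2)"
    if "\<omega> \<in> space M" for \<omega>
    using I_cont[OF that]
    by (auto intro!: borel_integrable_atLeastAtMost' continuous_intros intro: continuous_on_subset)
  have Hint: "H \<omega> = integral ?S (\<lambda>s. I s \<omega>)" and Qint: "Q \<omega> = integral ?S (\<lambda>s. (norm (I s \<omega>))\<^sup>2)"
    if "\<omega> \<in> space M" for \<omega>
    using si[OF that, THEN set_borel_integral_eq_integral(2)]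
    unfolding H_def Q_def set_lebesgue_integral_def by auto
  have Hm [measurable]: "H \<in> borel_measurable M" and Qm [measurable]: "Q \<in> borel_measurable M"
    unfolding H_def Q_def by measurable
  \<comment> \<open>A general integrand, because the same exchange of integrals serves the square,
    the fourth power and the dominating function in the orthogonality claim.\<close>
  have nnint: "(\<integral>\<^sup>+ \<omega>. \<integral>\<^sup>+ s. indicator ?S s * ennreal (f (I s \<omega>)) \<partial>lborel \<partial>M) \<le> ennreal (\<tau> * B)"
    if [measurable]: "f \<in> borel_measurable borel" and B: "\<And>s. (\<integral>\<^sup>+ \<omega>. ennreal (f (I s \<omega>)) \<partial>M) \<le> ennreal B"
    for f B
  proof -
    have "(\<integral>\<^sup>+ \<omega>. \<integral>\<^sup>+ s. indicator ?S s * ennreal (f (I s \<omega>)) \<partial>lborel \<partial>M)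
        = (\<integral>\<^sup>+ s. \<integral>\<^sup>+ \<omega>. indicator ?S s * ennreal (f (I s \<omega>)) \<partial>M \<partial>lborel)"
      by (rule P.Fubini'[symmetric]) measurable
    also have "\<dots> = (\<integral>\<^sup>+ s. indicator ?S s * (\<integral>\<^sup>+ \<omega>. ennreal (f (I s \<omega>)) \<partial>M) \<partial>lborel)"
      using I_meas by (intro nn_integral_cong nn_integral_cmult) measurable
    also have "\<dots> \<le> (\<integral>\<^sup>+ s. ennreal B * indicator ?S s \<partial>lborel)"
      using B by (intro nn_integral_mono) (auto split: split_indicator)
    also have "\<dots> = ennreal (\<tau> * B)"
      using \<tau> by (subst nn_integral_cmult_indicator) (auto simp: ennreal_mult'' mult.commute)
    finally show ?thesis .
  qed

  have Q_nn: "ennreal (Q \<omega>) = (\<integral>\<^sup>+ s. indicator ?S s * ennreal ((norm (I s \<omega>))\<^sup>2) \<partial>lborel)"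
    if "\<omega> \<in> space M" for \<omega>
    unfolding Qint[OF that] using I_cont[OF that]
    by (intro nn_integral_indicator_continuous[symmetric]) (auto intro!: continuous_intros intro: continuous_on_subset)
  have "(norm (H \<omega>))\<^sup>2 \<le> \<tau> * Q \<omega>" if "\<omega> \<in> space M" for \<omega>
  proof -
    have c: "continuous_on ?S (\<lambda>s. I s \<omega>)" using I_cont[OF that] by (rule continuous_on_subset) simp
    have "norm (H \<omega>) \<le> integral ?S (\<lambda>s. norm (I s \<omega>))"
      unfolding Hint[OF that] using c
      by (intro integral_norm_bound_integral) (auto intro!: integrable_continuous_interval continuous_intros)
    then have "(norm (H \<omega>))\<^sup>2 \<le> (integral ?S (\<lambda>s. norm (I s \<omega>)))\<^sup>2" by (rule power_mono) simp
    also have "\<dots> \<le> (t + \<tau> - t) * Q \<omega>"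
      unfolding Qint[OF that] using \<tau> c by (intro power2_integral_le continuous_intros) auto
    finally show ?thesis by simp
  qed
  then have "(\<integral>\<^sup>+ \<omega>. ennreal ((norm (H \<omega>))\<^sup>2) \<partial>M) \<le> (\<integral>\<^sup>+ \<omega>. ennreal \<tau> * ennreal (Q \<omega>) \<partial>M)"
    using \<tau> by (intro nn_integral_mono) (simp add: ennreal_mult'[symmetric] ennreal_leI)
  also have "\<dots> = ennreal \<tau> * (\<integral>\<^sup>+ \<omega>. ennreal (Q \<omega>) \<partial>M)"
    by (rule nn_integral_cmult) measurable
  also have "(\<integral>\<^sup>+ \<omega>. ennreal (Q \<omega>) \<partial>M) \<le> ennreal (\<tau> * (real CARD('d) * \<tau>))"
    using nnint[of "\<lambda>x. (norm x)\<^sup>2", OF _ I2] by (simp add: Q_nn cong: nn_integral_cong)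
  also have "ennreal \<tau> * ennreal (\<tau> * (real CARD('d) * \<tau>)) = ennreal (real CARD('d) * \<tau> ^ 3)"
    using \<tau> by (simp add: ennreal_mult'[symmetric] power3_eq_cube mult_ac)
  finally have H2: "(\<integral>\<^sup>+ \<omega>. ennreal ((norm (H \<omega>))\<^sup>2) \<partial>M) \<le> ennreal (real CARD('d) * \<tau> ^ 3)"
    by (simp add: mult_left_mono)

  have "ennreal ((Q \<omega>)\<^sup>2) \<le> ennreal \<tau> * (\<integral>\<^sup>+ s. indicator ?S s * ennreal ((norm (I s \<omega>)) ^ 4) \<partial>lborel)"
    if "\<omega> \<in> space M" for \<omega>
  proof -
    have c: "continuous_on ?S (\<lambda>s. I s \<omega>)" using I_cont[OF that] by (rule continuous_on_subset) simp
    have "(Q \<omega>)\<^sup>2 \<le> (t + \<tau> - t) * integral ?S (\<lambda>s. ((norm (I s \<omega>))\<^sup>2)\<^sup>2)"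
      unfolding Qint[OF that] using \<tau> c by (intro power2_integral_le continuous_intros) auto
    then have "(Q \<omega>)\<^sup>2 \<le> \<tau> * integral ?S (\<lambda>s. (norm (I s \<omega>)) ^ 4)"
      by (simp flip: power_mult)
    then have "ennreal ((Q \<omega>)\<^sup>2) \<le> ennreal \<tau> * ennreal (integral ?S (\<lambda>s. (norm (I s \<omega>)) ^ 4))"
      using \<tau> by (simp add: ennreal_mult'[symmetric] ennreal_leI)
    then show ?thesis
      using c by (subst nn_integral_indicator_continuous) (auto intro!: continuous_intros)
  qed
  then have "(\<integral>\<^sup>+ \<omega>. ennreal ((Q \<omega>)\<^sup>2) \<partial>M)
      \<le> (\<integral>\<^sup>+ \<omega>. ennreal \<tau> * (\<integral>\<^sup>+ s. indicator ?S s * ennreal ((norm (I s \<omega>)) ^ 4) \<partial>lborel) \<partial>M)"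
    by (intro nn_integral_mono)
  also have "\<dots> = ennreal \<tau> * (\<integral>\<^sup>+ \<omega>. (\<integral>\<^sup>+ s. indicator ?S s * ennreal ((norm (I s \<omega>)) ^ 4) \<partial>lborel) \<partial>M)"
    by (rule nn_integral_cmult) measurable
  also have "\<dots> \<le> ennreal \<tau> * ennreal (\<tau> * (3 * (real CARD('d))\<^sup>2 * \<tau>\<^sup>2))"
    using nnint[of "\<lambda>x. (norm x) ^ 4", OF _ I4] by (intro mult_left_mono) auto
  also have "\<dots> = ennreal (3 * (real CARD('d))\<^sup>2 * \<tau> ^ 4)"
    using \<tau> by (simp add: ennreal_mult'[symmetric] power4_eq_xxxx power2_eq_square mult_ac)
  finally have Q2: "(\<integral>\<^sup>+ \<omega>. ennreal ((Q \<omega>)\<^sup>2) \<partial>M) \<le> ennreal (3 * (real CARD('d))\<^sup>2 * \<tau> ^ 4)" .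

  have orth: "(\<integral>\<omega>. g \<omega> * H \<omega> $ j \<partial>M) = 0"
    if g: "g \<in> borel_measurable (F t)" and gc: "AE \<omega> in M. \<bar>g \<omega>\<bar> \<le> c" for g j c
  proof -
    have gM [measurable]: "g \<in> borel_measurable M" using measurable_from_subalg[OF sub g] .
    have Is: "(\<integral>\<omega>. g \<omega> * I s \<omega> $ j \<partial>M) = 0" for s
    proof (cases "cl s = t")
      case False
      have "(\<integral>\<omega>. g \<omega> * I s \<omega> $ j \<partial>M) = (\<integral>\<omega>. g \<omega> * (W (cl s) \<omega> - W t \<omega>) $ j \<partial>M)"
      proof (rule integral_cong_AE)
        note [measurable] = W[OF cl(3)[of s]] W[OF t] I_meas[of s]
        show "(\<lambda>\<omega>. g \<omega> * I s \<omega> $ j) \<in> borel_measurable M"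
          "(\<lambda>\<omega>. g \<omega> * (W (cl s) \<omega> - W t \<omega>) $ j) \<in> borel_measurable M"
          by measurable
      qed (use I_t[of s] in \<open>auto elim!: eventually_mono\<close>)
      also have "\<dots> = 0"
        using False cl(1)[of s] by (intro brownian_increment_centered[OF BM t _ g gc]) auto
      finally show ?thesis .
    qed (simp add: I_eq_0)
    have mg: "(\<lambda>(\<omega>, s). indicator ?S s * (g \<omega> * I s \<omega> $ j)) \<in> borel_measurable (M \<Otimes>\<^sub>M lborel)"
    proof -
      have [measurable]: "(\<lambda>q. I (snd q) (fst q) $ j) \<in> borel_measurable (M \<Otimes>\<^sub>M lborel)"
        using borel_measurable_vec_nth[OF Ip] by (simp add: case_prod_beta)
      show ?thesis unfolding case_prod_beta by measurable
    qed
    \<comment> \<open>Fubini's theorem asks for absolute integrability on the product: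
      \<open>1 + (norm (I s \<omega>))\<^sup>2\<close> dominates each coordinate of \<open>I\<close>
      and has bounded expectation by \<open>I2\<close>. The sign of \<open>c\<close> is not given,
      hence its absolute value in the final bound.\<close>
    have "integrable (M \<Otimes>\<^sub>M lborel) (\<lambda>(\<omega>, s). indicator ?S s * (g \<omega> * I s \<omega> $ j))"
    proof (rule integrableI_bounded)
      have "(\<integral>\<^sup>+ q. ennreal (norm (case q of (\<omega>, s) \<Rightarrow> indicator ?S s * (g \<omega> * I s \<omega> $ j))) \<partial>(M \<Otimes>\<^sub>M lborel))
          = (\<integral>\<^sup>+ \<omega>. \<integral>\<^sup>+ s. ennreal (norm (indicator ?S s * (g \<omega> * I s \<omega> $ j))) \<partial>lborel \<partial>M)"
        by (subst lborel.nn_integral_fst[symmetric]) (use mg in auto)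
      also have "\<dots> \<le> (\<integral>\<^sup>+ \<omega>. \<integral>\<^sup>+ s. indicator ?S s * ennreal (c * (1 + (norm (I s \<omega>))\<^sup>2)) \<partial>lborel \<partial>M)"
      proof (rule nn_integral_mono_AE, use gc in eventually_elim, rule nn_integral_mono)
        fix \<omega> s assume "\<bar>g \<omega>\<bar> \<le> c"
        moreover have "\<bar>I s \<omega> $ j\<bar> \<le> 1 + (norm (I s \<omega>))\<^sup>2"
        proof -
          have "0 \<le> (norm (I s \<omega>) - 1)\<^sup>2" by simp
          then have "norm (I s \<omega>) \<le> 1 + (norm (I s \<omega>))\<^sup>2"
            by (simp add: power2_diff) (smt (verit) norm_ge_zero)
          then show ?thesis using component_le_norm_cart[of "I s \<omega>" j] by linarith
        qed
        ultimately have "\<bar>g \<omega>\<bar> * \<bar>I s \<omega> $ j\<bar> \<le> c * (1 + (norm (I s \<omega>))\<^sup>2)"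
          by (intro mult_mono) auto
        then show "ennreal (norm (indicator ?S s * (g \<omega> * I s \<omega> $ j))) \<le> indicator ?S s * ennreal (c * (1 + (norm (I s \<omega>))\<^sup>2))"
          by (auto simp: abs_mult ennreal_leI split: split_indicator)
      qed
      also have "\<dots> \<le> ennreal (\<tau> * (\<bar>c\<bar> * (1 + real CARD('d) * \<tau>)))"
      proof (rule nnint[of "\<lambda>x. c * (1 + (norm x)\<^sup>2)"])
        fix s
        have "(\<integral>\<^sup>+ \<omega>. ennreal (c * (1 + (norm (I s \<omega>))\<^sup>2)) \<partial>M) \<le> (\<integral>\<^sup>+ \<omega>. ennreal \<bar>c\<bar> * (1 + ennreal ((norm (I s \<omega>))\<^sup>2)) \<partial>M)"
        proof (rule nn_integral_mono)
          fix \<omega>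
          have "ennreal \<bar>c\<bar> * (1 + ennreal ((norm (I s \<omega>))\<^sup>2)) = ennreal (\<bar>c\<bar> * (1 + (norm (I s \<omega>))\<^sup>2))"
            by (simp add: ennreal_mult' ennreal_plus)
          also have "\<dots> \<ge> ennreal (c * (1 + (norm (I s \<omega>))\<^sup>2))"
            by (intro ennreal_leI mult_right_mono) auto
          finally show "ennreal (c * (1 + (norm (I s \<omega>))\<^sup>2)) \<le> ennreal \<bar>c\<bar> * (1 + ennreal ((norm (I s \<omega>))\<^sup>2))" .
        qed
        also have "\<dots> = ennreal \<bar>c\<bar> * (1 + (\<integral>\<^sup>+ \<omega>. ennreal ((norm (I s \<omega>))\<^sup>2) \<partial>M))"
          using I_meas[of s] by (subst nn_integral_cmult, measurable, subst nn_integral_add) (auto simp: emeasure_space_1)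
        also have "\<dots> \<le> ennreal \<bar>c\<bar> * (1 + ennreal (real CARD('d) * \<tau>))"
          by (intro mult_left_mono add_left_mono I2) simp
        also have "\<dots> = ennreal (\<bar>c\<bar> * (1 + real CARD('d) * \<tau>))"
          using \<tau> by (simp add: ennreal_mult' ennreal_plus)
        finally show "(\<integral>\<^sup>+ \<omega>. ennreal (c * (1 + (norm (I s \<omega>))\<^sup>2)) \<partial>M) \<le> ennreal (\<bar>c\<bar> * (1 + real CARD('d) * \<tau>))" .
      qed measurable
      also have "\<dots> < \<infinity>" by simp
      finally show "(\<integral>\<^sup>+ q. ennreal (norm (case q of (\<omega>, s) \<Rightarrow> indicator ?S s * (g \<omega> * I s \<omega> $ j))) \<partial>(M \<Otimes>\<^sub>M lborel)) < \<infinity>" .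
    qed (rule mg)
    from P.Fubini_integral[OF this]
    have "(\<integral>\<omega>. (\<integral>s. indicator ?S s * (g \<omega> * I s \<omega> $ j) \<partial>lborel) \<partial>M) = (\<integral>s. (\<integral>\<omega>. indicator ?S s * (g \<omega> * I s \<omega> $ j) \<partial>M) \<partial>lborel)"
      by simp
    also have "\<dots> = 0" by (simp add: Is)
    also have "(\<integral>\<omega>. (\<integral>s. indicator ?S s * (g \<omega> * I s \<omega> $ j) \<partial>lborel) \<partial>M) = (\<integral>\<omega>. g \<omega> * H \<omega> $ j \<partial>M)"
    proof (rule Bochner_Integration.integral_cong[OF refl])
      fix \<omega> assume w: "\<omega> \<in> space M"
      have "H \<omega> $ j = (\<integral>s. (indicator ?S s *\<^sub>R I s \<omega>) $ j \<partial>lborel)"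
        unfolding H_def using si(1)[OF w] unfolding set_integrable_def
        by (intro integral_bounded_linear[OF bounded_linear_vec_nth, symmetric])
      then show "(\<integral>s. indicator ?S s * (g \<omega> * I s \<omega> $ j) \<partial>lborel) = g \<omega> * H \<omega> $ j"
        by (simp add: mult.left_commute[of _ "g \<omega>"])
    qed
    finally show ?thesis .
  qed

  have "AE \<omega> in M. continuous_on {0..} (\<lambda>s. W s \<omega>) \<and>
       H \<omega> = integral {t..t + \<tau>} (\<lambda>s. W s \<omega> - W t \<omega>) \<and>
       Q \<omega> = integral {t..t + \<tau>} (\<lambda>s. (norm (W s \<omega> - W t \<omega>))\<^sup>2)"
    using AEN AE_space
  proof eventually_elim
    fix \<omega> assume w: "\<omega> \<notin> N" "\<omega> \<in> space M"
    have "I s \<omega> = W s \<omega> - W t \<omega>" if "s \<in> ?S" for s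
      using w cl_id[OF that] by (simp add: I_def)
    then show "continuous_on {0..} (\<lambda>s. W s \<omega>) \<and>
       H \<omega> = integral {t..t + \<tau>} (\<lambda>s. W s \<omega> - W t \<omega>) \<and>
       Q \<omega> = integral {t..t + \<tau>} (\<lambda>s. (norm (W s \<omega> - W t \<omega>))\<^sup>2)"
      using w N unfolding Hint[OF w(2)] Qint[OF w(2)]
      by (auto intro!: Henstock_Kurzweil_Integration.integral_cong)
  qed
  from that[OF Hm Qm this H2 Q2 orth] show ?thesis .
qed

section \<open>The law of the random batch chain\<close>

text \<open>Induction on the largest index: \<open>X k\<close> is independent of \<open>G k\<close>,
  which contains all events of the earlier variables, so its factor splits off.\<close>

lemma (in prob_space) indep_vars_sequential:
  fixes X :: "nat \<Rightarrow> 'a \<Rightarrow> 'b" and G :: "nat \<Rightarrow> 'a measure"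
  assumes X: "\<And>k. X k \<in> measurable M (N k)"
    and G: "\<And>k. subalgebra M (G k)" "\<And>j k. j < k \<Longrightarrow> X j \<in> measurable (G k) (N j)"
    and ind: "\<And>k. indep_set (sets (G k)) (preimages M (N k) (X k))"
  shows "indep_vars N X UNIV"
  unfolding indep_vars_def2
proof (intro conjI ballI X indep_setsI)
  fix k show "{X k -` A \<inter> space M |A. A \<in> sets (N k)} \<subseteq> events"
    using X by (auto intro: measurable_sets)
next
  fix A and J :: "nat set"
  assume "J \<noteq> {}" "J \<subseteq> UNIV" "finite J"
    and A: "\<forall>j\<in>J. A j \<in> {X j -` A \<inter> space M |A. A \<in> sets (N j)}"
  \<comment> \<open>The intersection with \<open>space M\<close> gives probability 1 to the empty
    index set, at which the induction starts; the intersection over no sets is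
    \<open>UNIV\<close>.\<close>
  have "prob ((\<Inter>j\<in>J. A j) \<inter> space M) = (\<Prod>j\<in>J. prob (A j))"
    using \<open>finite J\<close> A
  proof (induction J rule: finite_linorder_max_induct)
    case empty
    then show ?case by (simp add: prob_space)
  next
    case (insert k J)
    have spG: "space (G k) = space M" using G(1) by (simp add: subalgebra_def)
    have "A j \<in> sets (G k)" if j: "j \<in> J" for j
    proof -
      obtain B where "B \<in> sets (N j)" "A j = X j -` B \<inter> space M" using insert.prems j by auto
      then show ?thesis
        using measurable_sets[OF G(2), of j k B] insert.hyps j spG by simp
    qed
    then have "(\<Inter>j\<in>J. A j) \<inter> space M \<in> sets (G k)"
      using insert.hyps spG sets.top[of "G k"] by (cases "J = {}") (auto intro!: sets.Int sets.finite_INT)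
    moreover have "A k \<in> preimages M (N k) (X k)" using insert.prems by (auto simp: preimages_def)
    ultimately have "prob (((\<Inter>j\<in>J. A j) \<inter> space M) \<inter> A k) = prob ((\<Inter>j\<in>J. A j) \<inter> space M) * prob (A k)"
      by (rule indep_setD[OF ind])
    moreover have "(\<Inter>j\<in>insert k J. A j) \<inter> space M = ((\<Inter>j\<in>J. A j) \<inter> space M) \<inter> A k" by auto
    moreover have "prob ((\<Inter>j\<in>J. A j) \<inter> space M) = (\<Prod>j\<in>J. prob (A j))"
      using insert by auto
    ultimately show ?case
      using insert.hyps by (simp add: mult.commute) (metis less_irrefl mult.commute prod.insert)
  qed
  moreover have "(\<Inter>j\<in>J. A j) \<inter> space M = (\<Inter>j\<in>J. A j)"
    using A \<open>J \<noteq> {}\<close> by fastforce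
  ultimately show "prob (\<Inter>j\<in>J. A j) = (\<Prod>j\<in>J. prob (A j))" by simp
qed

lemma (in prob_space) indep_vars_distr_PiM_UNIV:
  fixes X :: "nat \<Rightarrow> 'a \<Rightarrow> 'b"
  assumes "indep_vars N X UNIV"
  shows "(\<lambda>\<omega> k. X k \<omega>) \<in> measurable M (Pi\<^sub>M UNIV N)"
    and "distr M (Pi\<^sub>M UNIV N) (\<lambda>\<omega> k. X k \<omega>) = Pi\<^sub>M UNIV (\<lambda>k. distr M (N k) (X k))"
proof -
  have X: "X k \<in> measurable M (N k)" for k using assms by (simp add: indep_vars_def2)
  have "(\<lambda>\<omega>. \<lambda>k\<in>UNIV. X k \<omega>) \<in> measurable M (Pi\<^sub>M UNIV N)"
    by (rule measurable_restrict) (rule X)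
  then show "(\<lambda>\<omega> k. X k \<omega>) \<in> measurable M (Pi\<^sub>M UNIV N)"
    by (simp add: restrict_def)
  show "distr M (Pi\<^sub>M UNIV N) (\<lambda>\<omega> k. X k \<omega>) = Pi\<^sub>M UNIV (\<lambda>k. distr M (N k) (X k))"
    using indep_vars_iff_distr_eq_PiM'[of UNIV X N] X assms by (simp add: restrict_def)
qed

text \<open>Rectangles determine a product measure, and on rectangles the claim is independence
  itself. The two variables may have different value types, as batches and Gaussian vectors
  do.\<close>

lemma (in prob_space) indep_set_preimages_distr:
  assumes X: "X \<in> measurable M S" and Y: "Y \<in> measurable M T"
    and ind: "indep_set (preimages M S X) (preimages M T Y)"
  shows "distr M (S \<Otimes>\<^sub>M T) (\<lambda>\<omega>. (X \<omega>, Y \<omega>)) = distr M S X \<Otimes>\<^sub>M distr M T Y"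
proof -
  interpret X: prob_space "distr M S X" by (rule prob_space_distr[OF X])
  interpret Y: prob_space "distr M T Y" by (rule prob_space_distr[OF Y])
  show ?thesis
  proof (rule pair_measure_eqI[symmetric])
    fix A B assume "A \<in> sets (distr M S X)" "B \<in> sets (distr M T Y)"
    then have AB: "A \<in> sets S" "B \<in> sets T" by auto
    have "prob ((X -` A \<inter> space M) \<inter> (Y -` B \<inter> space M)) = prob (X -` A \<inter> space M) * prob (Y -` B \<inter> space M)"
      using AB by (intro indep_setD[OF ind]) (auto simp: preimages_def)
    moreover have "(\<lambda>\<omega>. (X \<omega>, Y \<omega>)) -` (A \<times> B) \<inter> space M = (X -` A \<inter> space M) \<inter> (Y -` B \<inter> space M)"
      by auto
    ultimately show "emeasure (distr M S X) A * emeasure (distr M T Y) B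
        = emeasure (distr M (S \<Otimes>\<^sub>M T) (\<lambda>\<omega>. (X \<omega>, Y \<omega>))) (A \<times> B)"
      using AB X Y by (simp add: emeasure_distr emeasure_eq_measure ennreal_mult')
  qed (auto intro: X.sigma_finite_measure_axioms Y.sigma_finite_measure_axioms cong: sets_pair_measure_cong)
qed

text \<open>Measurability of \<open>b S\<close> is available for \<open>S\<close> in the finite set
  \<open>A\<close>; treating the values of the current batch one at a time makes the batch-dependent
  drift jointly measurable.\<close>

lemma measurable_rb_chain:
  assumes "finite A" and b: "\<And>S. S \<in> A \<Longrightarrow> b S \<in> borel_measurable borel"
  shows "(\<lambda>q. rb_chain b D \<tau> (fst q) (snd q) x m)
    \<in> borel_measurable (Pi\<^sub>M UNIV (\<lambda>_. count_space A) \<Otimes>\<^sub>M Pi\<^sub>M UNIV (\<lambda>_. borel))" (is "_ \<in> borel_measurable ?P")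
proof (induction m)
  case (Suc m)
  note [measurable] = Suc.IH
  have "(\<lambda>q. (\<lambda>S q. b S (rb_chain b D \<tau> (fst q) (snd q) x m)) (fst q m) q) \<in> borel_measurable ?P"
  proof (rule measurable_compose_countable'[where f = "\<lambda>S q. b S (rb_chain b D \<tau> (fst q) (snd q) x m)" and g = "\<lambda>q. fst q m"])
    show "(\<lambda>q. b S (rb_chain b D \<tau> (fst q) (snd q) x m)) \<in> borel_measurable ?P" if "S \<in> A" for S
      by (rule measurable_compose[OF Suc.IH b[OF that]])
    show "(\<lambda>q. fst q m) \<in> measurable ?P (count_space A)" by measurable
  qed (use assms in \<open>auto intro: countable_finite\<close>)
  then have [measurable]: "(\<lambda>q. b (fst q m) (rb_chain b D \<tau> (fst q) (snd q) x m)) \<in> borel_measurable ?P" by simp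
  have [measurable]: "(\<lambda>q. snd q m) \<in> borel_measurable ?P" by measurable
  show ?case by simp
qed simp

text \<open>The law of the batch sequence stays unevaluated: the coupling keeps the batches and
  exchanges only the Gaussian factor.\<close>

lemma batch_noise_distr:
  fixes z :: "nat \<Rightarrow> 'v \<Rightarrow> real ^ 'd::finite"
  assumes bn: "batch_noise M' N i p \<xi> z"
  shows "(\<lambda>\<omega>. ((\<lambda>k. \<xi> k \<omega>), (\<lambda>k. z k \<omega>))) \<in> measurable M' (Pi\<^sub>M UNIV (\<lambda>_. count_space (batches N i p)) \<Otimes>\<^sub>M Pi\<^sub>M UNIV (\<lambda>_. borel))"
    and "distr M' (Pi\<^sub>M UNIV (\<lambda>_. count_space (batches N i p)) \<Otimes>\<^sub>M Pi\<^sub>M UNIV (\<lambda>_. borel)) (\<lambda>\<omega>. ((\<lambda>k. \<xi> k \<omega>), (\<lambda>k. z k \<omega>)))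
      = distr M' (Pi\<^sub>M UNIV (\<lambda>_. count_space (batches N i p))) (\<lambda>\<omega> k. \<xi> k \<omega>) \<Otimes>\<^sub>M Pi\<^sub>M UNIV (\<lambda>_. gaussian 1)"
proof -
  interpret prob_space M' using bn by (simp add: batch_noise_def)
  have \<xi>: "(\<lambda>\<omega> k. \<xi> k \<omega>) \<in> measurable M' (Pi\<^sub>M UNIV (\<lambda>_. count_space (batches N i p)))"
    using bn by (intro indep_vars_distr_PiM_UNIV) (simp add: batch_noise_def)
  have z: "(\<lambda>\<omega> k. z k \<omega>) \<in> measurable M' (Pi\<^sub>M UNIV (\<lambda>_. borel))"
    "distr M' (Pi\<^sub>M UNIV (\<lambda>_. borel)) (\<lambda>\<omega> k. z k \<omega>) = Pi\<^sub>M UNIV (\<lambda>k. distr M' borel (z k))"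
    using bn indep_vars_distr_PiM_UNIV[of "\<lambda>_. borel" z] unfolding batch_noise_def by blast+
  show "(\<lambda>\<omega>. ((\<lambda>k. \<xi> k \<omega>), (\<lambda>k. z k \<omega>))) \<in> measurable M' (Pi\<^sub>M UNIV (\<lambda>_. count_space (batches N i p)) \<Otimes>\<^sub>M Pi\<^sub>M UNIV (\<lambda>_. borel))"
    using \<xi> z(1) by (rule measurable_Pair)
  have "distr M' borel (z k) = gaussian 1" for k using bn by (simp add: batch_noise_def)
  then show "distr M' (Pi\<^sub>M UNIV (\<lambda>_. count_space (batches N i p)) \<Otimes>\<^sub>M Pi\<^sub>M UNIV (\<lambda>_. borel)) (\<lambda>\<omega>. ((\<lambda>k. \<xi> k \<omega>), (\<lambda>k. z k \<omega>)))
      = distr M' (Pi\<^sub>M UNIV (\<lambda>_. count_space (batches N i p))) (\<lambda>\<omega> k. \<xi> k \<omega>) \<Otimes>\<^sub>M Pi\<^sub>M UNIV (\<lambda>_. gaussian 1)"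
    using indep_set_preimages_distr[OF \<xi> z(1)] bn by (simp add: batch_noise_def z(2))
qed

text \<open>The replacement for \<open>z k\<close> in the coupled chain; the factor
  \<open>1 / sqrt \<tau>\<close> makes its law standard Gaussian.\<close>

definition normalized_increment :: "real \<Rightarrow> (real \<Rightarrow> 'w \<Rightarrow> real ^ 'd::finite) \<Rightarrow> nat \<Rightarrow> 'w \<Rightarrow> real ^ 'd" where
  "normalized_increment \<tau> W k \<omega> = (1 / sqrt \<tau>) *\<^sub>R (W (real (Suc k) * \<tau>) \<omega> - W (real k * \<tau>) \<omega>)"

lemma normalized_increment_adapted:
  assumes BM: "brownian_motion M F W" and \<tau>: "0 < \<tau>" and "j < k"
  shows "normalized_increment \<tau> W j \<in> borel_measurable (F (real k * \<tau>))"
proof -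
  have "W (real (Suc j) * \<tau>) \<in> borel_measurable (F (real k * \<tau>))" "W (real j * \<tau>) \<in> borel_measurable (F (real k * \<tau>))"
    using assms by (auto intro!: brownian_adapted[OF BM] mult_right_mono simp del: of_nat_Suc)
  then show ?thesis unfolding normalized_increment_def by measurable
qed

text \<open>The increment over step \<open>k\<close> is independent of
  \<open>F (real k * \<tau>)\<close>, to which all earlier increments are adapted; this is the
  situation of \<open>indep_vars_sequential\<close>.\<close>

lemma normalized_increment_distr:
  fixes W :: "real \<Rightarrow> 'w \<Rightarrow> real ^ 'd::finite"
  assumes BM: "brownian_motion M F W" and \<tau>: "0 < \<tau>"
  shows "(\<lambda>\<omega> k. normalized_increment \<tau> W k \<omega>) \<in> measurable M (Pi\<^sub>M UNIV (\<lambda>_. borel))"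
    and "distr M (Pi\<^sub>M UNIV (\<lambda>_. borel)) (\<lambda>\<omega> k. normalized_increment \<tau> W k \<omega>) = Pi\<^sub>M UNIV (\<lambda>_. gaussian 1)"
proof -
  interpret prob_space M using BM by (simp add: brownian_motion_def)
  have sub: "subalgebra M (F u)" for u using BM by (simp add: brownian_motion_def)
  have inc: "real k * \<tau> < real (Suc k) * \<tau>" for k using \<tau> by simp
  have d: "(\<lambda>\<omega>. W (real (Suc k) * \<tau>) \<omega> - W (real k * \<tau>) \<omega>) \<in> borel_measurable M" for k
    using \<tau> by (intro brownian_increment_measurable[OF BM _ inc]) simp
  have n: "normalized_increment \<tau> W k \<in> borel_measurable M" for k
    unfolding normalized_increment_def using d by measurable
  have ind: "indep_vars (\<lambda>_. borel) (\<lambda>k. normalized_increment \<tau> W k) UNIV"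
  proof (rule indep_vars_sequential[where G = "\<lambda>k. F (real k * \<tau>)"])
    show "normalized_increment \<tau> W j \<in> borel_measurable (F (real k * \<tau>))" if "j < k" for j k
      by (rule normalized_increment_adapted[OF BM \<tau> that])
    show "indep_set (sets (F (real k * \<tau>))) (preimages M borel (normalized_increment \<tau> W k))" for k
    proof (rule indep_setI)
      show "sets (F (real k * \<tau>)) \<subseteq> events" using sub by (simp add: subalgebra_def)
      show "preimages M borel (normalized_increment \<tau> W k) \<subseteq> events"
        using n by (auto simp: preimages_def intro: measurable_sets)
      fix a b assume a: "a \<in> sets (F (real k * \<tau>))" and "b \<in> preimages M borel (normalized_increment \<tau> W k)"
      then obtain B where B: "B \<in> sets borel" "b = normalized_increment \<tau> W k -` B \<inter> space M"
        by (auto simp: preimages_def)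
      have "(\<lambda>x::real ^ 'd. (1 / sqrt \<tau>) *\<^sub>R x) -` B \<inter> space borel \<in> sets borel"
        by (rule measurable_sets[OF _ B(1)]) simp
      then have "b \<in> preimages M borel (\<lambda>\<omega>. W (real (Suc k) * \<tau>) \<omega> - W (real k * \<tau>) \<omega>)"
        unfolding preimages_def B(2)
        by (intro CollectI exI[of _ "(\<lambda>x. (1 / sqrt \<tau>) *\<^sub>R x) -` B"]) (auto simp: normalized_increment_def)
      moreover have "indep_set (sets (F (real k * \<tau>))) (preimages M borel (\<lambda>\<omega>. W (real (Suc k) * \<tau>) \<omega> - W (real k * \<tau>) \<omega>))"
        using BM inc[of k] \<tau> unfolding brownian_motion_def by (simp del: of_nat_Suc)
      ultimately show "prob (a \<inter> b) = prob a * prob b" using a indep_setD by blast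
    qed
  qed (use n sub in auto)
  have "distr M borel (normalized_increment \<tau> W k) = gaussian 1" for k
  proof -
    have "real (Suc k) * \<tau> - real k * \<tau> = \<tau>" by (simp add: algebra_simps)
    then have "distr M borel (\<lambda>\<omega>. W (real (Suc k) * \<tau>) \<omega> - W (real k * \<tau>) \<omega>) = gaussian (sqrt \<tau>)"
      using BM inc[of k] \<tau> unfolding brownian_motion_def by (simp del: of_nat_Suc)
    then have "distr (gaussian (sqrt \<tau>)) borel (\<lambda>x. (1 / sqrt \<tau>) *\<^sub>R x)
        = distr M borel (\<lambda>\<omega>. (1 / sqrt \<tau>) *\<^sub>R (W (real (Suc k) * \<tau>) \<omega> - W (real k * \<tau>) \<omega>))"
      using d[of k] by (subst distr_distr[of _ borel, unfolded comp_def, symmetric]) auto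
    moreover have "distr (gaussian (sqrt \<tau>)) borel (\<lambda>x. (1 / sqrt \<tau>) *\<^sub>R x) = (gaussian 1 :: (real ^ 'd) measure)"
      using distr_gaussian_scaleR[of "1 / sqrt \<tau>" "sqrt \<tau>"] \<tau> by simp
    ultimately show ?thesis by (simp add: normalized_increment_def[abs_def])
  qed
  then show "distr M (Pi\<^sub>M UNIV (\<lambda>_. borel)) (\<lambda>\<omega> k. normalized_increment \<tau> W k \<omega>) = Pi\<^sub>M UNIV (\<lambda>_. gaussian 1)"
    using indep_vars_distr_PiM_UNIV(2)[OF ind] by simp
  show "(\<lambda>\<omega> k. normalized_increment \<tau> W k \<omega>) \<in> measurable M (Pi\<^sub>M UNIV (\<lambda>_. borel))"
    by (rule indep_vars_distr_PiM_UNIV(1)[OF ind])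
qed

text \<open>The chain is one measurable function of the batch sequence and the noise sequence.
  Batches with rescaled increments on the product space have the same joint law as batches with
  \<open>z\<close> on \<open>M'\<close>, so the exchange of noises leaves the law of the chain
  unchanged.\<close>

lemma rb_chain_coupling_distr:
  fixes W :: "real \<Rightarrow> 'w \<Rightarrow> real ^ 'd::finite" and z :: "nat \<Rightarrow> 'v \<Rightarrow> real ^ 'd"
  assumes BM: "brownian_motion M F W" and \<tau>: "0 < \<tau>" and bn: "batch_noise M' N i p \<xi> z"
    and b: "\<And>S. S \<in> A \<Longrightarrow> b S \<in> borel_measurable borel" and A: "A = batches N i p" "finite A"
  shows "(\<lambda>q. rb_chain b D \<tau> (\<lambda>k. \<xi> k (fst q)) (\<lambda>k. normalized_increment \<tau> W k (snd q)) x m) \<in> borel_measurable (M' \<Otimes>\<^sub>M M)"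
    and "distr M' borel (\<lambda>\<omega>. rb_chain b D \<tau> (\<lambda>k. \<xi> k \<omega>) (\<lambda>k. z k \<omega>) x m)
     = distr (M' \<Otimes>\<^sub>M M) borel (\<lambda>q. rb_chain b D \<tau> (\<lambda>k. \<xi> k (fst q)) (\<lambda>k. normalized_increment \<tau> W k (snd q)) x m)"
proof -
  interpret M: prob_space M using BM by (simp add: brownian_motion_def)
  interpret M': prob_space M' using bn by (simp add: batch_noise_def)
  let ?PA = "Pi\<^sub>M UNIV (\<lambda>_::nat. count_space A)"
  let ?PB = "Pi\<^sub>M UNIV (\<lambda>_::nat. borel :: (real ^ 'd) measure)"
  let ?f = "\<lambda>q. rb_chain b D \<tau> (fst q) (snd q) x m"
  have f: "?f \<in> borel_measurable (?PA \<Otimes>\<^sub>M ?PB)"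
    by (rule measurable_rb_chain[OF A(2) b])
  have \<xi>: "(\<lambda>\<omega> k. \<xi> k \<omega>) \<in> measurable M' ?PA"
    unfolding A using bn by (intro M'.indep_vars_distr_PiM_UNIV) (simp add: batch_noise_def)
  note ni = normalized_increment_distr[OF BM \<tau>]
  have g: "(\<lambda>(\<omega>', \<omega>). ((\<lambda>k. \<xi> k \<omega>'), (\<lambda>k. normalized_increment \<tau> W k \<omega>))) \<in> measurable (M' \<Otimes>\<^sub>M M) (?PA \<Otimes>\<^sub>M ?PB)"
    unfolding case_prod_beta
    by (intro measurable_Pair measurable_compose[OF measurable_fst \<xi>] measurable_compose[OF measurable_snd ni(1)])
  have law: "distr (M' \<Otimes>\<^sub>M M) (?PA \<Otimes>\<^sub>M ?PB) (\<lambda>(\<omega>', \<omega>). ((\<lambda>k. \<xi> k \<omega>'), (\<lambda>k. normalized_increment \<tau> W k \<omega>)))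
      = distr M' (?PA \<Otimes>\<^sub>M ?PB) (\<lambda>\<omega>. ((\<lambda>k. \<xi> k \<omega>), (\<lambda>k. z k \<omega>)))"
    unfolding A batch_noise_distr(2)[OF bn]
    using pair_measure_distr[OF \<xi> ni(1)] M.prob_space_distr[OF ni(1)]
    by (simp add: ni(2) A prob_space_imp_sigma_finite)
  show "(\<lambda>q. rb_chain b D \<tau> (\<lambda>k. \<xi> k (fst q)) (\<lambda>k. normalized_increment \<tau> W k (snd q)) x m) \<in> borel_measurable (M' \<Otimes>\<^sub>M M)"
    using measurable_compose[OF g f] by (simp add: case_prod_beta)
  have "distr M' borel (\<lambda>\<omega>. rb_chain b D \<tau> (\<lambda>k. \<xi> k \<omega>) (\<lambda>k. z k \<omega>) x m)
      = distr (distr M' (?PA \<Otimes>\<^sub>M ?PB) (\<lambda>\<omega>. ((\<lambda>k. \<xi> k \<omega>), (\<lambda>k. z k \<omega>)))) borel ?f"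
    using batch_noise_distr(1)[OF bn] f by (subst distr_distr) (auto simp: A comp_def)
  also have "\<dots> = distr (M' \<Otimes>\<^sub>M M) borel (\<lambda>q. rb_chain b D \<tau> (\<lambda>k. \<xi> k (fst q)) (\<lambda>k. normalized_increment \<tau> W k (snd q)) x m)"
    unfolding law[symmetric] using g f by (subst distr_distr) (auto simp: comp_def case_prod_beta)
  finally show "distr M' borel (\<lambda>\<omega>. rb_chain b D \<tau> (\<lambda>k. \<xi> k \<omega>) (\<lambda>k. z k \<omega>) x m)
     = distr (M' \<Otimes>\<^sub>M M) borel (\<lambda>q. rb_chain b D \<tau> (\<lambda>k. \<xi> k (fst q)) (\<lambda>k. normalized_increment \<tau> W k (snd q)) x m)" .
qed

section \<open>One step of the coupled processes\<close>

lemma (in prob_space) distr_pair_snd: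
  assumes "sigma_finite_measure N"
  shows "distr (M \<Otimes>\<^sub>M N) N snd = N"
proof (rule measure_eqI)
  interpret N: sigma_finite_measure N by fact
  fix A assume "A \<in> sets (distr (M \<Otimes>\<^sub>M N) N snd)"
  then have A: "A \<in> sets N" by simp
  have "emeasure (distr (M \<Otimes>\<^sub>M N) N snd) A = emeasure (M \<Otimes>\<^sub>M N) (snd -` A \<inter> space (M \<Otimes>\<^sub>M N))"
    using A by (simp add: emeasure_distr)
  also have "snd -` A \<inter> space (M \<Otimes>\<^sub>M N) = space M \<times> A"
    using sets.sets_into_space[OF A] by (auto simp: space_pair_measure)
  also have "emeasure (M \<Otimes>\<^sub>M N) (space M \<times> A) = emeasure N A"
    using A by (simp add: N.emeasure_pair_measure_Times emeasure_space_1)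
  finally show "emeasure (distr (M \<Otimes>\<^sub>M N) N snd) A = emeasure N A" .
qed simp

text \<open>A pathwise estimate. The point \<open>y t + h\<close>, with \<open>h\<close> the noise
  displacement, is inserted between \<open>y t\<close> and \<open>y u\<close>: the first passage is
  Taylor's formula in \<open>h\<close>, the second is a displacement of at most
  \<open>L * \<tau>\<close> and costs a Lipschitz constant. The linear term commutes with the
  integral, which produces \<open>Db (y t)\<close> of the integrated noise.\<close>

lemma drift_window_remainder:
  fixes b :: "'a::euclidean_space \<Rightarrow> 'a" and y w :: "real \<Rightarrow> 'a"
  assumes \<tau>: "0 < \<tau>" and L: "0 \<le> L"
    and y: "continuous_on {t..t + \<tau>} y" and w: "continuous_on {t..t + \<tau>} w"
    and eq: "\<And>u. u \<in> {t..t + \<tau>} \<Longrightarrow> y u = y t + integral {t..u} (\<lambda>r. b (y r)) + s *\<^sub>R (w u - w t)"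
    and b_bound: "\<And>x. norm (b x) \<le> L"
    and b_lip: "\<And>x x'. norm (b x' - b x) \<le> L * norm (x' - x)"
    and b_taylor: "\<And>x h. norm (b (x + h) - b x - Db x h) \<le> L * (norm h)\<^sup>2"
    and Db: "\<And>x. linear (Db x)"
  shows "norm (integral {t..t + \<tau>} (\<lambda>u. b (y u)) - \<tau> *\<^sub>R b (y t) - s *\<^sub>R Db (y t) (integral {t..t + \<tau>} (\<lambda>u. w u - w t)))
    \<le> L\<^sup>2 * \<tau>\<^sup>2 + s\<^sup>2 * L * integral {t..t + \<tau>} (\<lambda>u. (norm (w u - w t))\<^sup>2)"
proof -
  let ?S = "{t..t + \<tau>}"
  have "L-lipschitz_on UNIV b"
    using b_lip L by (intro lipschitz_onI) (auto simp: dist_norm)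
  then have bc: "continuous_on UNIV b" by (rule lipschitz_on_continuous_on)
  have byc: "continuous_on ?S (\<lambda>u. b (y u))"
    using continuous_on_compose2[OF bc y] by simp
  have Dc: "continuous_on ?S (\<lambda>u. Db (y t) (w u - w t))"
    by (rule linear_continuous_on_compose[OF _ Db]) (intro continuous_intros w)
  have intD: "integral ?S (\<lambda>u. Db (y t) (w u - w t)) = Db (y t) (integral ?S (\<lambda>u. w u - w t))"
  proof -
    have "(\<lambda>u. w u - w t) integrable_on ?S"
      using w by (intro integrable_continuous_interval continuous_intros)
    then show ?thesis
      using integral_linear[of "\<lambda>u. w u - w t" ?S "Db (y t)"] Db
      by (simp add: comp_def linear_conv_bounded_linear)
  qed
  have "integral ?S (\<lambda>u. b (y u)) - \<tau> *\<^sub>R b (y t) - s *\<^sub>R Db (y t) (integral ?S (\<lambda>u. w u - w t))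
      = integral ?S (\<lambda>u. b (y u) - b (y t) - s *\<^sub>R Db (y t) (w u - w t))"
    using byc Dc \<tau>
    by (simp add: integral_diff integrable_continuous_interval continuous_intros intD[symmetric])
  also have "norm \<dots> \<le> integral ?S (\<lambda>u. L\<^sup>2 * \<tau> + s\<^sup>2 * L * (norm (w u - w t))\<^sup>2)"
  proof (rule integral_norm_bound_integral)
    show "(\<lambda>u. b (y u) - b (y t) - s *\<^sub>R Db (y t) (w u - w t)) integrable_on ?S"
      using byc Dc by (intro integrable_continuous_interval continuous_intros)
    show "(\<lambda>u. L\<^sup>2 * \<tau> + s\<^sup>2 * L * (norm (w u - w t))\<^sup>2) integrable_on ?S"
      using w by (intro integrable_continuous_interval continuous_intros)
    fix u assume u: "u \<in> ?S"
    define h where "h = s *\<^sub>R (w u - w t)"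
    have "norm (integral {t..u} (\<lambda>r. b (y r))) \<le> L * (u - t)"
      using u byc b_bound by (intro integral_bound) (auto intro: continuous_on_subset)
    also have "\<dots> \<le> L * \<tau>" using u L by (intro mult_left_mono) auto
    finally have "norm (y u - (y t + h)) \<le> L * \<tau>" using eq[OF u] by (simp add: h_def)
    then have "norm (b (y u) - b (y t + h)) \<le> L * (L * \<tau>)"
      by (rule order_trans[OF b_lip mult_left_mono[OF _ L]])
    moreover have "norm (b (y t + h) - b (y t) - Db (y t) h) \<le> L * (s\<^sup>2 * (norm (w u - w t))\<^sup>2)"
      using b_taylor[of "y t" h] by (simp add: h_def power_mult_distrib)
    moreover have "b (y u) - b (y t) - s *\<^sub>R Db (y t) (w u - w t)
        = (b (y u) - b (y t + h)) + (b (y t + h) - b (y t) - Db (y t) h)"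
      by (simp add: h_def linear_scale[OF Db])
    ultimately have "norm (b (y u) - b (y t) - s *\<^sub>R Db (y t) (w u - w t))
        \<le> L * (L * \<tau>) + L * (s\<^sup>2 * (norm (w u - w t))\<^sup>2)"
      by (metis norm_triangle_mono)
    then show "norm (b (y u) - b (y t) - s *\<^sub>R Db (y t) (w u - w t)) \<le> L\<^sup>2 * \<tau> + s\<^sup>2 * L * (norm (w u - w t))\<^sup>2"
      by (simp add: power2_eq_square mult_ac)
  qed
  also have "\<dots> = L\<^sup>2 * \<tau>\<^sup>2 + s\<^sup>2 * L * integral ?S (\<lambda>u. (norm (w u - w t))\<^sup>2)"
    using w \<tau> by (subst integral_add)
      (auto intro!: integrable_continuous_interval continuous_intros simp: power2_eq_square)
  finally show ?thesis .
qed

text \<open>A discrete Gronwall inequality. The rate \<open>2 + 2 * L\<close> serves twice: its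
  exponential over one step dominates both the amplification
  \<open>(1 + \<tau>) * (1 + L * \<tau>)\<^sup>2\<close> and
  \<open>1 + (1 + \<tau>) * \<tau>\<close>. By the second bound the source terms accumulate to
  \<open>exp - 1\<close> without a division by \<open>L\<close>.\<close>

lemma exp_recursion_bound:
  fixes a :: "nat \<Rightarrow> real"
  assumes \<tau>: "0 < \<tau>" and L: "0 \<le> L" and C: "0 \<le> C" and q: "0 \<le> q" and a0: "a 0 \<le> 0"
    and step: "\<And>k. k < m \<Longrightarrow> a (Suc k) \<le> (1 + \<tau>) * ((1 + L * \<tau>)\<^sup>2 * a k + \<tau> * C * q)"
    and km: "k \<le> m"
  shows "a k \<le> C * (exp ((2 + 2 * L) * (real k * \<tau>)) - 1) * q"
  using km
proof (induction k)
  case (Suc k)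
  define E where "E = exp ((2 + 2 * L) * (real k * \<tau>))"
  have E1: "1 \<le> E" using \<tau> L by (simp add: E_def)
  have e1: "1 + \<tau> \<le> exp \<tau>" and e2: "1 + L * \<tau> \<le> exp (L * \<tau>)" by (rule exp_ge_add_one_self)+
  have "(1 + L * \<tau>)\<^sup>2 \<le> (exp (L * \<tau>))\<^sup>2" using e2 \<tau> L by (intro power_mono) auto
  then have "(1 + \<tau>) * (1 + L * \<tau>)\<^sup>2 \<le> exp \<tau> * (exp (L * \<tau>))\<^sup>2"
    using e1 \<tau> by (intro mult_mono) auto
  also have "\<dots> \<le> exp \<tau> * (exp \<tau> * (exp (L * \<tau>))\<^sup>2)" using \<tau> by simp
  also have "\<dots> = exp ((2 + 2 * L) * \<tau>)"
    by (simp add: power2_eq_square exp_add[symmetric] algebra_simps)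
  finally have f1: "(1 + \<tau>) * (1 + L * \<tau>)\<^sup>2 \<le> exp ((2 + 2 * L) * \<tau>)" .
  have "1 + (1 + \<tau>) * \<tau> \<le> (1 + \<tau>) * (1 + \<tau>)" using \<tau> by (simp add: algebra_simps)
  also have "\<dots> \<le> exp \<tau> * exp \<tau>" using e1 \<tau> by (intro mult_mono) auto
  also have "\<dots> \<le> exp ((2 + 2 * L) * \<tau>)" using L \<tau> by (simp add: exp_add[symmetric] algebra_simps)
  finally have f2: "(1 + \<tau>) * \<tau> \<le> exp ((2 + 2 * L) * \<tau>) - 1" by simp
  have IH: "a k \<le> C * (E - 1) * q" using Suc by (simp add: E_def)
  have "a (Suc k) \<le> (1 + \<tau>) * ((1 + L * \<tau>)\<^sup>2 * a k + \<tau> * C * q)" using step Suc.prems by simp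
  also have "\<dots> \<le> (1 + \<tau>) * ((1 + L * \<tau>)\<^sup>2 * (C * (E - 1) * q) + \<tau> * C * q)"
    using IH \<tau> by (intro mult_left_mono add_right_mono) auto
  also have "\<dots> = ((1 + \<tau>) * (1 + L * \<tau>)\<^sup>2) * (C * (E - 1) * q) + ((1 + \<tau>) * \<tau>) * (C * q)"
    by (simp add: algebra_simps)
  also have "\<dots> \<le> exp ((2 + 2 * L) * \<tau>) * (C * (E - 1) * q) + (exp ((2 + 2 * L) * \<tau>) - 1) * (C * q)"
    using f1 f2 C q E1 by (intro add_mono mult_right_mono) auto
  also have "\<dots> = C * (exp ((2 + 2 * L) * \<tau>) * E - 1) * q" by (simp add: algebra_simps)
  also have "exp ((2 + 2 * L) * \<tau>) * E = exp ((2 + 2 * L) * (real (Suc k) * \<tau>))"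
    by (simp add: E_def exp_add[symmetric] algebra_simps)
  finally show ?case .
qed (use a0 in simp)

text \<open>Conditioning on the past by hand: split according to the value \<open>S\<close> of
  \<open>\<xi> k\<close>, factor each term by independence of \<open>\<xi> k\<close> from the
  earlier batches, and use that each value has probability \<open>1 / card A\<close>.\<close>

lemma batch_noise_average:
  assumes bn: "batch_noise M' N i p \<xi> z" and A: "A = batches N i p" "finite A" "A \<noteq> {}"
    and g: "\<And>S. S \<in> A \<Longrightarrow> g S \<in> borel_measurable (Pi\<^sub>M {..<k} (\<lambda>_. count_space A))"
    and c: "\<And>S \<omega>. S \<in> A \<Longrightarrow> \<omega> \<in> space M' \<Longrightarrow> \<bar>g S (\<lambda>j\<in>{..<k}. \<xi> j \<omega>)\<bar> \<le> c"
  shows "(\<integral>\<omega>. g (\<xi> k \<omega>) (\<lambda>j\<in>{..<k}. \<xi> j \<omega>) \<partial>M')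
    = (\<integral>\<omega>. (\<Sum>S\<in>A. g S (\<lambda>j\<in>{..<k}. \<xi> j \<omega>)) / real (card A) \<partial>M')"
proof -
  interpret prob_space M' using bn by (simp add: batch_noise_def)
  have iv: "indep_vars (\<lambda>_. count_space A) \<xi> UNIV" using bn by (simp add: batch_noise_def A)
  then have \<xi> [measurable]: "\<xi> j \<in> measurable M' (count_space A)" for j by (simp add: indep_vars_def2)
  have r [measurable]: "(\<lambda>\<omega>. \<lambda>j\<in>{..<k}. \<xi> j \<omega>) \<in> measurable M' (Pi\<^sub>M {..<k} (\<lambda>_. count_space A))"
    by (rule measurable_restrict) (rule \<xi>)
  have gm: "(\<lambda>\<omega>. g S (\<lambda>j\<in>{..<k}. \<xi> j \<omega>)) \<in> borel_measurable M'" if "S \<in> A" for S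
    by (rule measurable_compose[OF r g[OF that]])
  have gi: "integrable M' (\<lambda>\<omega>. g S (\<lambda>j\<in>{..<k}. \<xi> j \<omega>))" if "S \<in> A" for S
    using gm[OF that] c[OF that] by (intro integrable_const_bound[of _ c]) (auto intro!: AE_I2)
  have one: "integrable M' (\<lambda>\<omega>. indicator {S} (\<xi> k \<omega>) * g S (\<lambda>j\<in>{..<k}. \<xi> j \<omega>)) \<and>
      (\<integral>\<omega>. indicator {S} (\<xi> k \<omega>) * g S (\<lambda>j\<in>{..<k}. \<xi> j \<omega>) \<partial>M') = (\<integral>\<omega>. g S (\<lambda>j\<in>{..<k}. \<xi> j \<omega>) \<partial>M') / real (card A)"
    if S: "S \<in> A" for S
  proof -
    have "indep_var (Pi\<^sub>M {k} (\<lambda>_. count_space A)) (\<lambda>\<omega>. \<lambda>j\<in>{k}. \<xi> j \<omega>) (Pi\<^sub>M {..<k} (\<lambda>_. count_space A)) (\<lambda>\<omega>. \<lambda>j\<in>{..<k}. \<xi> j \<omega>)"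
      by (rule indep_var_restrict[OF iv]) auto
    moreover have "(\<lambda>\<sigma>. indicator {S} (\<sigma> k) :: real) \<in> borel_measurable (Pi\<^sub>M {k} (\<lambda>_. count_space A))"
    proof (rule measurable_compose[where N = "count_space A"])
      show "(\<lambda>\<sigma>. \<sigma> k) \<in> Pi\<^sub>M {k} (\<lambda>_. count_space A) \<rightarrow>\<^sub>M count_space A" by measurable
    qed simp
    ultimately have "indep_var borel ((\<lambda>\<sigma>. indicator {S} (\<sigma> k) :: real) \<circ> (\<lambda>\<omega>. \<lambda>j\<in>{k}. \<xi> j \<omega>))
        borel (g S \<circ> (\<lambda>\<omega>. \<lambda>j\<in>{..<k}. \<xi> j \<omega>))"
      by (rule indep_var_compose[OF _ _ g[OF S]])
    then have ind: "indep_var borel (\<lambda>\<omega>. indicator {S} (\<xi> k \<omega>) :: real) borel (\<lambda>\<omega>. g S (\<lambda>j\<in>{..<k}. \<xi> j \<omega>))"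
      by (simp add: comp_def)
    have im: "(\<lambda>\<omega>. indicator {S} (\<xi> k \<omega>) :: real) \<in> borel_measurable M'"
      by (rule measurable_compose[OF \<xi>]) simp
    then have ii: "integrable M' (\<lambda>\<omega>. indicator {S} (\<xi> k \<omega>) :: real)"
      by (intro integrable_const_bound[of _ 1]) (auto split: split_indicator)
    have "(\<integral>\<omega>. (indicator {S} (\<xi> k \<omega>) :: real) \<partial>M') = (\<integral>S'. indicator {S} S' \<partial>distr M' (count_space A) (\<xi> k))"
      by (rule integral_distr[symmetric, OF \<xi>]) simp
    also have "\<dots> = (\<integral>S'. indicator {S} S' \<partial>uniform_count_measure A)"
      using bn by (simp add: batch_noise_def A)
    also have "\<dots> = 1 / real (card A)"
      using A S by (subst integral_uniform_count_measure) (auto simp: indicator_def)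
    finally show ?thesis
      using indep_var_lebesgue_integral[OF ind ii gi[OF S]] indep_var_integrable[OF ind ii gi[OF S]] by simp
  qed
  have "(\<integral>\<omega>. g (\<xi> k \<omega>) (\<lambda>j\<in>{..<k}. \<xi> j \<omega>) \<partial>M')
      = (\<integral>\<omega>. (\<Sum>S\<in>A. indicator {S} (\<xi> k \<omega>) * g S (\<lambda>j\<in>{..<k}. \<xi> j \<omega>)) \<partial>M')"
  proof (rule Bochner_Integration.integral_cong[OF refl])
    fix \<omega> assume "\<omega> \<in> space M'"
    then have "\<xi> k \<omega> \<in> A" using measurable_space[OF \<xi>] by simp
    then show "g (\<xi> k \<omega>) (\<lambda>j\<in>{..<k}. \<xi> j \<omega>) = (\<Sum>S\<in>A. indicator {S} (\<xi> k \<omega>) * g S (\<lambda>j\<in>{..<k}. \<xi> j \<omega>))"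
      using A(2) by (simp add: indicator_def if_distrib[of "\<lambda>x. x * _"] cong: if_cong)
  qed
  also have "\<dots> = (\<Sum>S\<in>A. (\<integral>\<omega>. g S (\<lambda>j\<in>{..<k}. \<xi> j \<omega>) \<partial>M') / real (card A))"
    using one by (subst Bochner_Integration.integral_sum) auto
  also have "\<dots> = (\<integral>\<omega>. (\<Sum>S\<in>A. g S (\<lambda>j\<in>{..<k}. \<xi> j \<omega>)) / real (card A) \<partial>M')"
    using gi by (simp add: sum_divide_distrib[symmetric])
  finally show ?thesis .
qed

section \<open>The chain as a function of the batches alone and of the noise alone\<close>

lemma rb_chain_cong:
  assumes "\<And>j. j < m \<Longrightarrow> \<sigma> j = \<sigma>' j"
  shows "rb_chain b D \<tau> \<sigma> z x m = rb_chain b D \<tau> \<sigma>' z x m"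
  using assms by (induction m) auto

text \<open>\<open>J\<close> may be exactly \<open>{..<m}\<close>; the chain after \<open>m\<close>
  steps is then a function of the past batches, which are independent of the next one.\<close>

lemma measurable_rb_chain_batches:
  assumes "finite A" and b: "\<And>S. S \<in> A \<Longrightarrow> b S \<in> borel_measurable borel" and "{..<m} \<subseteq> J"
  shows "(\<lambda>\<sigma>. rb_chain b D \<tau> \<sigma> z x m) \<in> borel_measurable (Pi\<^sub>M J (\<lambda>_. count_space A))" (is "_ \<in> borel_measurable ?P")
  using assms(3)
proof (induction m)
  case (Suc m)
  then have IH [measurable]: "(\<lambda>\<sigma>. rb_chain b D \<tau> \<sigma> z x m) \<in> borel_measurable ?P" by (auto simp: lessThan_Suc)
  have "(\<lambda>\<sigma>. (\<lambda>S \<sigma>. b S (rb_chain b D \<tau> \<sigma> z x m)) (\<sigma> m) \<sigma>) \<in> borel_measurable ?P"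
  proof (rule measurable_compose_countable'[where f = "\<lambda>S \<sigma>. b S (rb_chain b D \<tau> \<sigma> z x m)" and g = "\<lambda>\<sigma>. \<sigma> m"])
    show "(\<lambda>\<sigma>. b S (rb_chain b D \<tau> \<sigma> z x m)) \<in> borel_measurable ?P" if "S \<in> A" for S
      by (rule measurable_compose[OF IH b[OF that]])
    show "(\<lambda>\<sigma>. \<sigma> m) \<in> measurable ?P (count_space A)"
      using Suc.prems by (intro measurable_component_singleton) auto
  qed (use assms in \<open>auto intro: countable_finite\<close>)
  then have [measurable]: "(\<lambda>\<sigma>. b (\<sigma> m) (rb_chain b D \<tau> \<sigma> z x m)) \<in> borel_measurable ?P" by simp
  show ?case by simp
qed simp

text \<open>With \<open>M\<close> taken as a member of the filtration, this is the adaptedness of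
  the coupled chain for frozen batches.\<close>

lemma measurable_rb_chain_noise:
  assumes "\<And>j. j < m \<Longrightarrow> b (\<sigma> j) \<in> borel_measurable borel" "\<And>j. j < m \<Longrightarrow> z j \<in> borel_measurable M"
  shows "(\<lambda>\<omega>. rb_chain b D \<tau> \<sigma> (\<lambda>j. z j \<omega>) x m) \<in> borel_measurable M"
  using assms
proof (induction m)
  case (Suc m)
  then have IH [measurable]: "(\<lambda>\<omega>. rb_chain b D \<tau> \<sigma> (\<lambda>j. z j \<omega>) x m) \<in> borel_measurable M" by simp
  have [measurable]: "(\<lambda>\<omega>. b (\<sigma> m) (rb_chain b D \<tau> \<sigma> (\<lambda>j. z j \<omega>) x m)) \<in> borel_measurable M"
    using Suc.prems by (intro measurable_compose[OF IH]) simp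
  have [measurable]: "z m \<in> borel_measurable M" using Suc.prems by simp
  show ?case by simp
qed simp

section \<open>The synchronous coupling\<close>

text \<open>Among the products with \<open>a\<close>, only the one with \<open>r\<close> is
  estimated by Young's inequality, with weight \<tau>: the factor \<open>1 + \<tau>\<close>
  compounds to an exponential of the elapsed time, and \<open>r\<close> is small enough to bear
  \<open>1 / \<tau>\<close>. The products with \<open>g\<close> and \<open>c\<close> stay because
  their expectations vanish.\<close>

lemma norm_power2_sum4_le:
  fixes a r g c :: "'a::real_inner"
  assumes \<tau>: "0 < \<tau>"
  shows "(norm (a + r + g + c))\<^sup>2 \<le> (1 + \<tau>) * (norm a)\<^sup>2 + (1 / \<tau> + 3) * (norm r)\<^sup>2
    + 3 * (norm g)\<^sup>2 + 3 * (norm c)\<^sup>2 + 2 * (a \<bullet> g) + 2 * (a \<bullet> c)"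
proof -
  have "0 \<le> (norm (\<tau> *\<^sub>R a - r))\<^sup>2" by simp
  also have "\<dots> = \<tau>\<^sup>2 * (norm a)\<^sup>2 - 2 * \<tau> * (a \<bullet> r) + (norm r)\<^sup>2"
    unfolding power2_norm_eq_inner by (simp add: inner_diff_left inner_diff_right inner_commute power2_eq_square)
  finally have "2 * \<tau> * (a \<bullet> r) \<le> \<tau>\<^sup>2 * (norm a)\<^sup>2 + (norm r)\<^sup>2" by simp
  then have "(2 * \<tau> * (a \<bullet> r)) / \<tau> \<le> (\<tau>\<^sup>2 * (norm a)\<^sup>2 + (norm r)\<^sup>2) / \<tau>"
    using \<tau> by (intro divide_right_mono) auto
  then have 1: "2 * (a \<bullet> r) \<le> \<tau> * (norm a)\<^sup>2 + (1 / \<tau>) * (norm r)\<^sup>2"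
    using \<tau> by (simp add: add_divide_distrib power2_eq_square[of \<tau>])
  have "0 \<le> (norm (r - g))\<^sup>2 + (norm (g - c))\<^sup>2 + (norm (r - c))\<^sup>2" by simp
  then have 2: "(norm (r + g + c))\<^sup>2 \<le> 3 * (norm r)\<^sup>2 + 3 * (norm g)\<^sup>2 + 3 * (norm c)\<^sup>2"
    unfolding power2_norm_eq_inner
    by (simp add: inner_diff_left inner_diff_right inner_add_left inner_add_right inner_commute)
  have "(norm (a + r + g + c))\<^sup>2 = (norm a)\<^sup>2 + 2 * (a \<bullet> r) + 2 * (a \<bullet> g) + 2 * (a \<bullet> c) + (norm (r + g + c))\<^sup>2"
    unfolding power2_norm_eq_inner by (simp add: inner_add_left inner_add_right inner_commute)
  then show ?thesis using 1 2 by (simp add: algebra_simps)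
qed

text \<open>The Gaussian vectors \<open>z\<close> enter only through the law of the chain: the coupled chain \<open>Z\<close> on
  \<open>M' \<Otimes>\<^sub>M M\<close> is driven by the increments of \<open>W\<close> instead.\<close>

locale random_batch_coupling =
  fixes M :: "'w measure" and F :: "real \<Rightarrow> 'w measure" and W :: "real \<Rightarrow> 'w \<Rightarrow> real ^ 'd::finite"
    and x :: "real ^ 'd" and Y :: "real \<Rightarrow> 'w \<Rightarrow> real ^ 'd"
    and M' :: "'v measure" and N i p :: nat and \<xi> :: "nat \<Rightarrow> 'v \<Rightarrow> nat set" and z :: "nat \<Rightarrow> 'v \<Rightarrow> real ^ 'd"
    and b :: "real ^ 'd \<Rightarrow> real ^ 'd" and Db :: "real ^ 'd \<Rightarrow> real ^ 'd \<Rightarrow> real ^ 'd"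
    and bS :: "nat set \<Rightarrow> real ^ 'd \<Rightarrow> real ^ 'd" and A :: "nat set set"
    and D \<tau> L v :: real and m :: nat
  assumes BM: "brownian_motion M F W"
    and sde: "sde_solution M F W b (sqrt (2 * D)) x (real m * \<tau>) Y"
    and bn: "batch_noise M' N i p \<xi> z"
    and A: "A = batches N i p" "finite A" "A \<noteq> {}"
    and \<tau>: "0 < \<tau>" and D: "0 \<le> D" and L: "0 \<le> L"
    and b_bound: "\<And>y. norm (b y) \<le> L"
    and b_lip: "\<And>y y'. norm (b y' - b y) \<le> L * norm (y' - y)"
    and b_taylor: "\<And>y h. norm (b (y + h) - b y - Db y h) \<le> L * (norm h)\<^sup>2"
    and Db_linear: "\<And>y. linear (Db y)"
    and Db_bound: "\<And>y h. norm (Db y h) \<le> L * norm h"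
    and Db_cont: "\<And>h. continuous_on UNIV (\<lambda>y. Db y h)"
    and bS_cont: "\<And>S. S \<in> A \<Longrightarrow> continuous_on UNIV (bS S)"
    and bS_bound: "\<And>S y. S \<in> A \<Longrightarrow> norm (bS S y) \<le> L"
    and bS_mean: "\<And>y. (\<Sum>S\<in>A. bS S y) = real (card A) *\<^sub>R b y"
    and bS_var: "\<And>y. (\<Sum>S\<in>A. (norm (bS S y - b y))\<^sup>2) \<le> real (card A) * v"
begin

sublocale M: prob_space M using BM by (simp add: brownian_motion_def)
sublocale M': prob_space M' using bn by (simp add: batch_noise_def)
sublocale P: pair_prob_space M' M ..

abbreviation s where "s \<equiv> sqrt (2 * D)"
abbreviation t where "t k \<equiv> real k * \<tau>"
abbreviation noise where "noise \<omega> \<equiv> \<lambda>j. normalized_increment \<tau> W j \<omega>"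

definition Z where "Z k q = rb_chain bS D \<tau> (\<lambda>j. \<xi> j (fst q)) (noise (snd q)) x k"
definition err where "err k q = Y (t k) (snd q) - Z k q"

text \<open>Gathers the almost sure properties of a path in one predicate, so that the estimates
  along it become deterministic and hold at all times simultaneously.\<close>

definition regular_path where "regular_path \<omega> \<longleftrightarrow>
  continuous_on {0..} (\<lambda>u. W u \<omega>) \<and> continuous_on {0..t m} (\<lambda>u. Y u \<omega>) \<and> W 0 \<omega> = 0 \<and>
  (\<forall>u\<in>{0..t m}. Y u \<omega> = x + integral {0..u} (\<lambda>r. b (Y r \<omega>)) + s *\<^sub>R W u \<omega>)"

lemma AE_regular_path: "AE \<omega> in M. regular_path \<omega>"
proof -
  have "AE \<omega> in M. W 0 \<omega> = 0 \<and> continuous_on {0..} (\<lambda>u. W u \<omega>)" using BM by (simp add: brownian_motion_def)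
  moreover have "AE \<omega> in M. continuous_on {0..t m} (\<lambda>u. Y u \<omega>) \<and>
      (\<forall>u\<in>{0..t m}. Y u \<omega> = x + integral {0..u} (\<lambda>r. b (Y r \<omega>)) + s *\<^sub>R W u \<omega>)"
    using sde unfolding sde_solution_def by blast
  ultimately show ?thesis by eventually_elim (simp add: regular_path_def)
qed

lemma AE_snd:
  assumes "AE \<omega> in M. R \<omega>"
  shows "AE q in M' \<Otimes>\<^sub>M M. R (snd q)"
proof -
  have "AE \<omega> in distr (M' \<Otimes>\<^sub>M M) M snd. R \<omega>"
    unfolding M'.distr_pair_snd[OF M.sigma_finite_measure_axioms] by (rule assms)
  then show ?thesis by (rule AE_distrD[OF measurable_snd])
qed

text \<open>Batches inside, Brownian path outside: the order in which the current batch is averaged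
  out.\<close>

lemma integral_pair_swap:
  fixes f :: "'v \<times> 'w \<Rightarrow> real"
  assumes "integrable (M' \<Otimes>\<^sub>M M) f"
  shows "(\<integral>q. f q \<partial>(M' \<Otimes>\<^sub>M M)) = (\<integral>\<omega>. (\<integral>\<omega>'. f (\<omega>', \<omega>) \<partial>M') \<partial>M)"
    and "integrable M (\<lambda>\<omega>. \<integral>\<omega>'. f (\<omega>', \<omega>) \<partial>M')"
  using P.integral_snd[of "\<lambda>\<omega>' \<omega>. f (\<omega>', \<omega>)"] P.integrable_snd[of "\<lambda>\<omega>' \<omega>. f (\<omega>', \<omega>)"] assms
  by simp_all

lemma integrable_snd_lift:
  fixes f :: "'w \<Rightarrow> real"
  assumes "integrable M f"
  shows "integrable (M' \<Otimes>\<^sub>M M) (\<lambda>q. f (snd q))" "(\<integral>q. f (snd q) \<partial>(M' \<Otimes>\<^sub>M M)) = (\<integral>\<omega>. f \<omega> \<partial>M)"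
proof -
  have d: "distr (M' \<Otimes>\<^sub>M M) M snd = M" by (rule M'.distr_pair_snd[OF M.sigma_finite_measure_axioms])
  have f: "f \<in> borel_measurable M" using assms by auto
  show "integrable (M' \<Otimes>\<^sub>M M) (\<lambda>q. f (snd q))"
    using integrable_distr_eq[OF measurable_snd f, of M'] assms d by simp
  show "(\<integral>q. f (snd q) \<partial>(M' \<Otimes>\<^sub>M M)) = (\<integral>\<omega>. f \<omega> \<partial>M)"
    using integral_distr[OF measurable_snd f, of M'] d by simp
qed

lemma t_nonneg: "0 \<le> t k" and t_Suc: "t (Suc k) = t k + \<tau>" and t_mono: "j \<le> k \<Longrightarrow> t j \<le> t k"
  using \<tau> by (auto simp: algebra_simps)

section \<open>Measurability of the coefficients and of the coupled processes\<close>

lemma b_cont: "continuous_on UNIV b"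
proof -
  have "L-lipschitz_on UNIV b"
    using b_lip L by (intro lipschitz_onI) (auto simp: dist_norm)
  then show ?thesis by (rule lipschitz_on_continuous_on)
qed

lemma b_measurable [measurable]: "b \<in> borel_measurable borel"
  using b_cont by (rule borel_measurable_continuous_onI)

lemma bS_measurable: "S \<in> A \<Longrightarrow> bS S \<in> borel_measurable borel"
  using bS_cont by (intro borel_measurable_continuous_onI)

lemma Db_measurable [measurable]: "(\<lambda>y. Db y h) \<in> borel_measurable borel"
  using Db_cont by (intro borel_measurable_continuous_onI)

text \<open>In \<open>G\<close> a random linear map acts on a random vector. The expansion separates
  the two: it yields measurability and reduces orthogonality to scalar coefficients times the
  coordinates of \<open>H\<close>.\<close>

lemma Db_expand: "Db y h = (\<Sum>j\<in>UNIV. h $ j *\<^sub>R Db y (axis j 1))"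
proof -
  have "h = (\<Sum>j\<in>UNIV. h $ j *\<^sub>R axis j 1)"
    by (simp add: basis_expansion scalar_mult_eq_scaleR [symmetric])
  then have "Db y h = (\<Sum>j\<in>UNIV. Db y (h $ j *\<^sub>R axis j 1))"
    by (metis (no_types, lifting) Db_linear linear_sum sum.cong)
  then show ?thesis by (simp add: linear_scale[OF Db_linear])
qed

lemma \<xi>_measurable: "\<xi> j \<in> measurable M' (count_space A)"
  using bn by (simp add: batch_noise_def A M'.indep_vars_def2)

lemma \<xi>_in: "\<omega>' \<in> space M' \<Longrightarrow> \<xi> j \<omega>' \<in> A"
  using measurable_space[OF \<xi>_measurable] by simp

lemma Z_measurable [measurable]: "Z k \<in> borel_measurable (M' \<Otimes>\<^sub>M M)"
  unfolding Z_def[abs_def] by (rule rb_chain_coupling_distr(1)[OF BM \<tau> bn bS_measurable A(1,2)])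

lemma Y_adapted: "k \<le> m \<Longrightarrow> Y (t k) \<in> borel_measurable (F (t k))"
  using sde t_nonneg t_mono unfolding sde_solution_def by simp

lemma F_subalgebra: "subalgebra M (F u)"
  using BM by (simp add: brownian_motion_def)

lemma Y_measurable: "k \<le> m \<Longrightarrow> Y (t k) \<in> borel_measurable M"
  by (rule measurable_from_subalg[OF F_subalgebra Y_adapted])

lemma Y_measurable_pair: "k \<le> m \<Longrightarrow> (\<lambda>q. Y (t k) (snd q)) \<in> borel_measurable (M' \<Otimes>\<^sub>M M)"
  by (rule measurable_compose[OF measurable_snd Y_measurable])

lemma err_measurable: "k \<le> m \<Longrightarrow> err k \<in> borel_measurable (M' \<Otimes>\<^sub>M M)"
  unfolding err_def[abs_def] using Y_measurable_pair by measurable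

lemma batch_drift_measurable: "(\<lambda>q. bS (\<xi> k (fst q)) (Z k q)) \<in> borel_measurable (M' \<Otimes>\<^sub>M M)"
proof -
  have "(\<lambda>q. (\<lambda>S q. bS S (Z k q)) ((\<lambda>q. \<xi> k (fst q)) q) q) \<in> borel_measurable (M' \<Otimes>\<^sub>M M)"
  proof (rule measurable_compose_countable'[where f = "\<lambda>S q. bS S (Z k q)" and g = "\<lambda>q. \<xi> k (fst q)"])
    show "(\<lambda>q. bS S (Z k q)) \<in> borel_measurable (M' \<Otimes>\<^sub>M M)" if "S \<in> A" for S
      by (rule measurable_compose[OF Z_measurable bS_measurable[OF that]])
    show "(\<lambda>q. \<xi> k (fst q)) \<in> measurable (M' \<Otimes>\<^sub>M M) (count_space A)"
      by (rule measurable_compose[OF measurable_fst \<xi>_measurable])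
  qed (use A in \<open>auto intro: countable_finite\<close>)
  then show ?thesis by simp
qed

text \<open>The normalization of the increments cancels \<open>sqrt \<tau>\<close>, so the chain
  receives literally the noise term of the equation for \<open>Y\<close>.\<close>

lemma Z_Suc: "Z (Suc k) q = Z k q + \<tau> *\<^sub>R bS (\<xi> k (fst q)) (Z k q) + s *\<^sub>R (W (t (Suc k)) (snd q) - W (t k) (snd q))"
proof -
  have "sqrt (2 * D * \<tau>) / sqrt \<tau> = s" using \<tau> by (simp add: real_sqrt_mult)
  then show ?thesis by (simp add: Z_def normalized_increment_def)
qed

lemma Y_increment:
  assumes \<omega>: "regular_path \<omega>" and k: "k < m" and u: "u \<in> {t k..t k + \<tau>}"
  shows "Y u \<omega> = Y (t k) \<omega> + integral {t k..u} (\<lambda>r. b (Y r \<omega>)) + s *\<^sub>R (W u \<omega> - W (t k) \<omega>)"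
proof -
  have sub: "{t k..t k + \<tau>} \<subseteq> {0..t m}"
    using t_mono[of "Suc k" m] k t_Suc[of k] t_nonneg[of k] by (intro subsetI) (simp only: atLeastAtMost_iff, linarith)
  have tk: "t k \<in> {t k..t k + \<tau>}" using \<tau> by simp
  have "continuous_on {0..u} (\<lambda>r. b (Y r \<omega>))"
  proof (rule continuous_on_compose2[OF b_cont])
    show "continuous_on {0..u} (\<lambda>r. Y r \<omega>)"
      using \<omega> u sub unfolding regular_path_def by (elim conjE continuous_on_subset) auto
  qed simp
  then have "integral {0..t k} (\<lambda>r. b (Y r \<omega>)) + integral {t k..u} (\<lambda>r. b (Y r \<omega>)) = integral {0..u} (\<lambda>r. b (Y r \<omega>))"
    using u t_nonneg[of k] by (intro Henstock_Kurzweil_Integration.integral_combine integrable_continuous_interval) auto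
  moreover have "Y u \<omega> = x + integral {0..u} (\<lambda>r. b (Y r \<omega>)) + s *\<^sub>R W u \<omega>"
    "Y (t k) \<omega> = x + integral {0..t k} (\<lambda>r. b (Y r \<omega>)) + s *\<^sub>R W (t k) \<omega>"
    using \<omega> subsetD[OF sub u] subsetD[OF sub tk] unfolding regular_path_def by blast+
  ultimately show ?thesis by (simp add: algebra_simps)
qed

lemma Y_0: "regular_path \<omega> \<Longrightarrow> Y 0 \<omega> = x"
  using t_nonneg[of m] by (auto simp: regular_path_def)

text \<open>The noise cancels in the coupling, so the error is bounded and integrability is never an issue.\<close>

lemma err_bound:
  assumes \<omega>: "regular_path \<omega>" and \<omega>': "\<omega>' \<in> space M'" and "k \<le> m"
  shows "norm (err k (\<omega>', \<omega>)) \<le> 2 * L * t k"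
  using \<open>k \<le> m\<close>
proof (induction k)
  case 0
  then show ?case using Y_0[OF \<omega>] by (simp add: err_def Z_def)
next
  case (Suc k)
  have sub: "{t k..t k + \<tau>} \<subseteq> {0..t m}"
    using t_mono[OF Suc.prems] t_Suc[of k] t_nonneg[of k] by (intro subsetI) (simp only: atLeastAtMost_iff, linarith)
  have "continuous_on {t k..t k + \<tau>} (\<lambda>r. b (Y r \<omega>))"
  proof (rule continuous_on_compose2[OF b_cont])
    show "continuous_on {t k..t k + \<tau>} (\<lambda>r. Y r \<omega>)"
      using \<omega> sub unfolding regular_path_def by (blast intro: continuous_on_subset)
  qed simp
  then have I: "norm (integral {t k..t k + \<tau>} (\<lambda>r. b (Y r \<omega>))) \<le> L * (t k + \<tau> - t k)"
    using \<tau> b_bound by (intro integral_bound) auto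
  have J: "norm (\<tau> *\<^sub>R bS (\<xi> k \<omega>') (Z k (\<omega>', \<omega>))) \<le> \<tau> * L"
    using bS_bound[OF \<xi>_in[OF \<omega>']] \<tau> by simp
  have eq: "err (Suc k) (\<omega>', \<omega>) = err k (\<omega>', \<omega>)
      + (integral {t k..t k + \<tau>} (\<lambda>r. b (Y r \<omega>)) - \<tau> *\<^sub>R bS (\<xi> k \<omega>') (Z k (\<omega>', \<omega>)))"
    using Y_increment[OF \<omega>, of k "t k + \<tau>"] Suc \<tau>
    unfolding err_def Z_Suc t_Suc by (simp add: algebra_simps)
  have e: "norm (err k (\<omega>', \<omega>)) \<le> 2 * L * t k" using Suc by simp
  have "norm (err (Suc k) (\<omega>', \<omega>)) \<le> 2 * L * t k + (L * (t k + \<tau> - t k) + \<tau> * L)"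
    unfolding eq by (intro norm_triangle_mono e norm_triangle_le_diff add_mono I J)
  then show ?case unfolding t_Suc by (simp add: algebra_simps)
qed

lemma AE_pair_regular: "AE q in M' \<Otimes>\<^sub>M M. regular_path (snd q) \<and> fst q \<in> space M'"
  using AE_snd[OF AE_regular_path] AE_space by eventually_elim (auto simp: space_pair_measure)

lemma AE_err_bound: "k \<le> m \<Longrightarrow> AE q in M' \<Otimes>\<^sub>M M. norm (err k q) \<le> 2 * L * t k"
  using AE_pair_regular by eventually_elim (metis err_bound prod.collapse)

lemma integrable_pair_bounded:
  fixes f :: "'v \<times> 'w \<Rightarrow> real"
  assumes "f \<in> borel_measurable (M' \<Otimes>\<^sub>M M)" "AE q in M' \<Otimes>\<^sub>M M. \<bar>f q\<bar> \<le> c"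
  shows "integrable (M' \<Otimes>\<^sub>M M) f"
  using assms by (intro P.integrable_const_bound[of _ c]) auto

text \<open>\<open>drift_step\<close> and \<open>batch_step\<close> are \<open>A\<close> and
  \<open>\<tau> \<chi>\<close> of the overview. The value \<open>b (Z k q)\<close> is added and
  subtracted, so that the current batch enters through \<open>batch_step\<close> only.\<close>

definition drift_step where "drift_step k q = err k q + \<tau> *\<^sub>R (b (Y (t k) (snd q)) - b (Z k q))"
definition batch_step where "batch_step k q = \<tau> *\<^sub>R (b (Z k q) - bS (\<xi> k (fst q)) (Z k q))"

lemma drift_step_norm: "norm (drift_step k q) \<le> (1 + L * \<tau>) * norm (err k q)"
proof -
  have "norm (drift_step k q) \<le> norm (err k q) + \<tau> * norm (b (Y (t k) (snd q)) - b (Z k q))"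
    unfolding drift_step_def using \<tau> by (metis abs_of_pos norm_scaleR norm_triangle_ineq)
  also have "\<dots> \<le> norm (err k q) + \<tau> * (L * norm (err k q))"
    unfolding err_def using \<tau> b_lip by (intro add_left_mono mult_left_mono) auto
  finally show ?thesis by (simp add: algebra_simps)
qed

lemma drift_step_bound:
  assumes "regular_path \<omega>" "\<omega>' \<in> space M'" "k \<le> m"
  shows "norm (drift_step k (\<omega>', \<omega>)) \<le> (1 + L * \<tau>) * (2 * L * t k)"
  using drift_step_norm[of k "(\<omega>', \<omega>)"] mult_left_mono[OF err_bound[OF assms], of "1 + L * \<tau>"] L \<tau>
  by (meson add_nonneg_nonneg less_imp_le mult_nonneg_nonneg order_trans zero_le_one)

lemma batch_step_bound: "\<omega>' \<in> space M' \<Longrightarrow> norm (batch_step k (\<omega>', \<omega>)) \<le> \<tau> * (2 * L)"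
  using bS_bound[OF \<xi>_in[of \<omega>' k], of "Z k (\<omega>', \<omega>)"] b_bound[of "Z k (\<omega>', \<omega>)"] \<tau>
    norm_triangle_ineq4[of "b (Z k (\<omega>', \<omega>))" "bS (\<xi> k \<omega>') (Z k (\<omega>', \<omega>))"]
  by (simp add: batch_step_def)

lemma drift_step_measurable: "k \<le> m \<Longrightarrow> drift_step k \<in> borel_measurable (M' \<Otimes>\<^sub>M M)"
  unfolding drift_step_def[abs_def] using Y_measurable_pair[of k] err_measurable[of k] by measurable

lemma batch_step_measurable: "batch_step k \<in> borel_measurable (M' \<Otimes>\<^sub>M M)"
  unfolding batch_step_def[abs_def] using batch_drift_measurable[of k] by measurable

text \<open>With the batches frozen, the chain at step \<open>k\<close> involves only increments up
  to time \<open>t k\<close>. The orthogonality of \<open>H\<close> to \<open>F (t k)\<close> asks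
  for exactly this.\<close>

lemma drift_step_adapted:
  assumes "\<omega>' \<in> space M'" "k \<le> m"
  shows "(\<lambda>\<omega>. drift_step k (\<omega>', \<omega>)) \<in> borel_measurable (F (t k))"
proof -
  have [measurable]: "(\<lambda>\<omega>. Z k (\<omega>', \<omega>)) \<in> borel_measurable (F (t k))"
    unfolding Z_def fst_conv snd_conv
    by (rule measurable_rb_chain_noise)
      (auto intro: bS_measurable \<xi>_in assms normalized_increment_adapted[OF BM \<tau>])
  note [measurable] = Y_adapted[OF assms(2)]
  show ?thesis unfolding drift_step_def err_def by simp
qed

text \<open>For a fixed Brownian path the chain at step \<open>k\<close> depends only on the batches before \<open>k\<close>, so the
  batch at step \<open>k\<close> can be averaged out.\<close>

lemma batch_average:
  assumes \<omega>: "regular_path \<omega>" and k: "k \<le> m"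
  shows "(\<integral>\<omega>'. drift_step k (\<omega>', \<omega>) \<bullet> batch_step k (\<omega>', \<omega>) \<partial>M') = 0"
    and "(\<integral>\<omega>'. (norm (batch_step k (\<omega>', \<omega>)))\<^sup>2 \<partial>M') \<le> \<tau>\<^sup>2 * v"
proof -
  define C where "C \<sigma> = rb_chain bS D \<tau> \<sigma> (noise \<omega>) x k" for \<sigma>
  have [measurable]: "C \<in> borel_measurable (Pi\<^sub>M {..<k} (\<lambda>_. count_space A))"
    unfolding C_def[abs_def] by (rule measurable_rb_chain_batches[OF A(2) bS_measurable]) auto
  have bSC [measurable]: "(\<lambda>\<sigma>. bS S (C \<sigma>)) \<in> borel_measurable (Pi\<^sub>M {..<k} (\<lambda>_. count_space A))" if "S \<in> A" for S
    using bS_measurable[OF that] by measurable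
  have ZC: "Z k (\<omega>', \<omega>) = C (\<lambda>j\<in>{..<k}. \<xi> j \<omega>')" for \<omega>'
    unfolding Z_def C_def fst_conv snd_conv by (rule rb_chain_cong) simp
  define a where "a \<sigma> = Y (t k) \<omega> - C \<sigma> + \<tau> *\<^sub>R (b (Y (t k) \<omega>) - b (C \<sigma>))" for \<sigma>
  have [measurable]: "a \<in> borel_measurable (Pi\<^sub>M {..<k} (\<lambda>_. count_space A))"
    unfolding a_def[abs_def] by measurable
  have aC: "drift_step k (\<omega>', \<omega>) = a (\<lambda>j\<in>{..<k}. \<xi> j \<omega>')" for \<omega>'
    by (simp add: drift_step_def err_def a_def ZC)
  have xC: "batch_step k (\<omega>', \<omega>) = \<tau> *\<^sub>R (b (C (\<lambda>j\<in>{..<k}. \<xi> j \<omega>')) - bS (\<xi> k \<omega>') (C (\<lambda>j\<in>{..<k}. \<xi> j \<omega>')))" for \<omega>'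
    by (simp add: batch_step_def ZC)
  have xb: "norm (\<tau> *\<^sub>R (b y - bS S y)) \<le> \<tau> * (2 * L)" if "S \<in> A" for S y
    using bS_bound[OF that, of y] b_bound[of y] \<tau> norm_triangle_ineq4[of "b y" "bS S y"] by simp
  have "(\<integral>\<omega>'. drift_step k (\<omega>', \<omega>) \<bullet> batch_step k (\<omega>', \<omega>) \<partial>M')
      = (\<integral>\<omega>'. (\<lambda>S \<sigma>. a \<sigma> \<bullet> (\<tau> *\<^sub>R (b (C \<sigma>) - bS S (C \<sigma>)))) (\<xi> k \<omega>') (\<lambda>j\<in>{..<k}. \<xi> j \<omega>') \<partial>M')"
    by (simp add: aC xC)
  also have "\<dots> = (\<integral>\<omega>'. (\<Sum>S\<in>A. (\<lambda>S \<sigma>. a \<sigma> \<bullet> (\<tau> *\<^sub>R (b (C \<sigma>) - bS S (C \<sigma>)))) S (\<lambda>j\<in>{..<k}. \<xi> j \<omega>')) / real (card A) \<partial>M')"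
  proof (rule batch_noise_average[OF bn A])
    show "(\<lambda>\<sigma>. a \<sigma> \<bullet> (\<tau> *\<^sub>R (b (C \<sigma>) - bS S (C \<sigma>)))) \<in> borel_measurable (Pi\<^sub>M {..<k} (\<lambda>_. count_space A))" if "S \<in> A" for S
      using bSC[OF that] by measurable
    fix S \<omega>' assume S: "S \<in> A" and w': "\<omega>' \<in> space M'"
    let ?\<sigma> = "\<lambda>j\<in>{..<k}. \<xi> j \<omega>'"
    have "\<bar>a ?\<sigma> \<bullet> (\<tau> *\<^sub>R (b (C ?\<sigma>) - bS S (C ?\<sigma>)))\<bar> \<le> norm (a ?\<sigma>) * norm (\<tau> *\<^sub>R (b (C ?\<sigma>) - bS S (C ?\<sigma>)))"
      by (rule Cauchy_Schwarz_ineq2)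
    also have "\<dots> \<le> ((1 + L * \<tau>) * (2 * L * t k)) * (\<tau> * (2 * L))"
      using drift_step_bound[OF \<omega> w' k] xb[OF S] L \<tau> by (intro mult_mono) (auto simp: aC)
    finally show "\<bar>a ?\<sigma> \<bullet> (\<tau> *\<^sub>R (b (C ?\<sigma>) - bS S (C ?\<sigma>)))\<bar> \<le> ((1 + L * \<tau>) * (2 * L * t k)) * (\<tau> * (2 * L))" .
  qed
  \<comment> \<open>With the past frozen, the deviations \<open>b - bS\<close> of all batches add up
    to zero by unbiasedness.\<close>
  also have "\<dots> = 0"
  proof -
    have "(\<Sum>S\<in>A. a \<sigma> \<bullet> (\<tau> *\<^sub>R (b (C \<sigma>) - bS S (C \<sigma>)))) = 0" for \<sigma>
    proof -
      have "(\<Sum>S\<in>A. a \<sigma> \<bullet> (\<tau> *\<^sub>R (b (C \<sigma>) - bS S (C \<sigma>)))) = a \<sigma> \<bullet> (\<tau> *\<^sub>R (\<Sum>S\<in>A. b (C \<sigma>) - bS S (C \<sigma>)))"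
        by (simp only: inner_sum_right scaleR_sum_right)
      also have "(\<Sum>S\<in>A. b (C \<sigma>) - bS S (C \<sigma>)) = 0"
        by (simp add: sum_subtractf bS_mean sum_constant_scaleR del: sum_constant)
      finally show ?thesis by simp
    qed
    then show ?thesis by simp
  qed
  finally show "(\<integral>\<omega>'. drift_step k (\<omega>', \<omega>) \<bullet> batch_step k (\<omega>', \<omega>) \<partial>M') = 0" .
  have "(\<integral>\<omega>'. (norm (batch_step k (\<omega>', \<omega>)))\<^sup>2 \<partial>M')
      = (\<integral>\<omega>'. (\<lambda>S \<sigma>. (norm (\<tau> *\<^sub>R (b (C \<sigma>) - bS S (C \<sigma>))))\<^sup>2) (\<xi> k \<omega>') (\<lambda>j\<in>{..<k}. \<xi> j \<omega>') \<partial>M')"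
    by (simp add: xC)
  also have "\<dots> = (\<integral>\<omega>'. (\<Sum>S\<in>A. (\<lambda>S \<sigma>. (norm (\<tau> *\<^sub>R (b (C \<sigma>) - bS S (C \<sigma>))))\<^sup>2) S (\<lambda>j\<in>{..<k}. \<xi> j \<omega>')) / real (card A) \<partial>M')"
  proof (rule batch_noise_average[OF bn A])
    show "(\<lambda>\<sigma>. (norm (\<tau> *\<^sub>R (b (C \<sigma>) - bS S (C \<sigma>))))\<^sup>2) \<in> borel_measurable (Pi\<^sub>M {..<k} (\<lambda>_. count_space A))" if "S \<in> A" for S
      using bSC[OF that] by measurable
    show "\<bar>(norm (\<tau> *\<^sub>R (b (C \<sigma>) - bS S (C \<sigma>))))\<^sup>2\<bar> \<le> (\<tau> * (2 * L))\<^sup>2" if "S \<in> A" for S \<sigma>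
      using power_mono[OF xb[OF that, of "C \<sigma>"], of 2] by simp
  qed
  also have "\<dots> \<le> \<tau>\<^sup>2 * v"
  proof -
    have le: "(\<Sum>S\<in>A. (norm (\<tau> *\<^sub>R (b (C \<sigma>) - bS S (C \<sigma>))))\<^sup>2) / real (card A) \<le> \<tau>\<^sup>2 * v" for \<sigma>
    proof -
      have "(\<Sum>S\<in>A. (norm (\<tau> *\<^sub>R (b (C \<sigma>) - bS S (C \<sigma>))))\<^sup>2) = \<tau>\<^sup>2 * (\<Sum>S\<in>A. (norm (bS S (C \<sigma>) - b (C \<sigma>)))\<^sup>2)"
        by (simp add: power_mult_distrib sum_distrib_left norm_minus_commute)
      also have "\<dots> \<le> \<tau>\<^sup>2 * (real (card A) * v)" by (intro mult_left_mono bS_var) simp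
      finally show ?thesis using A by (simp add: divide_le_eq card_gt_0_iff mult_ac)
    qed
    have nn: "0 \<le> \<tau>\<^sup>2 * v"
      using le[of undefined] sum_nonneg[of A "\<lambda>S. (norm (\<tau> *\<^sub>R (b (C undefined) - bS S (C undefined))))\<^sup>2"]
      by (smt (verit) divide_nonneg_nonneg of_nat_0_le_iff zero_le_power2)
    \<comment> \<open>If the average is not integrable, its Bochner integral is 0 by convention and
      \<open>nn\<close> closes the case.\<close>
    show ?thesis
    proof (cases "integrable M' (\<lambda>\<omega>'. (\<Sum>S\<in>A. (norm (\<tau> *\<^sub>R (b (C (\<lambda>j\<in>{..<k}. \<xi> j \<omega>')) - bS S (C (\<lambda>j\<in>{..<k}. \<xi> j \<omega>')))))\<^sup>2) / real (card A))")
      case True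
      then show ?thesis
        using integral_mono[OF True, of "\<lambda>_. \<tau>\<^sup>2 * v"] le by (simp add: M'.prob_space)
    next
      case False
      show ?thesis unfolding not_integrable_integral_eq[OF False] by (rule nn)
    qed
  qed
  finally show "(\<integral>\<omega>'. (norm (batch_step k (\<omega>', \<omega>)))\<^sup>2 \<partial>M') \<le> \<tau>\<^sup>2 * v" .
qed

text \<open>Integrate over the batches first, for almost every Brownian path, and apply
  \<open>batch_average\<close>. Both steps are bounded almost surely, which legitimates the exchange
  of integrals.\<close>

lemma integral_batch_step:
  assumes k: "k \<le> m"
  shows "integrable (M' \<Otimes>\<^sub>M M) (\<lambda>q. drift_step k q \<bullet> batch_step k q)"
    and "(\<integral>q. drift_step k q \<bullet> batch_step k q \<partial>(M' \<Otimes>\<^sub>M M)) = 0"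
    and "integrable (M' \<Otimes>\<^sub>M M) (\<lambda>q. (norm (batch_step k q))\<^sup>2)"
    and "(\<integral>q. (norm (batch_step k q))\<^sup>2 \<partial>(M' \<Otimes>\<^sub>M M)) \<le> \<tau>\<^sup>2 * v"
proof -
  note [measurable] = drift_step_measurable[OF k] batch_step_measurable[of k]
  show i1: "integrable (M' \<Otimes>\<^sub>M M) (\<lambda>q. drift_step k q \<bullet> batch_step k q)"
  proof (rule integrable_pair_bounded)
    show "AE q in M' \<Otimes>\<^sub>M M. \<bar>drift_step k q \<bullet> batch_step k q\<bar> \<le> ((1 + L * \<tau>) * (2 * L * t k)) * (\<tau> * (2 * L))"
      using AE_pair_regular
    proof eventually_elim
      case (elim q)
      obtain \<omega>' \<omega> where q: "q = (\<omega>', \<omega>)" by (cases q)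
      have "\<bar>drift_step k q \<bullet> batch_step k q\<bar> \<le> norm (drift_step k q) * norm (batch_step k q)"
        by (rule Cauchy_Schwarz_ineq2)
      also have "\<dots> \<le> ((1 + L * \<tau>) * (2 * L * t k)) * (\<tau> * (2 * L))"
        using drift_step_bound[OF _ _ k] batch_step_bound elim L \<tau> unfolding q by (intro mult_mono) auto
      finally show ?case .
    qed
  qed measurable
  have "(\<integral>q. drift_step k q \<bullet> batch_step k q \<partial>(M' \<Otimes>\<^sub>M M))
      = (\<integral>\<omega>. (\<integral>\<omega>'. drift_step k (\<omega>', \<omega>) \<bullet> batch_step k (\<omega>', \<omega>) \<partial>M') \<partial>M)"
    by (rule integral_pair_swap(1)[OF i1])
  also have "\<dots> = 0"
    using AE_regular_path by (intro integral_eq_zero_AE) (auto elim!: eventually_mono simp: batch_average(1)[OF _ k])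
  finally show "(\<integral>q. drift_step k q \<bullet> batch_step k q \<partial>(M' \<Otimes>\<^sub>M M)) = 0" .
  show i2: "integrable (M' \<Otimes>\<^sub>M M) (\<lambda>q. (norm (batch_step k q))\<^sup>2)"
  proof (rule integrable_pair_bounded)
    show "AE q in M' \<Otimes>\<^sub>M M. \<bar>(norm (batch_step k q))\<^sup>2\<bar> \<le> (\<tau> * (2 * L))\<^sup>2"
      using AE_pair_regular
    proof eventually_elim
      case (elim q)
      then show ?case using power_mono[OF batch_step_bound[of "fst q" k "snd q"], of 2] by simp
    qed
  qed measurable
  have i3: "integrable M (\<lambda>\<omega>. \<integral>\<omega>'. (norm (batch_step k (\<omega>', \<omega>)))\<^sup>2 \<partial>M')"
    by (rule integral_pair_swap(2)[OF i2])
  have "(\<integral>q. (norm (batch_step k q))\<^sup>2 \<partial>(M' \<Otimes>\<^sub>M M)) = (\<integral>\<omega>. (\<integral>\<omega>'. (norm (batch_step k (\<omega>', \<omega>)))\<^sup>2 \<partial>M') \<partial>M)"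
    by (rule integral_pair_swap(1)[OF i2])
  also have "\<dots> \<le> (\<integral>\<omega>. \<tau>\<^sup>2 * v \<partial>M)"
    using i3 AE_regular_path by (intro integral_mono_AE) (auto elim!: eventually_mono simp: batch_average(2)[OF _ k])
  finally show "(\<integral>q. (norm (batch_step k q))\<^sup>2 \<partial>(M' \<Otimes>\<^sub>M M)) \<le> \<tau>\<^sup>2 * v"
    by (simp add: M.prob_space)
qed

lemma variance_nonneg: "0 \<le> v"
proof -
  have "0 \<le> (\<Sum>S\<in>A. (norm (bS S x - b x))\<^sup>2)" by (rule sum_nonneg) simp
  also have "\<dots> \<le> real (card A) * v" by (rule bS_var)
  finally show ?thesis using A by (simp add: zero_le_mult_iff card_gt_0_iff)
qed

text \<open>The constant adds up the three sources: \<open>6 * L ^ 4\<close> and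
  \<open>72 * (real CARD('d))\<^sup>2 * L\<^sup>2\<close> come from \<open>R\<close> (drift part and
  noise part, each tripled by the factor \<open>1 / \<tau> + 3\<close>),
  \<open>6 * real CARD('d) * L\<^sup>2\<close> comes from \<open>G\<close>, and 3 from the batch
  fluctuation. The shape of the right-hand side is the one that \<open>exp_recursion_bound\<close>
  consumes.\<close>

lemma step_recursion:
  assumes k: "k < m"
  shows "(\<integral>q. (norm (err (Suc k) q))\<^sup>2 \<partial>(M' \<Otimes>\<^sub>M M))
    \<le> (1 + \<tau>) * ((1 + L * \<tau>)\<^sup>2 * (\<integral>q. (norm (err k q))\<^sup>2 \<partial>(M' \<Otimes>\<^sub>M M))
       + \<tau> * (6 * L ^ 4 + 72 * (real CARD('d))\<^sup>2 * L\<^sup>2 + 6 * real CARD('d) * L\<^sup>2 + 3) * (v * \<tau> + (1 + D\<^sup>2) * \<tau>\<^sup>2))"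
proof -
  let ?P = "M' \<Otimes>\<^sub>M M"
  let ?d = "real CARD('d)"
  have km: "k \<le> m" "Suc k \<le> m" using k by auto
  obtain H Q where H [measurable]: "H \<in> borel_measurable M" and Q [measurable]: "Q \<in> borel_measurable M"
    and HQ: "AE \<omega> in M. continuous_on {0..} (\<lambda>s. W s \<omega>) \<and>
       H \<omega> = integral {t k..t k + \<tau>} (\<lambda>s. W s \<omega> - W (t k) \<omega>) \<and>
       Q \<omega> = integral {t k..t k + \<tau>} (\<lambda>s. (norm (W s \<omega> - W (t k) \<omega>))\<^sup>2)"
    and H2: "(\<integral>\<^sup>+ \<omega>. ennreal ((norm (H \<omega>))\<^sup>2) \<partial>M) \<le> ennreal (?d * \<tau> ^ 3)"
    and Q2: "(\<integral>\<^sup>+ \<omega>. ennreal ((Q \<omega>)\<^sup>2) \<partial>M) \<le> ennreal (3 * ?d\<^sup>2 * \<tau> ^ 4)"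
    and orth: "\<And>g j c. g \<in> borel_measurable (F (t k)) \<Longrightarrow> (AE \<omega> in M. \<bar>g \<omega>\<bar> \<le> c) \<Longrightarrow> (\<integral>\<omega>. g \<omega> * H \<omega> $ j \<partial>M) = 0"
    by (rule brownian_window[OF BM t_nonneg[of k] \<tau>]) blast
  have moment: "integrable M f \<and> (\<integral>\<omega>. f \<omega> \<partial>M) \<le> c"
    if "f \<in> borel_measurable M" "\<And>\<omega>. 0 \<le> f \<omega>" "(\<integral>\<^sup>+ \<omega>. ennreal (f \<omega>) \<partial>M) \<le> ennreal c" "0 \<le> c" for f :: "'w \<Rightarrow> real" and c
  proof
    show i: "integrable M f"
      using that by (intro integrableI_nonneg) (auto intro: le_less_trans)
    show "(\<integral>\<omega>. f \<omega> \<partial>M) \<le> c"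
      using that nn_integral_eq_integral[OF i] by simp
  qed
  have Hi: "integrable M (\<lambda>\<omega>. (norm (H \<omega>))\<^sup>2)" and HE: "(\<integral>\<omega>. (norm (H \<omega>))\<^sup>2 \<partial>M) \<le> ?d * \<tau> ^ 3"
    using moment[OF _ _ H2] \<tau> by auto
  have Qi: "integrable M (\<lambda>\<omega>. (Q \<omega>)\<^sup>2)" and QE: "(\<integral>\<omega>. (Q \<omega>)\<^sup>2 \<partial>M) \<le> 3 * ?d\<^sup>2 * \<tau> ^ 4"
    using moment[OF _ _ Q2] \<tau> by auto
  have Hji: "integrable M (\<lambda>\<omega>. H \<omega> $ j)" for j
  proof (rule Bochner_Integration.integrable_bound)
    show "integrable M (\<lambda>\<omega>. 1 + (norm (H \<omega>))\<^sup>2)" using Hi by simp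
    show "AE \<omega> in M. norm (H \<omega> $ j) \<le> norm (1 + (norm (H \<omega>))\<^sup>2)"
    proof (rule AE_I2)
      fix \<omega>
      have "0 \<le> (norm (H \<omega>) - 1)\<^sup>2" by simp
      then have "norm (H \<omega>) \<le> 1 + (norm (H \<omega>))\<^sup>2"
        by (simp add: power2_diff) (smt (verit) norm_ge_zero)
      then show "norm (H \<omega> $ j) \<le> norm (1 + (norm (H \<omega>))\<^sup>2)"
        using component_le_norm_cart[of "H \<omega>" j] by simp
    qed
  qed measurable

  define G where "G \<omega> = s *\<^sub>R Db (Y (t k) \<omega>) (H \<omega>)" for \<omega>
  \<comment> \<open>Defined by subtraction, which makes \<open>err_Suc\<close> an identity at every
    point; that \<open>R\<close> is the remainder estimated in \<open>drift_window_remainder\<close>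
    is known on regular paths.\<close>
  define R where "R \<omega> = Y (t (Suc k)) \<omega> - Y (t k) \<omega> - s *\<^sub>R (W (t (Suc k)) \<omega> - W (t k) \<omega>) - \<tau> *\<^sub>R b (Y (t k) \<omega>) - G \<omega>" for \<omega>
  have DbY [measurable]: "(\<lambda>\<omega>. Db (Y (t k) \<omega>) h) \<in> borel_measurable M" for h
    by (rule measurable_compose[OF Y_measurable[OF km(1)] Db_measurable])
  have G_measurable [measurable]: "G \<in> borel_measurable M"
    unfolding G_def[abs_def] by (subst Db_expand) measurable
  have R_measurable [measurable]: "R \<in> borel_measurable M"
  proof -
    have "(\<lambda>\<omega>. W (t (Suc k)) \<omega> - W (t k) \<omega>) \<in> borel_measurable M"
      using \<tau> by (intro brownian_increment_measurable[OF BM]) auto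
    then show ?thesis
      unfolding R_def[abs_def] using Y_measurable[OF km(1)] Y_measurable[OF km(2)] by measurable
  qed
  have err_Suc: "err (Suc k) q = drift_step k q + R (snd q) + G (snd q) + batch_step k q" for q
    unfolding err_def Z_Suc R_def drift_step_def batch_step_def by (simp add: algebra_simps del: of_nat_Suc)

  have G_bound: "(norm (G \<omega>))\<^sup>2 \<le> 2 * D * L\<^sup>2 * (norm (H \<omega>))\<^sup>2" for \<omega>
  proof -
    have "(norm (G \<omega>))\<^sup>2 = 2 * D * (norm (Db (Y (t k) \<omega>) (H \<omega>)))\<^sup>2"
      using D by (simp add: G_def power_mult_distrib)
    also have "\<dots> \<le> 2 * D * (L * norm (H \<omega>))\<^sup>2"
      using D Db_bound by (intro mult_left_mono power_mono) auto
    finally show ?thesis by (simp add: power_mult_distrib)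
  qed
  have Gi: "integrable M (\<lambda>\<omega>. (norm (G \<omega>))\<^sup>2)"
    by (rule Bochner_Integration.integrable_bound[OF integrable_mult_right[OF Hi, of "2 * D * L\<^sup>2"]])
      (use G_bound D in \<open>auto intro!: AE_I2\<close>)
  have GE: "(\<integral>\<omega>. (norm (G \<omega>))\<^sup>2 \<partial>M) \<le> 2 * D * L\<^sup>2 * (?d * \<tau> ^ 3)"
  proof -
    have "(\<integral>\<omega>. (norm (G \<omega>))\<^sup>2 \<partial>M) \<le> (\<integral>\<omega>. 2 * D * L\<^sup>2 * (norm (H \<omega>))\<^sup>2 \<partial>M)"
      using Gi Hi G_bound by (intro integral_mono) auto
    also have "\<dots> = 2 * D * L\<^sup>2 * (\<integral>\<omega>. (norm (H \<omega>))\<^sup>2 \<partial>M)" by simp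
    also have "\<dots> \<le> 2 * D * L\<^sup>2 * (?d * \<tau> ^ 3)" using HE D by (intro mult_left_mono) auto
    finally show ?thesis .
  qed

  have R_bound: "AE \<omega> in M. (norm (R \<omega>))\<^sup>2 \<le> 2 * L ^ 4 * \<tau> ^ 4 + 8 * D\<^sup>2 * L\<^sup>2 * (Q \<omega>)\<^sup>2"
    using AE_regular_path HQ
  proof eventually_elim
    case (elim \<omega>)
    let ?S = "{t k..t k + \<tau>}"
    have sub: "?S \<subseteq> {0..t m}"
      using t_mono[OF km(2)] t_Suc[of k] t_nonneg[of k] by (intro subsetI) (simp only: atLeastAtMost_iff, linarith)
    have Yinc: "\<And>u. u \<in> ?S \<Longrightarrow> Y u \<omega> = Y (t k) \<omega> + integral {t k..u} (\<lambda>r. b (Y r \<omega>)) + s *\<^sub>R (W u \<omega> - W (t k) \<omega>)"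
      by (rule Y_increment[OF elim(1) k])
    have "R \<omega> = integral ?S (\<lambda>u. b (Y u \<omega>)) - \<tau> *\<^sub>R b (Y (t k) \<omega>) - s *\<^sub>R Db (Y (t k) \<omega>) (integral ?S (\<lambda>u. W u \<omega> - W (t k) \<omega>))"
      using Yinc[of "t k + \<tau>"] elim(2) \<tau> unfolding R_def G_def t_Suc by simp
    also have "norm \<dots> \<le> L\<^sup>2 * \<tau>\<^sup>2 + s\<^sup>2 * L * integral ?S (\<lambda>u. (norm (W u \<omega> - W (t k) \<omega>))\<^sup>2)"
    proof (rule drift_window_remainder[OF \<tau> L _ _ Yinc b_bound b_lip b_taylor Db_linear])
      show "continuous_on ?S (\<lambda>u. Y u \<omega>)"
        using elim(1) sub unfolding regular_path_def by (blast intro: continuous_on_subset)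
      show "continuous_on ?S (\<lambda>u. W u \<omega>)"
        using elim(2) by (rule continuous_on_subset[OF conjunct1]) (use t_nonneg[of k] in auto)
    qed
    finally have "norm (R \<omega>) \<le> L\<^sup>2 * \<tau>\<^sup>2 + 2 * D * L * Q \<omega>" using elim(2) D by simp
    then have "(norm (R \<omega>))\<^sup>2 \<le> (L\<^sup>2 * \<tau>\<^sup>2 + 2 * D * L * Q \<omega>)\<^sup>2" by (rule power_mono) simp
    also have "\<dots> \<le> 2 * (L\<^sup>2 * \<tau>\<^sup>2)\<^sup>2 + 2 * (2 * D * L * Q \<omega>)\<^sup>2"
      using zero_le_power2[of "L\<^sup>2 * \<tau>\<^sup>2 - 2 * D * L * Q \<omega>"] unfolding power2_sum power2_diff by linarith
    finally show ?case by (simp add: power_mult_distrib power_even_eq[symmetric] flip: power_mult)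
  qed
  have Ri: "integrable M (\<lambda>\<omega>. (norm (R \<omega>))\<^sup>2)"
  proof (rule Bochner_Integration.integrable_bound)
    show "integrable M (\<lambda>\<omega>. 2 * L ^ 4 * \<tau> ^ 4 + 8 * D\<^sup>2 * L\<^sup>2 * (Q \<omega>)\<^sup>2)" using Qi by simp
  qed (use R_bound in \<open>auto elim!: eventually_mono\<close>)
  have RE: "(\<integral>\<omega>. (norm (R \<omega>))\<^sup>2 \<partial>M) \<le> 2 * L ^ 4 * \<tau> ^ 4 + 8 * D\<^sup>2 * L\<^sup>2 * (3 * ?d\<^sup>2 * \<tau> ^ 4)"
  proof -
    have "(\<integral>\<omega>. (norm (R \<omega>))\<^sup>2 \<partial>M) \<le> (\<integral>\<omega>. 2 * L ^ 4 * \<tau> ^ 4 + 8 * D\<^sup>2 * L\<^sup>2 * (Q \<omega>)\<^sup>2 \<partial>M)"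
      using Ri Qi R_bound by (intro integral_mono_AE) auto
    also have "\<dots> = 2 * L ^ 4 * \<tau> ^ 4 + 8 * D\<^sup>2 * L\<^sup>2 * (\<integral>\<omega>. (Q \<omega>)\<^sup>2 \<partial>M)"
      using Qi by (simp add: M.prob_space)
    also have "\<dots> \<le> 2 * L ^ 4 * \<tau> ^ 4 + 8 * D\<^sup>2 * L\<^sup>2 * (3 * ?d\<^sup>2 * \<tau> ^ 4)"
      using QE by (intro add_left_mono mult_left_mono) auto
    finally show ?thesis .
  qed

  let ?c = "(1 + L * \<tau>) * (2 * L * t k)"
  have AE_drift: "AE q in ?P. norm (drift_step k q) \<le> ?c"
    using AE_pair_regular by eventually_elim (metis drift_step_bound[OF _ _ km(1)] prod.collapse)
  note [measurable] = drift_step_measurable[OF km(1)] batch_step_measurable[of k] err_measurable[OF km(1)]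
  have Ai: "integrable ?P (\<lambda>q. (norm (drift_step k q))\<^sup>2)"
  proof (rule integrable_pair_bounded)
    show "AE q in ?P. \<bar>(norm (drift_step k q))\<^sup>2\<bar> \<le> ?c\<^sup>2"
      using AE_drift by eventually_elim (simp add: power_mono)
  qed measurable
  have ei: "integrable ?P (\<lambda>q. (norm (err k q))\<^sup>2)" if "k \<le> m" for k
  proof (rule integrable_pair_bounded)
    show "(\<lambda>q. (norm (err k q))\<^sup>2) \<in> borel_measurable ?P" using err_measurable[OF that] by measurable
    show "AE q in ?P. \<bar>(norm (err k q))\<^sup>2\<bar> \<le> (2 * L * t k)\<^sup>2"
      using AE_err_bound[OF that] by eventually_elim (simp add: power_mono)
  qed
  have AE': "(\<integral>q. (norm (drift_step k q))\<^sup>2 \<partial>?P) \<le> (1 + L * \<tau>)\<^sup>2 * (\<integral>q. (norm (err k q))\<^sup>2 \<partial>?P)"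
  proof -
    have "(\<integral>q. (norm (drift_step k q))\<^sup>2 \<partial>?P) \<le> (\<integral>q. (1 + L * \<tau>)\<^sup>2 * (norm (err k q))\<^sup>2 \<partial>?P)"
      using Ai ei[OF km(1)] power_mono[OF drift_step_norm, of k _ 2]
      by (intro integral_mono) (auto simp: power_mult_distrib)
    then show ?thesis by simp
  qed

  \<comment> \<open>Unlike the drift and batch steps, \<open>G\<close> is unbounded; its product
    with \<open>drift_step\<close> is dominated through its second moment.\<close>
  have AG_bound: "AE q in ?P. \<bar>drift_step k q \<bullet> G (snd q)\<bar> \<le> ?c * (1 + (norm (G (snd q)))\<^sup>2)"
    using AE_drift
  proof eventually_elim
    case (elim q)
    have "0 \<le> (norm (G (snd q)) - 1)\<^sup>2" by simp
    then have g: "norm (G (snd q)) \<le> 1 + (norm (G (snd q)))\<^sup>2"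
      by (simp add: power2_diff) (smt (verit) norm_ge_zero)
    have "\<bar>drift_step k q \<bullet> G (snd q)\<bar> \<le> norm (drift_step k q) * norm (G (snd q))" by (rule Cauchy_Schwarz_ineq2)
    also have "\<dots> \<le> ?c * (1 + (norm (G (snd q)))\<^sup>2)"
      using elim g by (intro mult_mono order_trans[OF norm_ge_zero elim]) auto
    finally show ?case .
  qed
  have AGi: "integrable ?P (\<lambda>q. drift_step k q \<bullet> G (snd q))"
  proof (rule Bochner_Integration.integrable_bound)
    have "integrable M (\<lambda>\<omega>. ?c * (1 + (norm (G \<omega>))\<^sup>2))" using Gi by simp
    then show "integrable ?P (\<lambda>q. ?c * (1 + (norm (G (snd q)))\<^sup>2))" by (rule integrable_snd_lift(1))
    show "AE q in ?P. norm (drift_step k q \<bullet> G (snd q)) \<le> norm (?c * (1 + (norm (G (snd q)))\<^sup>2))"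
      using AG_bound by eventually_elim simp
  qed measurable
  \<comment> \<open>Here the Brownian path is integrated first, with the batches frozen.
    \<open>Db_expand\<close> writes the product as a sum of bounded
    \<open>F (t k)\<close>-measurable coefficients \<open>g j\<close> times the coordinates of
    \<open>H\<close>, and \<open>orth\<close> annihilates each term.\<close>
  have AGE: "(\<integral>q. drift_step k q \<bullet> G (snd q) \<partial>?P) = 0"
  proof -
    have "(\<integral>\<omega>. drift_step k (\<omega>', \<omega>) \<bullet> G \<omega> \<partial>M) = 0" if w': "\<omega>' \<in> space M'" for \<omega>'
    proof -
      define g where "g j \<omega> = drift_step k (\<omega>', \<omega>) \<bullet> (s *\<^sub>R Db (Y (t k) \<omega>) (axis j 1))" for j \<omega>
      have gF: "g j \<in> borel_measurable (F (t k))" for j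
      proof -
        note [measurable] = drift_step_adapted[OF w' km(1)] measurable_compose[OF Y_adapted[OF km(1)] Db_measurable]
        show ?thesis unfolding g_def[abs_def] by measurable
      qed
      have gc: "AE \<omega> in M. \<bar>g j \<omega>\<bar> \<le> ?c * (s * L)" for j
        using AE_regular_path
      proof eventually_elim
        case (elim \<omega>)
        have "\<bar>g j \<omega>\<bar> \<le> norm (drift_step k (\<omega>', \<omega>)) * norm (s *\<^sub>R Db (Y (t k) \<omega>) (axis j 1))"
          unfolding g_def by (rule Cauchy_Schwarz_ineq2)
        also have "\<dots> \<le> ?c * (s * L)"
        proof (rule mult_mono)
          show "norm (drift_step k (\<omega>', \<omega>)) \<le> ?c" by (rule drift_step_bound[OF elim w' km(1)])
          show "norm (s *\<^sub>R Db (Y (t k) \<omega>) (axis j 1)) \<le> s * L"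
            using Db_bound[of "Y (t k) \<omega>" "axis j 1"] D by (simp add: norm_axis_1 mult_left_mono)
          show "0 \<le> ?c" using drift_step_bound[OF elim w' km(1)] by (rule order_trans[OF norm_ge_zero])
        qed simp
        finally show ?case .
      qed
      have gM: "g j \<in> borel_measurable M" for j by (rule measurable_from_subalg[OF F_subalgebra gF])
      have gi: "integrable M (\<lambda>\<omega>. g j \<omega> * H \<omega> $ j)" for j
      proof (rule Bochner_Integration.integrable_bound)
        show "integrable M (\<lambda>\<omega>. (?c * (s * L)) * \<bar>H \<omega> $ j\<bar>)"
          using Hji[of j] by (intro integrable_mult_right integrable_abs)
        show "(\<lambda>\<omega>. g j \<omega> * H \<omega> $ j) \<in> borel_measurable M" using gM[of j] by measurable
        show "AE \<omega> in M. norm (g j \<omega> * H \<omega> $ j) \<le> norm ((?c * (s * L)) * \<bar>H \<omega> $ j\<bar>)"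
          using gc[of j]
        proof eventually_elim
          case (elim \<omega>)
          then have "\<bar>g j \<omega>\<bar> * \<bar>H \<omega> $ j\<bar> \<le> (?c * (s * L)) * \<bar>H \<omega> $ j\<bar>" by (intro mult_right_mono) auto
          also have "\<dots> \<le> \<bar>(?c * (s * L)) * \<bar>H \<omega> $ j\<bar>\<bar>" by (rule abs_ge_self)
          finally show ?case by (simp add: abs_mult)
        qed
      qed
      have "drift_step k (\<omega>', \<omega>) \<bullet> G \<omega> = (\<Sum>j\<in>UNIV. g j \<omega> * H \<omega> $ j)" for \<omega>
      proof -
        have "G \<omega> = s *\<^sub>R (\<Sum>j\<in>UNIV. H \<omega> $ j *\<^sub>R Db (Y (t k) \<omega>) (axis j 1))"
          unfolding G_def by (subst Db_expand) simp
        then show ?thesis by (simp add: g_def inner_sum_right sum_distrib_left mult_ac)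
      qed
      then have "(\<integral>\<omega>. drift_step k (\<omega>', \<omega>) \<bullet> G \<omega> \<partial>M) = (\<Sum>j\<in>UNIV. \<integral>\<omega>. g j \<omega> * H \<omega> $ j \<partial>M)"
        using gi by simp
      then show ?thesis using orth[OF gF gc] by simp
    qed
    then have "(\<integral>\<omega>'. \<integral>\<omega>. drift_step k (\<omega>', \<omega>) \<bullet> G \<omega> \<partial>M \<partial>M') = 0"
      by (simp cong: Bochner_Integration.integral_cong)
    then show ?thesis using P.integral_fst'[OF AGi] by simp
  qed

  note bs = integral_batch_step[OF km(1)]
  note Gl = integrable_snd_lift[OF Gi] and Rl = integrable_snd_lift[OF Ri]
  have "(\<integral>q. (norm (err (Suc k) q))\<^sup>2 \<partial>?P) \<le> (\<integral>q. (1 + \<tau>) * (norm (drift_step k q))\<^sup>2 + (1 / \<tau> + 3) * (norm (R (snd q)))\<^sup>2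
      + 3 * (norm (G (snd q)))\<^sup>2 + 3 * (norm (batch_step k q))\<^sup>2 + 2 * (drift_step k q \<bullet> G (snd q)) + 2 * (drift_step k q \<bullet> batch_step k q) \<partial>?P)"
    using ei[OF km(2)] Ai Rl(1) Gl(1) bs AGi norm_power2_sum4_le[OF \<tau>]
    by (intro integral_mono) (auto simp: err_Suc)
  also have "\<dots> = (1 + \<tau>) * (\<integral>q. (norm (drift_step k q))\<^sup>2 \<partial>?P) + (1 / \<tau> + 3) * (\<integral>\<omega>. (norm (R \<omega>))\<^sup>2 \<partial>M)
      + 3 * (\<integral>\<omega>. (norm (G \<omega>))\<^sup>2 \<partial>M) + 3 * (\<integral>q. (norm (batch_step k q))\<^sup>2 \<partial>?P)"
    using Ai Rl Gl bs AGi AGE by simp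
  also have "\<dots> \<le> (1 + \<tau>) * ((1 + L * \<tau>)\<^sup>2 * (\<integral>q. (norm (err k q))\<^sup>2 \<partial>?P))
      + (1 / \<tau> + 3) * (2 * L ^ 4 * \<tau> ^ 4 + 8 * D\<^sup>2 * L\<^sup>2 * (3 * ?d\<^sup>2 * \<tau> ^ 4))
      + 3 * (2 * D * L\<^sup>2 * (?d * \<tau> ^ 3)) + 3 * (\<tau>\<^sup>2 * v)"
    using AE' RE GE bs(4) \<tau> by (intro add_mono mult_left_mono) auto
  also have "\<dots> \<le> (1 + \<tau>) * ((1 + L * \<tau>)\<^sup>2 * (\<integral>q. (norm (err k q))\<^sup>2 \<partial>?P)
       + \<tau> * (6 * L ^ 4 + 72 * ?d\<^sup>2 * L\<^sup>2 + 6 * ?d * L\<^sup>2 + 3) * (v * \<tau> + (1 + D\<^sup>2) * \<tau>\<^sup>2))"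
  proof -
    note v = variance_nonneg
    define e where "e = (1 + D\<^sup>2) * \<tau> ^ 3"
    \<comment> \<open>\<open>G\<close> contributes a term linear in \<open>D\<close>, whereas the
      right-hand side offers \<open>1 + D\<^sup>2\<close>.\<close>
    have "0 \<le> (D - 1)\<^sup>2" by simp
    then have D1: "D \<le> 1 + D\<^sup>2" by (simp add: power2_diff) (use D in linarith)
    \<comment> \<open>Young's factor \<open>1 / \<tau>\<close> lowers \<open>\<tau> ^ 4\<close> to
      \<open>\<tau> ^ 3\<close>; the rest, \<open>1 + 3 * \<tau>\<close>, goes into three times the
      common factor \<open>1 + \<tau>\<close>, whatever the size of \<tau>.\<close>
    have t1: "(1 / \<tau> + 3) * \<tau> ^ 4 \<le> 3 * (1 + \<tau>) * \<tau> ^ 3"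
    proof -
      have "(1 / \<tau> + 3) * \<tau> ^ 4 = (1 + 3 * \<tau>) * \<tau> ^ 3"
        using \<tau> by (simp add: field_simps power_numeral_reduce)
      also have "\<dots> \<le> (3 * (1 + \<tau>)) * \<tau> ^ 3" using \<tau> by (intro mult_right_mono) auto
      finally show ?thesis by simp
    qed
    have "(1 / \<tau> + 3) * (2 * L ^ 4 * \<tau> ^ 4 + 8 * D\<^sup>2 * L\<^sup>2 * (3 * ?d\<^sup>2 * \<tau> ^ 4))
        = (2 * L ^ 4 + 24 * ?d\<^sup>2 * L\<^sup>2 * D\<^sup>2) * ((1 / \<tau> + 3) * \<tau> ^ 4)"
      by (simp add: algebra_simps)
    also have "\<dots> \<le> ((2 * L ^ 4 + 24 * ?d\<^sup>2 * L\<^sup>2) * (1 + D\<^sup>2)) * (3 * (1 + \<tau>) * \<tau> ^ 3)"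
    proof (rule mult_mono[OF _ t1])
      have "0 \<le> 2 * L ^ 4 * D\<^sup>2 + 24 * ?d\<^sup>2 * L\<^sup>2" by simp
      then show "2 * L ^ 4 + 24 * ?d\<^sup>2 * L\<^sup>2 * D\<^sup>2 \<le> (2 * L ^ 4 + 24 * ?d\<^sup>2 * L\<^sup>2) * (1 + D\<^sup>2)"
        by (simp add: algebra_simps)
    qed (use \<tau> in auto)
    also have "\<dots> = (1 + \<tau>) * ((6 * L ^ 4 + 72 * ?d\<^sup>2 * L\<^sup>2) * e)"
      by (simp add: e_def algebra_simps)
    finally have r: "(1 / \<tau> + 3) * (2 * L ^ 4 * \<tau> ^ 4 + 8 * D\<^sup>2 * L\<^sup>2 * (3 * ?d\<^sup>2 * \<tau> ^ 4)) \<le> (1 + \<tau>) * ((6 * L ^ 4 + 72 * ?d\<^sup>2 * L\<^sup>2) * e)" .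
    have "3 * (2 * D * L\<^sup>2 * (?d * \<tau> ^ 3)) = D * (6 * ?d * L\<^sup>2 * \<tau> ^ 3)" by simp
    also have "\<dots> \<le> (1 + D\<^sup>2) * (6 * ?d * L\<^sup>2 * \<tau> ^ 3)" using D1 \<tau> by (intro mult_right_mono) auto
    also have "\<dots> = 1 * ((6 * ?d * L\<^sup>2) * e)" by (simp add: e_def)
    also have "\<dots> \<le> (1 + \<tau>) * ((6 * ?d * L\<^sup>2) * e)" using \<tau> by (intro mult_right_mono) (auto simp: e_def)
    finally have g: "3 * (2 * D * L\<^sup>2 * (?d * \<tau> ^ 3)) \<le> (1 + \<tau>) * ((6 * ?d * L\<^sup>2) * e)" .
    have "3 * (\<tau>\<^sup>2 * v) = 1 * (3 * (\<tau>\<^sup>2 * v))" by simp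
    also have "\<dots> \<le> (1 + \<tau>) * (3 * (\<tau>\<^sup>2 * v))" using \<tau> v by (intro mult_right_mono) auto
    finally have b: "3 * (\<tau>\<^sup>2 * v) \<le> (1 + \<tau>) * (3 * (\<tau>\<^sup>2 * v))" .
    \<comment> \<open>The full constant multiplies both summands, so the right-hand side exceeds the
      three estimates by this nonnegative surplus.\<close>
    have "0 \<le> (1 + \<tau>) * (3 * e + (6 * L ^ 4 + 72 * ?d\<^sup>2 * L\<^sup>2 + 6 * ?d * L\<^sup>2) * (\<tau>\<^sup>2 * v))"
      using \<tau> v by (auto simp: e_def)
    moreover have "\<tau> * (6 * L ^ 4 + 72 * ?d\<^sup>2 * L\<^sup>2 + 6 * ?d * L\<^sup>2 + 3) * (v * \<tau> + (1 + D\<^sup>2) * \<tau>\<^sup>2)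
        = (6 * L ^ 4 + 72 * ?d\<^sup>2 * L\<^sup>2) * e + (6 * ?d * L\<^sup>2) * e + 3 * (\<tau>\<^sup>2 * v)
          + (3 * e + (6 * L ^ 4 + 72 * ?d\<^sup>2 * L\<^sup>2 + 6 * ?d * L\<^sup>2) * (\<tau>\<^sup>2 * v))"
      by (simp add: e_def algebra_simps power2_eq_square power3_eq_cube)
    ultimately show ?thesis using r g b by (simp only: distrib_left)
  qed
  finally show ?thesis .
qed

lemma err_second_moment:
  "(\<integral>q. (norm (err m q))\<^sup>2 \<partial>(M' \<Otimes>\<^sub>M M))
    \<le> (6 * L ^ 4 + 72 * (real CARD('d))\<^sup>2 * L\<^sup>2 + 6 * real CARD('d) * L\<^sup>2 + 3)
       * (exp ((2 + 2 * L) * (real m * \<tau>)) - 1) * (v * \<tau> + (1 + D\<^sup>2) * \<tau>\<^sup>2)"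
proof (rule exp_recursion_bound[OF \<tau> L, where a = "\<lambda>k. \<integral>q. (norm (err k q))\<^sup>2 \<partial>(M' \<Otimes>\<^sub>M M)" and m = m])
  show "0 \<le> v * \<tau> + (1 + D\<^sup>2) * \<tau>\<^sup>2" using \<tau> variance_nonneg by simp
  \<comment> \<open>Both processes start at \<open>x\<close>: \<open>AE_err_bound\<close> at step 0
    has right-hand side 0.\<close>
  have "AE q in M' \<Otimes>\<^sub>M M. (norm (err 0 q))\<^sup>2 = 0"
    using AE_err_bound[of 0, OF le0] by eventually_elim simp
  then have "(\<integral>q. (norm (err 0 q))\<^sup>2 \<partial>(M' \<Otimes>\<^sub>M M)) = 0" by (rule integral_eq_zero_AE)
  then show "(\<integral>q. (norm (err 0 q))\<^sup>2 \<partial>(M' \<Otimes>\<^sub>M M)) \<le> 0" by simp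
qed (use step_recursion in auto)

text \<open>The joint law of \<open>Y\<close> and \<open>Z\<close> at the final time is one
  admissible coupling, so the infimum is at most its cost. Its marginals, taken on the product
  space, are traced back to \<open>M\<close> and \<open>M'\<close>.\<close>

lemma W2_le:
  "W2 (distr M borel (Y (t m))) (distr M' borel (\<lambda>\<omega>. rb_chain bS D \<tau> (\<lambda>k. \<xi> k \<omega>) (\<lambda>k. z k \<omega>) x m))
    \<le> ennreal (sqrt (\<integral>q. (norm (err m q))\<^sup>2 \<partial>(M' \<Otimes>\<^sub>M M)))"
proof -
  let ?P = "M' \<Otimes>\<^sub>M M"
  have law: "distr M' borel (\<lambda>\<omega>. rb_chain bS D \<tau> (\<lambda>k. \<xi> k \<omega>) (\<lambda>k. z k \<omega>) x m) = distr ?P borel (Z m)"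
    unfolding Z_def[abs_def] by (rule rb_chain_coupling_distr(2)[OF BM \<tau> bn bS_measurable A(1,2)])
  note Ym [measurable] = Y_measurable[of m, OF order_refl] Y_measurable_pair[of m, OF order_refl]
  have lawY: "distr ?P borel (\<lambda>q. Y (t m) (snd q)) = distr M borel (Y (t m))"
  proof -
    have "distr ?P borel (\<lambda>q. Y (t m) (snd q)) = distr (distr ?P M snd) borel (Y (t m))"
      by (subst distr_distr) (auto simp: comp_def)
    then show ?thesis by (simp add: M'.distr_pair_snd[OF M.sigma_finite_measure_axioms])
  qed
  define \<gamma> where "\<gamma> = distr ?P (borel \<Otimes>\<^sub>M borel) (\<lambda>q. (Y (t m) (snd q), Z m q))"
  have pm [measurable]: "(\<lambda>q. (Y (t m) (snd q), Z m q)) \<in> measurable ?P (borel \<Otimes>\<^sub>M borel)" by measurable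
  have "\<gamma> \<in> couplings (distr M borel (Y (t m))) (distr ?P borel (Z m))"
    unfolding couplings_def \<gamma>_def
    by (simp add: distr_distr comp_def lawY)
  then have "(INF \<gamma>\<in>couplings (distr M borel (Y (t m))) (distr ?P borel (Z m)). \<integral>\<^sup>+ q. ennreal ((norm (fst q - snd q))\<^sup>2) \<partial>\<gamma>)
      \<le> (\<integral>\<^sup>+ q. ennreal ((norm (fst q - snd q))\<^sup>2) \<partial>\<gamma>)"
    by (rule INF_lower)
  also have "\<dots> = (\<integral>\<^sup>+ q. ennreal ((norm (err m q))\<^sup>2) \<partial>?P)"
    unfolding \<gamma>_def by (subst nn_integral_distr) (auto simp: err_def)
  also have "\<dots> = ennreal (\<integral>q. (norm (err m q))\<^sup>2 \<partial>?P)"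
  proof (rule nn_integral_eq_integral)
    show "integrable ?P (\<lambda>q. (norm (err m q))\<^sup>2)"
    proof (rule integrable_pair_bounded)
      show "(\<lambda>q. (norm (err m q))\<^sup>2) \<in> borel_measurable ?P" using err_measurable[of m] by measurable
      show "AE q in ?P. \<bar>(norm (err m q))\<^sup>2\<bar> \<le> (2 * L * t m)\<^sup>2"
        using AE_err_bound[of m] by (simp add: power_mono eventually_mono)
    qed
  qed simp
  finally have le: "(INF \<gamma>\<in>couplings (distr M borel (Y (t m))) (distr ?P borel (Z m)). \<integral>\<^sup>+ q. ennreal ((norm (fst q - snd q))\<^sup>2) \<partial>\<gamma>)
      \<le> ennreal (\<integral>q. (norm (err m q))\<^sup>2 \<partial>?P)" .
  have mono: "ennreal_sqrt a \<le> ennreal (sqrt c)" if "a \<le> ennreal c" "0 \<le> c" for a c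
  proof -
    have "a \<noteq> \<top>" using that by (auto simp: top_unique)
    moreover have "enn2real a \<le> c" using that enn2real_mono[of a "ennreal c"] by simp
    ultimately show ?thesis by (simp add: ennreal_sqrt_def ennreal_leI)
  qed
  show ?thesis unfolding W2_def law by (rule mono[OF le]) simp
qed

end

section \<open>The drifts of the particle system\<close>

definition full_drift_deriv ::
    "real \<Rightarrow> (real ^ 'd::finite \<Rightarrow> real) \<Rightarrow> (real ^ 'd \<Rightarrow> real) \<Rightarrow> nat \<Rightarrow> nat \<Rightarrow> (nat \<Rightarrow> real ^ 'd) \<Rightarrow>
     real ^ 'd \<Rightarrow> real ^ 'd \<Rightarrow> real ^ 'd" where
  "full_drift_deriv lam V U1 N i xs y h =
     - (lam *\<^sub>R hess V y h + (1 / (real N - 1)) *\<^sub>R (\<Sum>j\<in>{1..N} - {i}. hess U1 (y - xs j) h))"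

lemma norm_average_le:
  fixes f :: "'b \<Rightarrow> 'a::real_normed_vector"
  assumes "real (card S) = r" "0 < r" "\<And>j. norm (f j) \<le> B"
  shows "norm ((1 / r) *\<^sub>R (\<Sum>j\<in>S. f j)) \<le> B"
proof -
  have "norm (\<Sum>j\<in>S. f j) \<le> r * B"
    using sum_norm_le[of S f "\<lambda>_. B"] assms by simp
  then show ?thesis using assms by (simp add: field_simps)
qed

text \<open>Origin of the factor \<open>\<Lambda> + 1\<close>: weight at most \<Lambda> for the
  external force, weight 1 for the averaged interaction.\<close>

lemma norm_weighted_drift_le:
  fixes a c :: "'a::real_normed_vector"
  assumes "0 \<le> lam" "lam \<le> \<Lambda>" "norm a \<le> B" "norm c \<le> B"
  shows "norm (- (lam *\<^sub>R a + c)) \<le> (\<Lambda> + 1) * B"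
proof -
  have "norm (lam *\<^sub>R a) \<le> \<Lambda> * B"
    using assms by (simp add: mult_mono)
  then show ?thesis
    using norm_triangle_mono[of "lam *\<^sub>R a" "\<Lambda> * B" c B] assms
    unfolding norm_minus_cancel by (simp add: distrib_right)
qed

context
  fixes V U1 :: "real ^ 'd::finite \<Rightarrow> real" and N i p :: nat and xs :: "nat \<Rightarrow> real ^ 'd" and lam \<Lambda> K :: real
  assumes i: "i \<in> {1..N}" and p: "1 < p" "p \<le> N" and lam: "0 \<le> lam" "lam \<le> \<Lambda>"
    and V: "smooth V" "derivs_bounded K V" and U1: "smooth U1" "derivs_bounded K U1"
begin

section \<open>Bounds, regularity and batch statistics of the particle drifts\<close>

lemma K_nonneg: "0 \<le> K"
  by (rule derivs_bound_nonneg[OF V])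

text \<open>The sup, Lipschitz and Taylor estimates carry the first, second and third power of the
  dimension; raising all of them to the third lets a single \<open>L\<close> serve in the
  coupling.\<close>

lemma card_power_le:
  "real CARD('d) * K \<le> real CARD('d) ^ 3 * K" "real CARD('d) * (real CARD('d) * K) \<le> real CARD('d) ^ 3 * K"
proof -
  have "real CARD('d) ^ 1 \<le> real CARD('d) ^ 3" "real CARD('d) ^ 2 \<le> real CARD('d) ^ 3"
    by (rule power_increasing, simp, rule one_le_card_finite)+
  then have "real CARD('d) ^ 1 * K \<le> real CARD('d) ^ 3 * K" "real CARD('d) ^ 2 * K \<le> real CARD('d) ^ 3 * K"
    using K_nonneg by (auto intro: mult_right_mono)
  then show "real CARD('d) * K \<le> real CARD('d) ^ 3 * K" "real CARD('d) * (real CARD('d) * K) \<le> real CARD('d) ^ 3 * K"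
    by (simp_all add: power2_eq_square mult.assoc)
qed

lemma real_card_others: "real (card ({1..N} - {i})) = real N - 1" "0 < real N - 1"
  using card_others[OF i] p by auto

lemma full_drift_bound: "norm (full_drift lam V U1 N i xs y) \<le> ((\<Lambda> + 1) * (real CARD('d) ^ 3 * K))"
  unfolding full_drift_def
  by (intro norm_weighted_drift_le lam norm_average_le real_card_others)
    (rule order_trans[OF norm_grad_le card_power_le(1)], (rule V U1)+)+

lemma batch_drift_bound: "S \<in> batches N i p \<Longrightarrow> norm (batch_drift lam V U1 p S xs y) \<le> ((\<Lambda> + 1) * (real CARD('d) ^ 3 * K))"
  unfolding batch_drift_def using p
  by (intro norm_weighted_drift_le lam norm_average_le)
    ((rule order_trans[OF norm_grad_le card_power_le(1)], (rule V U1)+ | auto simp: batches_def)+)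

lemma full_drift_deriv_bound: "norm (full_drift_deriv lam V U1 N i xs y h) \<le> ((\<Lambda> + 1) * (real CARD('d) ^ 3 * K)) * norm h"
proof -
  have *: "norm (hess f z h) \<le> real CARD('d) ^ 3 * K * norm h" if "smooth f" "derivs_bounded K f" for f :: "real ^ 'd \<Rightarrow> real" and z
    using norm_hess_le[OF that, of z h] mult_right_mono[OF card_power_le(2), of "norm h"] by (simp add: mult.assoc)
  have "norm (full_drift_deriv lam V U1 N i xs y h) \<le> (\<Lambda> + 1) * (real CARD('d) ^ 3 * K * norm h)"
    unfolding full_drift_deriv_def
    by (intro norm_weighted_drift_le lam norm_average_le real_card_others *[OF V] *[OF U1])
  then show ?thesis by (simp add: mult.assoc)
qed

lemma full_drift_lipschitz:
  "norm (full_drift lam V U1 N i xs y' - full_drift lam V U1 N i xs y) \<le> ((\<Lambda> + 1) * (real CARD('d) ^ 3 * K)) * norm (y' - y)"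
proof -
  have *: "norm (grad f z' - grad f z) \<le> real CARD('d) ^ 3 * K * norm (z' - z)" if "smooth f" "derivs_bounded K f" for f :: "real ^ 'd \<Rightarrow> real" and z z'
    using grad_lipschitz[OF that, of z' z] mult_right_mono[OF card_power_le(2), of "norm (z' - z)"] by (simp add: mult.assoc)
  have "full_drift lam V U1 N i xs y' - full_drift lam V U1 N i xs y
    = - (lam *\<^sub>R (grad V y' - grad V y) + (1 / (real N - 1)) *\<^sub>R (\<Sum>j\<in>{1..N} - {i}. grad U1 (y' - xs j) - grad U1 (y - xs j)))"
    unfolding full_drift_def by (simp add: sum_subtractf scaleR_diff_right)
  also have "norm \<dots> \<le> (\<Lambda> + 1) * (real CARD('d) ^ 3 * K * norm (y' - y))"
  proof (intro norm_weighted_drift_le lam norm_average_le real_card_others *[OF V])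
    show "norm (grad U1 (y' - xs j) - grad U1 (y - xs j)) \<le> real CARD('d) ^ 3 * K * norm (y' - y)" for j
      using *[OF U1, of "y' - xs j" "y - xs j"] by simp
  qed
  finally show ?thesis by (simp add: mult.assoc)
qed

lemma full_drift_taylor:
  "norm (full_drift lam V U1 N i xs (y + h) - full_drift lam V U1 N i xs y - full_drift_deriv lam V U1 N i xs y h) \<le> ((\<Lambda> + 1) * (real CARD('d) ^ 3 * K)) * (norm h)\<^sup>2"
proof -
  have *: "norm (grad f (z + h) - grad f z - hess f z h) \<le> real CARD('d) ^ 3 * K * (norm h)\<^sup>2" if "smooth f" "derivs_bounded K f" for f :: "real ^ 'd \<Rightarrow> real" and z
    using grad_taylor[OF that, of z h] by (simp add: power3_eq_cube mult.assoc)
  have "full_drift lam V U1 N i xs (y + h) - full_drift lam V U1 N i xs y - full_drift_deriv lam V U1 N i xs y h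
    = - (lam *\<^sub>R (grad V (y + h) - grad V y - hess V y h)
        + (1 / (real N - 1)) *\<^sub>R (\<Sum>j\<in>{1..N} - {i}. grad U1 (y + h - xs j) - grad U1 (y - xs j) - hess U1 (y - xs j) h))"
    unfolding full_drift_def full_drift_deriv_def by (simp add: sum_subtractf scaleR_diff_right)
  also have "norm \<dots> \<le> (\<Lambda> + 1) * (real CARD('d) ^ 3 * K * (norm h)\<^sup>2)"
  proof (intro norm_weighted_drift_le lam norm_average_le real_card_others *[OF V])
    show "norm (grad U1 (y + h - xs j) - grad U1 (y - xs j) - hess U1 (y - xs j) h) \<le> real CARD('d) ^ 3 * K * (norm h)\<^sup>2" for j
      using *[OF U1, of "y - xs j"] by (simp add: algebra_simps)
  qed
  finally show ?thesis by (simp add: mult.assoc)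
qed

lemma linear_full_drift_deriv: "linear (full_drift_deriv lam V U1 N i xs y)"
  unfolding full_drift_deriv_def[abs_def]
  by (intro linear_compose_neg linear_compose_add linear_compose_scale_right linear_compose_sum ballI linear_hess)

lemma continuous_on_grad_shift: "continuous_on UNIV (\<lambda>y. grad U1 (y - a))"
  by (rule continuous_on_compose2[OF continuous_on_grad[OF U1]]) (auto intro!: continuous_intros)

lemma continuous_on_batch_drift: "continuous_on UNIV (batch_drift lam V U1 p S xs)"
  unfolding batch_drift_def[abs_def]
  by (intro continuous_intros continuous_on_grad[OF V] continuous_on_grad_shift)

lemma continuous_on_full_drift_deriv: "continuous_on UNIV (\<lambda>y. full_drift_deriv lam V U1 N i xs y h)"
proof -
  have "continuous_on UNIV (\<lambda>y. hess U1 (y - xs j) h)" for j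
    by (rule continuous_on_compose2[OF continuous_on_hess[OF U1, of h]]) (auto intro!: continuous_intros)
  then show ?thesis
    unfolding full_drift_deriv_def by (intro continuous_intros continuous_on_hess[OF V])
qed

lemma batch_drift_mean:
  "(\<Sum>S\<in>batches N i p. batch_drift lam V U1 p S xs y) = real (card (batches N i p)) *\<^sub>R full_drift lam V U1 N i xs y"
  unfolding batch_drift_def full_drift_def
  by (simp only: sum_negf sum.distrib batch_mean[OF i p] sum_constant_scaleR scaleR_minus_right scaleR_add_right)

text \<open>Bounded first derivatives make the set of values bounded above, so that the real-valued
  supremum really is an upper bound.\<close>

lemma norm_grad_le_SUP: "norm (grad U1 y) \<le> (SUP x. norm (grad U1 x))"
  using norm_grad_le[OF U1] by (intro cSUP_upper bdd_aboveI2) auto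

text \<open>The external force is common to both drifts and cancels, which is why only the sup norm
  of \<open>grad U1\<close> appears.\<close>

lemma batch_drift_variance:
  "(\<Sum>S\<in>batches N i p. (norm (batch_drift lam V U1 p S xs y - full_drift lam V U1 N i xs y))\<^sup>2)
    \<le> real (card (batches N i p)) * ((SUP x. norm (grad U1 x))\<^sup>2 / (real p - 1))"
proof -
  have "norm (batch_drift lam V U1 p S xs y - full_drift lam V U1 N i xs y)
    = norm ((1 / (real p - 1)) *\<^sub>R (\<Sum>j\<in>S. grad U1 (y - xs j)) - (1 / (real N - 1)) *\<^sub>R (\<Sum>j\<in>{1..N} - {i}. grad U1 (y - xs j)))" for S
    unfolding batch_drift_def full_drift_def by (simp add: norm_minus_commute)
  then show ?thesis using batch_variance[OF i p norm_grad_le_SUP] by simp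
qed

lemma random_batch_coupling_particles:
  assumes "brownian_motion M F W"
    and "sde_solution M F W (full_drift lam V U1 N i xs) (sqrt (2 * D)) x (real m * \<tau>) Y"
    and "batch_noise M' N i p \<xi> z" and "0 < \<tau>" "0 \<le> D"
  shows "random_batch_coupling M F W x Y M' N i p \<xi> z (full_drift lam V U1 N i xs) (full_drift_deriv lam V U1 N i xs)
    (\<lambda>S. batch_drift lam V U1 p S xs) (batches N i p) D \<tau> ((\<Lambda> + 1) * (real CARD('d) ^ 3 * K)) ((SUP x. norm (grad U1 x))\<^sup>2 / (real p - 1)) m"
proof (rule random_batch_coupling.intro)
  show "0 \<le> ((\<Lambda> + 1) * (real CARD('d) ^ 3 * K))" using lam K_nonneg by simp
qed (use assms finite_batches batches_nonempty[OF i p] full_drift_bound full_drift_lipschitz full_drift_taylor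
    linear_full_drift_deriv full_drift_deriv_bound continuous_on_full_drift_deriv continuous_on_batch_drift
    batch_drift_bound batch_drift_mean batch_drift_variance in auto)

end

theorem theorem3p1:
  fixes K Lam :: real
  shows "\<exists>C>0. \<forall>(V :: real ^ 'd::finite \<Rightarrow> real) (U1 :: real ^ 'd \<Rightarrow> real)
      (N :: nat) (i :: nat) (p :: nat) (xs :: nat \<Rightarrow> real ^ 'd)
      (w :: real) (\<beta> :: real) (lam :: real) (D :: real) (\<tau> :: real) (T :: real) (m :: nat)
      (M :: 'w measure) (F :: real \<Rightarrow> 'w measure) (W :: real \<Rightarrow> 'w \<Rightarrow> real ^ 'd)
      (Y :: real ^ 'd \<Rightarrow> real \<Rightarrow> 'w \<Rightarrow> real ^ 'd)
      (M' :: 'v measure) (\<xi> :: nat \<Rightarrow> 'v \<Rightarrow> nat set) (z :: nat \<Rightarrow> 'v \<Rightarrow> real ^ 'd).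
    i \<in> {1..N} \<and> 1 < p \<and> p \<le> N \<and> 0 < w \<and> 0 < \<beta> \<and>
    lam = 1 / (w * (real N - 1)) \<and> D = 1 / (\<beta> * w\<^sup>2 * (real N - 1)) \<and> lam \<le> Lam \<and>
    smooth V \<and> smooth U1 \<and> derivs_bounded K V \<and> derivs_bounded K U1 \<and>
    0 < \<tau> \<and> 0 < T \<and> real m * \<tau> = T \<and>
    brownian_motion M F W \<and>
    (\<forall>x. sde_solution M F W (full_drift lam V U1 N i xs) (sqrt (2 * D)) x T (Y x)) \<and>
    batch_noise M' N i p \<xi> z
    \<longrightarrow>
    (SUP x. W2 (distr M borel (Y x T))
       (distr M' borel (\<lambda>\<omega>. rb_chain (\<lambda>S. batch_drift lam V U1 p S xs) D \<tau>
          (\<lambda>k. \<xi> k \<omega>) (\<lambda>k. z k \<omega>) x m)))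
    \<le> ennreal (C * sqrt ((exp (C * T) - 1) *
         (1 / (real p - 1) * (SUP x. norm (grad U1 x)) * \<tau> + (1 + D\<^sup>2) * \<tau>\<^sup>2)))"
proof -
  let ?d = "real CARD('d)"
  define L where "L = (Lam + 1) * (?d ^ 3 * K)"
  define C0 where "C0 = 6 * L ^ 4 + 72 * ?d\<^sup>2 * L\<^sup>2 + 6 * ?d * L\<^sup>2 + 3"
  \<comment> \<open>The batch variance brings the square of the sup norm of \<open>grad U1\<close>,
    the claim has its first power: one factor is at most \<open>?d * K\<close> and is absorbed here.
    The 1 in the maximum lets the same \<kappa> multiply the term
    \<open>(1 + D\<^sup>2) * \<tau>\<^sup>2\<close>.\<close>
  define \<kappa> where "\<kappa> = max 1 (?d * K)"
  \<comment> \<open>\<open>C\<close> dominates \<open>2 + 2 * L\<close> in the exponent and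
    \<open>sqrt (C0 * \<kappa>)\<close> in front of the root. The 2 secures positivity at a stage
    where no potential is given yet and \<open>K\<close> and \<open>Lam\<close> are arbitrary
    reals.\<close>
  define C where "C = max 2 (max (2 + 2 * L) (sqrt (C0 * \<kappa>)))"
  have C: "0 < C" "2 + 2 * L \<le> C" "sqrt (C0 * \<kappa>) \<le> C" by (auto simp: C_def)
  have C0: "0 \<le> C0" and \<kappa>: "1 \<le> \<kappa>" "?d * K \<le> \<kappa>" by (auto simp: C0_def \<kappa>_def)
  show ?thesis
  proof (intro exI[of _ C] conjI C(1) allI impI SUP_least, elim conjE)
    fix V U1 :: "real ^ 'd \<Rightarrow> real" and N i p :: nat and xs :: "nat \<Rightarrow> real ^ 'd" and w \<beta> lam D \<tau> T :: real and m :: nat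
      and M :: "'w measure" and F W and Y :: "real ^ 'd \<Rightarrow> real \<Rightarrow> 'w \<Rightarrow> real ^ 'd"
      and M' :: "'v measure" and \<xi> and z :: "nat \<Rightarrow> 'v \<Rightarrow> real ^ 'd" and x :: "real ^ 'd"
    assume h: "i \<in> {1..N}" "1 < p" "p \<le> N" "0 < w" "0 < \<beta>" "lam = 1 / (w * (real N - 1))"
      "D = 1 / (\<beta> * w\<^sup>2 * (real N - 1))" "lam \<le> Lam" "smooth V" "smooth U1" "derivs_bounded K V" "derivs_bounded K U1"
      "0 < \<tau>" "0 < T" "real m * \<tau> = T" "brownian_motion M F W"
      "\<forall>x. sde_solution M F W (full_drift lam V U1 N i xs) (sqrt (2 * D)) x T (Y x)" "batch_noise M' N i p \<xi> z"
    have N: "0 < real N - 1" using h by linarith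
    have lam: "0 \<le> lam" and D: "0 \<le> D" using h N by auto
    have K: "0 \<le> K" by (rule derivs_bound_nonneg[OF h(9,11)])
    have L: "0 \<le> L" using lam h(8) K by (simp add: L_def)
    let ?G = "SUP x. norm (grad U1 x)"
    have G: "norm (grad U1 0) \<le> ?G"
      by (rule norm_grad_le_SUP[OF h(1-3) lam h(8,9,11,10,12)])
    then have G0: "0 \<le> ?G" by (rule order_trans[OF norm_ge_zero])
    have Gd: "?G \<le> ?d * K" by (intro cSUP_least norm_grad_le[OF h(10,12)]) simp
    define q where "q = 1 / (real p - 1) * ?G * \<tau> + (1 + D\<^sup>2) * \<tau>\<^sup>2"
    have q: "0 \<le> q" using G0 h(2,13) by (simp add: q_def)
    interpret random_batch_coupling M F W x "Y x" M' N i p \<xi> z "full_drift lam V U1 N i xs" "full_drift_deriv lam V U1 N i xs"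
      "\<lambda>S. batch_drift lam V U1 p S xs" "batches N i p" D \<tau> L "?G\<^sup>2 / (real p - 1)" m
      unfolding L_def
      by (rule random_batch_coupling_particles[OF h(1-3) lam h(8,9,11,10,12)]) (use h D in auto)
    have "?G\<^sup>2 / (real p - 1) * \<tau> + (1 + D\<^sup>2) * \<tau>\<^sup>2 \<le> \<kappa> * q"
    proof -
      have "?G\<^sup>2 / (real p - 1) * \<tau> = ?G * (1 / (real p - 1) * ?G * \<tau>)" by (simp add: power2_eq_square)
      also have "\<dots> \<le> \<kappa> * (1 / (real p - 1) * ?G * \<tau>)"
        using Gd \<kappa> G0 h(2,13) by (intro mult_right_mono) auto
      finally have "?G\<^sup>2 / (real p - 1) * \<tau> \<le> \<kappa> * (1 / (real p - 1) * ?G * \<tau>)" .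
      moreover have "1 * ((1 + D\<^sup>2) * \<tau>\<^sup>2) \<le> \<kappa> * ((1 + D\<^sup>2) * \<tau>\<^sup>2)"
        using \<kappa> by (intro mult_right_mono) auto
      ultimately show ?thesis by (simp add: q_def distrib_left)
    qed
    moreover have "0 \<le> ?G\<^sup>2 / (real p - 1) * \<tau> + (1 + D\<^sup>2) * \<tau>\<^sup>2" using h(2,13) by simp
    moreover have e: "0 \<le> exp ((2 + 2 * L) * T) - 1" "exp ((2 + 2 * L) * T) - 1 \<le> exp (C * T) - 1"
      using L h(14) C(2) by (auto intro: mult_right_mono)
    ultimately have "C0 * (exp ((2 + 2 * L) * T) - 1) * (?G\<^sup>2 / (real p - 1) * \<tau> + (1 + D\<^sup>2) * \<tau>\<^sup>2)
        \<le> C0 * (exp (C * T) - 1) * (\<kappa> * q)"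
      using C0 \<kappa> q by (intro mult_mono mult_left_mono) auto
    with err_second_moment
    have "(\<integral>q. (norm (err m q))\<^sup>2 \<partial>(M' \<Otimes>\<^sub>M M)) \<le> (C0 * \<kappa>) * ((exp (C * T) - 1) * q)"
      unfolding h(15) C0_def by (simp add: mult_ac)
    then have "sqrt (\<integral>q. (norm (err m q))\<^sup>2 \<partial>(M' \<Otimes>\<^sub>M M)) \<le> sqrt (C0 * \<kappa>) * sqrt ((exp (C * T) - 1) * q)"
      by (simp flip: real_sqrt_mult)
    also have "\<dots> \<le> C * sqrt ((exp (C * T) - 1) * q)"
      using e q C(3) by (intro mult_right_mono) auto
    finally show "W2 (distr M borel (Y x T)) (distr M' borel (\<lambda>\<omega>. rb_chain (\<lambda>S. batch_drift lam V U1 p S xs) D \<tau>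
          (\<lambda>k. \<xi> k \<omega>) (\<lambda>k. z k \<omega>) x m))
      \<le> ennreal (C * sqrt ((exp (C * T) - 1) * (1 / (real p - 1) * ?G * \<tau> + (1 + D\<^sup>2) * \<tau>\<^sup>2)))"
      using W2_le unfolding h(15) q_def by (meson ennreal_leI order_trans)
  qed
qed

end
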